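(* Let $\nu\in\mathbb R$, let $M,L\ge 0$ be integers with $\nu\le L\le M+\nu$, let $0<\gamma\le 1$, and let $T\in SIO_\nu(M+\gamma)$. Assume that $T^*(x^\alpha)=0$ for all $|\alpha|\le L$ and that $T$ satisfies $WBP_\nu$. Fix $\psi,\tilde\psi\in\mathcal D_P$ for $P$ sufficiently large, and define $\lambda_{j,k}(x,y)=\langle T^*\psi_j^x,\tilde\psi_k^y\rangle$ for $j,k\in\mathbb Z$ and $x,y\in\mathbb R^n$. Let $\widetilde L=\lfloor L-\nu\rfloor$. Then $$|D_x^\alpha D_y^\beta\lambda_{j,k}(x,y)|\lesssim 2^{(\nu+|\alpha|)j+|\beta|k}\,2^{(\widetilde L+\gamma')\min(0,j-k)}\,\Phi_{\min(j,k)}^{n+\nu+M+\gamma}(x-y)$$ and $$|D_x^\alpha D_y^\beta\lambda_{j,k}(x+h,y)-D_x^\alpha D_y^\beta\lambda_{j,k}(x,y)|\lesssim 2^{j(\nu+|\alpha|)+k|\beta|}(2^j|h|)^{\gamma'-\delta}\,2^{\min(0,j-k)(\widetilde L+\delta)}\,\Phi_{\min(j,k)}^{n+\nu+M+\gamma}(x-y)$$ for all $\alpha,\beta\in\mathbb N_0^n$, $0\le\delta\le\gamma'<\gamma$, and $x,y,h\in\mathbb R^n$ satisfying $|h|<(2^{-\min(j,k)}+|x-y|)/2$.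
   Context: Test functions. $\mathscr S$ is the Schwartz class on $\mathbb R^n$; for $P\in\mathbb N_0$, $\mathscr S_P\subset\mathscr S$ is the closed subspace of functions with $\int f(x)x^\alpha dx=0$ for $|\alpha|\le P$; $\mathcal D_P\subset C_0^\infty$ is the subspace of functions with vanishing moments up to order $P$; $\mathcal D_P'$ is its dual. $\langle\cdot,\cdot\rangle$ is the bilinear pairing. A linear map $T:\mathscr S_P\to\mathscr S'$ is continuous if there is $\mathcal K\in\mathscr S'(\mathbb R^{2n})$ with $\langle Tf,g\rangle=\langle\mathcal K,g\otimes f\rangle$ for $f\in\mathscr S_P,g\in\mathscr S$. "$T$ and $T^*$ are continuous from $\mathscr S_P$ into $\mathscr S'$" means $T$ is, and there is another operator $T^*$ (the transpose), also continuous from $\mathscr S_P$ into $\mathscr S'$, with $\langle Tf,g\rangle=\langle T^*g,f\rangle$ for $f,g\in\mathscr S_P$. $SIO_\nu(M+\gamma)$ ($\nu\in\mathbb R$, $M\in\mathbb N_0$, $0<\gamma\le1$): linear operators $T$ such that, for some $P\in\mathbb N_0$, $T$ and $T^*$ are continuous from $\mathscr S_P$ into $\mathscr S'$, and there is a function $K(x,y)$ with $\langle Tf,g\rangle=\int_{\mathbb R^{2n}}K(x,y)f(y)g(x)\,dy\,dx$ for all $(f,g)\in\mathcal D_P\times C_0^\infty$ or $(f,g)\in C_0^\infty\times\mathcal D_P$ with disjoint supports, $|D_x^\alpha D_y^\beta K(x,y)|\lesssim|x-y|^{-(n+\nu+|\alpha|+|\beta|)}$ for $x\ne y$, $|\alpha|+|\beta|\le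 M$, and $|D_x^\alpha D_y^\beta K(x+h,y)-D_x^\alpha D_y^\beta K(x,y)|+|D_x^\alpha D_y^\beta K(x,y)-D_x^\alpha D_y^\beta K(x,y+h)|\lesssim|h|^\gamma|x-y|^{-(n+\nu+M+\gamma)}$ for $|h|<|x-y|/2$, $|\alpha|+|\beta|=M$. $WBP_\nu$: $T\in SIO_\nu$ satisfies $WBP_\nu$ if there are integers $M',N\ge0$ and $C>0$ with $|\langle T\psi,\varphi\rangle|+|\langle T^*\psi,\varphi\rangle|\le C|B|^{1-\nu/n}$ for every ball $B$ and all $\psi\in\mathcal D_{M'}$, $\varphi\in C_0^\infty$ supported in $B$ with $\|D^\alpha\psi\|_{L^\infty},\|D^\alpha\varphi\|_{L^\infty}\le|B|^{-|\alpha|/n}$ for $|\alpha|\le N$. Moments: for $T\in SIO_\nu(M+\gamma)$, let $P$ be as in the definition of $SIO_\nu(M+\gamma)$, taken so that $P\ge M+|\nu|$, let $\eta\in\mathcal D_{2P}$ with $\eta=1$ on $B(0,1)$, $\eta_R(x)=\eta(x/R)$. For $|\alpha|<M+\nu+\gamma$, $\langle T(x^\alpha),\psi\rangle=\lim_{R\to\infty}\langle T(x^\alpha\eta_R),\psi\rangle$ for $\psi\in\mathcal D_P$ (well defined, independent of $\eta$). $T(x^\alpha)=0$ means that for some integer $P\ge0$, $T(x^\alpha)=0$ in $\mathcal D_P'$. $T^*(x^\alpha)$ is defined in the same way with $T^*$ in place of $T$. Other notation: $\psi_k(x)=2^{kn}\psi(2^kx)$; $\psi_k^x(u)=\psi_k(x-u)$;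 convolution kernel functions such as $\psi,\tilde\psi$ are taken radial by convention; $\Phi_k^N(x)=2^{kn}(1+2^k|x|)^{-N}$; $A\lesssim B$ means $A\le CB$ with $C$ independent of $j,k,x,y,h$. *)

theory Defs
  imports "HOL-Analysis.Analysis"
begin

section \<open>Multi-indices and partial derivatives\<close>

definition mi_order :: "('n::finite \<Rightarrow> nat) \<Rightarrow> nat"
  where "mi_order \<alpha> = (\<Sum>i\<in>UNIV. \<alpha> i)"

definition vpow :: "real ^ 'n::finite \<Rightarrow> ('n \<Rightarrow> nat) \<Rightarrow> real"
  where "vpow x \<alpha> = (\<Prod>i\<in>UNIV. (x $ i) ^ \<alpha> i)"

definition partial_deriv :: "'n::finite \<Rightarrow> (real ^ 'n \<Rightarrow> complex) \<Rightarrow> real ^ 'n \<Rightarrow> complex"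
  where "partial_deriv i f x = frechet_derivative f (at x) (axis i 1)"

text \<open>An index type carries no order, so the iterated derivative uses one fixed enumeration of
  the coordinates; the choice is immaterial for functions of class \<open>C\<^sup>k\<close>, \<open>k = mi_order \<alpha>\<close>.\<close>

definition coords :: "'n::finite list"
  where "coords = (SOME is. distinct is \<and> set is = UNIV)"

definition multi_deriv :: "('n::finite \<Rightarrow> nat) \<Rightarrow> (real ^ 'n \<Rightarrow> complex) \<Rightarrow> real ^ 'n \<Rightarrow> complex"
  where "multi_deriv \<alpha> f = foldr (\<lambda>i. partial_deriv i ^^ \<alpha> i) coords f"

definition multi_deriv2 ::
    "('n::finite \<Rightarrow> nat) \<Rightarrow> ('n \<Rightarrow> nat) \<Rightarrow> (real ^ 'n \<Rightarrow> real ^ 'n \<Rightarrow> complex) \<Rightarrow> real ^ 'n \<Rightarrow> real ^ 'n \<Rightarrow> complex"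
  where "multi_deriv2 \<alpha> \<beta> F x y = multi_deriv \<alpha> (\<lambda>u. multi_deriv \<beta> (\<lambda>v. F u v) y) x"

text \<open>The domain \<open>S\<close> below is always open.\<close>

fun Ck_on :: "nat \<Rightarrow> 'a::euclidean_space set \<Rightarrow> ('a \<Rightarrow> complex) \<Rightarrow> bool"
  where
    "Ck_on 0 S f \<longleftrightarrow> continuous_on S f"
  | "Ck_on (Suc k) S f \<longleftrightarrow> (\<forall>x\<in>S. f differentiable (at x)) \<and>
       (\<forall>b\<in>Basis. Ck_on k S (\<lambda>x. frechet_derivative f (at x) b))"

definition smooth :: "('a::euclidean_space \<Rightarrow> complex) \<Rightarrow> bool"
  where "smooth f \<longleftrightarrow> (\<forall>k. Ck_on k UNIV f)"


section \<open>Test functions and tempered distributions\<close>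

definition supp :: "('a::topological_space \<Rightarrow> complex) \<Rightarrow> 'a set"
  where "supp f = closure {x. f x \<noteq> 0}"

definition schwartz :: "(real ^ 'n::finite \<Rightarrow> complex) set"
  where "schwartz = {f. smooth f \<and> (\<forall>\<alpha> \<beta>. bounded (range (\<lambda>x. vpow x \<alpha> *\<^sub>R multi_deriv \<beta> f x)))}"

definition test_fns :: "(real ^ 'n::finite \<Rightarrow> complex) set"
  where "test_fns = {f. smooth f \<and> compact (supp f)}"

definition vanishing_moments :: "nat \<Rightarrow> (real ^ 'n::finite \<Rightarrow> complex) \<Rightarrow> bool"
  where "vanishing_moments P f \<longleftrightarrow>
    (\<forall>\<alpha>. mi_order \<alpha> \<le> P \<longrightarrow> (LINT x|lborel. vpow x \<alpha> *\<^sub>R f x) = 0)"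

text \<open>The spaces \<open>\<S>\<^sub>P\<close> and \<open>\<D>\<^sub>P\<close>.\<close>

definition schwartz0 :: "nat \<Rightarrow> (real ^ 'n::finite \<Rightarrow> complex) set"
  where "schwartz0 P = {f \<in> schwartz. vanishing_moments P f}"

definition test_fns0 :: "nat \<Rightarrow> (real ^ 'n::finite \<Rightarrow> complex) set"
  where "test_fns0 P = {f \<in> test_fns. vanishing_moments P f}"

definition schwartz_seminorm :: "nat \<Rightarrow> (real ^ 'n::finite \<Rightarrow> complex) \<Rightarrow> real"
  where "schwartz_seminorm N f =
    (\<Sum>(\<alpha>, \<beta>) \<in> {(\<alpha>, \<beta>). mi_order \<alpha> \<le> N \<and> mi_order \<beta> \<le> N}.
      (SUP x. norm (vpow x \<alpha> *\<^sub>R multi_deriv \<beta> f x)))"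

text \<open>Distributions are functionals on all functions; only their values on the Schwartz class
  matter.  The pairing is bilinear (no complex conjugation).\<close>

definition tempered :: "((real ^ 'n::finite \<Rightarrow> complex) \<Rightarrow> complex) \<Rightarrow> bool"
  where "tempered u \<longleftrightarrow>
    (\<forall>f\<in>schwartz. \<forall>g\<in>schwartz. u (\<lambda>x. f x + g x) = u f + u g) \<and>
    (\<forall>c. \<forall>f\<in>schwartz. u (\<lambda>x. c * f x) = c * u f) \<and>
    (\<exists>N C. \<forall>f\<in>schwartz. norm (u f) \<le> C * schwartz_seminorm N f)"

text \<open>\<open>\<real>\<^sup>2\<^sup>n\<close> is \<open>real ^ ('n + 'n)\<close>, the first factor being indexed by \<open>Inl\<close>.\<close>

definition tensor ::
    "(real ^ 'n::finite \<Rightarrow> complex) \<Rightarrow> (real ^ 'n \<Rightarrow> complex) \<Rightarrow> real ^ ('n + 'n) \<Rightarrow> complex"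
  where "tensor g f z = g (\<chi> i. z $ Inl i) * f (\<chi> i. z $ Inr i)"


section \<open>Singular integral operators\<close>

text \<open>An operator is represented by its bilinear form: \<open>T f g\<close> stands for \<open>\<langle>T f, g\<rangle>\<close>, so that
  \<open>T f\<close> is itself a distribution.\<close>

type_synonym 'n oper = "(real ^ 'n \<Rightarrow> complex) \<Rightarrow> (real ^ 'n \<Rightarrow> complex) \<Rightarrow> complex"

definition continuous_oper :: "nat \<Rightarrow> ('n::finite) oper \<Rightarrow> bool"
  where "continuous_oper P T \<longleftrightarrow>
    (\<forall>f\<in>schwartz0 P. tempered (T f)) \<and>
    (\<forall>f1\<in>schwartz0 P. \<forall>f2\<in>schwartz0 P. \<forall>g\<in>schwartz. T (\<lambda>x. f1 x + f2 x) g = T f1 g + T f2 g) \<and>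
    (\<forall>c. \<forall>f\<in>schwartz0 P. \<forall>g\<in>schwartz. T (\<lambda>x. c * f x) g = c * T f g) \<and>
    (\<exists>\<K>. tempered \<K> \<and> (\<forall>f\<in>schwartz0 P. \<forall>g\<in>schwartz. T f g = \<K> (tensor g f)))"

definition SIO_kernel ::
    "real \<Rightarrow> nat \<Rightarrow> real \<Rightarrow> (real ^ 'n::finite \<Rightarrow> real ^ 'n \<Rightarrow> complex) \<Rightarrow> bool"
  where "SIO_kernel \<nu> M \<gamma> K \<longleftrightarrow>
    Ck_on M {(x, y). x \<noteq> y} (\<lambda>(x, y). K x y) \<and>
    (\<exists>C. \<forall>\<alpha> \<beta> x y. mi_order \<alpha> + mi_order \<beta> \<le> M \<and> x \<noteq> y \<longrightarrow>
       norm (multi_deriv2 \<alpha> \<beta> K x y)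
         \<le> C * norm (x - y) powr - (real CARD('n) + \<nu> + real (mi_order \<alpha>) + real (mi_order \<beta>))) \<and>
    (\<exists>C. \<forall>\<alpha> \<beta> x y h. mi_order \<alpha> + mi_order \<beta> = M \<and> norm h < norm (x - y) / 2 \<longrightarrow>
       norm (multi_deriv2 \<alpha> \<beta> K (x + h) y - multi_deriv2 \<alpha> \<beta> K x y)
       + norm (multi_deriv2 \<alpha> \<beta> K x y - multi_deriv2 \<alpha> \<beta> K x (y + h))
         \<le> C * norm h powr \<gamma> * norm (x - y) powr - (real CARD('n) + \<nu> + real M + \<gamma>))"

text \<open>\<open>T\<close> belongs to \<open>SIO\<^sub>\<nu>(M + \<gamma>)\<close>, with transpose \<open>Ts\<close> and with \<open>P\<close> as the order of the
  vanishing moments.  The transpose is an explicit argument because it is part of the data: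
  \<open>\<langle>T f, g\<rangle> = \<langle>Ts g, f\<rangle>\<close> on \<open>\<S>\<^sub>P\<close> determines \<open>Ts g\<close> on \<open>\<S>\<^sub>P\<close> only.
  If \<open>f\<close> is not in \<open>\<S>\<^sub>P\<close> but \<open>g\<close> is, \<open>\<langle>T f, g\<rangle>\<close> is understood as \<open>\<langle>Ts g, f\<rangle>\<close>.\<close>

definition SIO_at :: "nat \<Rightarrow> real \<Rightarrow> nat \<Rightarrow> real \<Rightarrow> ('n::finite) oper \<Rightarrow> 'n oper \<Rightarrow> bool"
  where "SIO_at P \<nu> M \<gamma> T Ts \<longleftrightarrow>
    continuous_oper P T \<and> continuous_oper P Ts \<and>
    (\<forall>f\<in>schwartz0 P. \<forall>g\<in>schwartz0 P. T f g = Ts g f) \<and>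
    (\<exists>K. SIO_kernel \<nu> M \<gamma> K \<and>
      (\<forall>f\<in>test_fns0 P. \<forall>g\<in>test_fns. supp f \<inter> supp g = {} \<longrightarrow>
         T f g = (LINT (x, y)|lborel. K x y * f y * g x)) \<and>
      (\<forall>f\<in>test_fns. \<forall>g\<in>test_fns0 P. supp f \<inter> supp g = {} \<longrightarrow>
         Ts g f = (LINT (x, y)|lborel. K x y * f y * g x)))"

definition SIO :: "real \<Rightarrow> nat \<Rightarrow> real \<Rightarrow> ('n::finite) oper \<Rightarrow> 'n oper \<Rightarrow> bool"
  where "SIO \<nu> M \<gamma> T Ts \<longleftrightarrow> (\<exists>P. SIO_at P \<nu> M \<gamma> T Ts)"

text \<open>\<open>M'\<close> may always be enlarged, so the \<open>\<psi>\<close> below can be taken in the domain of \<open>T\<close> and \<open>Ts\<close>.\<close>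

definition WBP :: "real \<Rightarrow> ('n::finite) oper \<Rightarrow> 'n oper \<Rightarrow> bool"
  where "WBP \<nu> T Ts \<longleftrightarrow>
    (\<exists>M' N. \<exists>C>0. \<forall>c r. r > 0 \<longrightarrow> (let vol = measure lborel (ball (c :: real ^ 'n) r) in
      \<forall>\<psi>\<in>test_fns0 M'. \<forall>\<phi>\<in>test_fns.
        supp \<psi> \<subseteq> ball c r \<and> supp \<phi> \<subseteq> ball c r \<and>
        (\<forall>\<alpha> x. mi_order \<alpha> \<le> N \<longrightarrow>
           norm (multi_deriv \<alpha> \<psi> x) \<le> vol powr (- real (mi_order \<alpha>) / real CARD('n)) \<and>
           norm (multi_deriv \<alpha> \<phi> x) \<le> vol powr (- real (mi_order \<alpha>) / real CARD('n)))
        \<longrightarrow> norm (T \<psi> \<phi>) + norm (Ts \<psi> \<phi>) \<le> C * vol powr (1 - \<nu> / real CARD('n))))"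

text \<open>\<open>\<langle>T(x\<^sup>\<alpha>), \<psi>\<rangle> = l\<close>, as the limit over dilated cutoffs.\<close>

definition monomial_pairing ::
    "nat \<Rightarrow> ('n::finite) oper \<Rightarrow> ('n \<Rightarrow> nat) \<Rightarrow> (real ^ 'n \<Rightarrow> complex) \<Rightarrow> complex \<Rightarrow> bool"
  where "monomial_pairing P T \<alpha> \<psi> l \<longleftrightarrow>
    (\<forall>\<eta>\<in>test_fns0 (2 * P). (\<forall>x\<in>ball 0 1. \<eta> x = 1) \<longrightarrow>
       ((\<lambda>R::real. T (\<lambda>x. vpow x \<alpha> *\<^sub>R \<eta> (x /\<^sub>R R)) \<psi>) \<longlongrightarrow> l) at_top)"

text \<open>\<open>T(x\<^sup>\<alpha>) = 0\<close> for an operator in \<open>SIO\<^sub>\<nu>(M + \<gamma>)\<close> with transpose \<open>Ts\<close>.  Since \<open>SIO_at P\<close>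
  passes to larger \<open>P\<close> and \<open>\<D>\<^sub>P\<close> decreases in \<open>P\<close>, one \<open>P\<close> serves both for the definition of
  \<open>T(x\<^sup>\<alpha>)\<close> and for the space \<open>\<D>\<^sub>P'\<close> in which it vanishes.\<close>

definition annihilates_monomial ::
    "real \<Rightarrow> nat \<Rightarrow> real \<Rightarrow> ('n::finite) oper \<Rightarrow> 'n oper \<Rightarrow> ('n \<Rightarrow> nat) \<Rightarrow> bool"
  where "annihilates_monomial \<nu> M \<gamma> T Ts \<alpha> \<longleftrightarrow>
    (\<exists>P. SIO_at P \<nu> M \<gamma> T Ts \<and> real M + \<bar>\<nu>\<bar> \<le> real P \<and>
      (\<forall>\<psi>\<in>test_fns0 P. monomial_pairing P T \<alpha> \<psi> 0))"


section \<open>Almost diagonal estimates\<close>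

definition radial :: "(real ^ 'n::finite \<Rightarrow> complex) \<Rightarrow> bool"
  where "radial \<psi> \<longleftrightarrow> (\<forall>x y. norm x = norm y \<longrightarrow> \<psi> x = \<psi> y)"

text \<open>\<open>\<psi>\<^sub>k\<^sup>x(u) = 2\<^sup>k\<^sup>n \<psi>(2\<^sup>k(x - u))\<close>.\<close>

definition dil_trans :: "(real ^ 'n::finite \<Rightarrow> complex) \<Rightarrow> int \<Rightarrow> real ^ 'n \<Rightarrow> real ^ 'n \<Rightarrow> complex"
  where "dil_trans \<psi> k x u = (2 powi (k * int CARD('n))) *\<^sub>R \<psi> ((2 powi k) *\<^sub>R (x - u))"

definition Phi :: "real \<Rightarrow> int \<Rightarrow> real ^ 'n::finite \<Rightarrow> real"
  where "Phi N k x = 2 powi (k * int CARD('n)) * (1 + 2 powi k * norm x) powr - N"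

definition lam ::
    "('n::finite) oper \<Rightarrow> (real ^ 'n \<Rightarrow> complex) \<Rightarrow> (real ^ 'n \<Rightarrow> complex) \<Rightarrow>
      int \<Rightarrow> int \<Rightarrow> real ^ 'n \<Rightarrow> real ^ 'n \<Rightarrow> complex"
  where "lam Ts \<psi> \<psi>' j k x y = Ts (dil_trans \<psi> j x) (dil_trans \<psi>' k y)"

end

theory Submission
  imports Defs
begin

text \<open>
  The pairing \<open>\<langle>T\<^sup>* \<psi>\<^sub>j\<^sup>x, \<psi>'\<^sub>k\<^sup>y\<rangle>\<close> is always read as an operator applied to the function of the smaller
  scale \<open>t\<close> (this is \<open>T\<^sup>*\<close> for \<open>j \<ge> k\<close> and, by transposition, \<open>T\<close> for \<open>j < k\<close>) and tested against
  the function of the larger scale \<open>s\<close>.  A cutoff at distance of order \<open>t\<close> splits the latter: the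
  near part is controlled by the weak boundedness property, the far part by subtracting the Taylor
  polynomial of the kernel.  For \<open>j < k\<close> the vanishing of \<open>T\<^sup>*\<close> on polynomials allows us to replace
  the wide function by its Taylor remainder of order \<open>L\<close>, which is bounded by
  \<open>(r / s) powr (L + \<gamma>')\<close> at distance \<open>r\<close>; as \<open>L + \<gamma>' < \<nu> + M + \<gamma>\<close>, the far integral converges and the
  gain is \<open>(t / s) powr (L + \<gamma>')\<close>.  If the two functions are further apart than \<open>s\<close>, the kernel
  estimate alone suffices.  Derivatives of \<open>\<lambda>\<^bsub>j,k\<^esub>\<close> fall on \<open>\<psi>\<close> and \<open>\<psi>'\<close> and keep their form, and the
  Hoelder estimate interpolates between the size estimate and the mean value theorem.
\<close>


section \<open>Functions of class \<open>C\<^sup>k\<close>\<close>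

text \<open>The pairing with a polynomial exists only as a limit over cutoffs. The bounds for the
  near and far part are therefore stated for an arbitrary test function H, of which only two facts
  are used: growth A |u-a|^\<tau> for |u-a| \<ge> t, and derivatives of order m of size A
  t^(\<tau>-m) in a ball of radius comparable to t. Both hold for f minus its cut-off Taylor
  polynomial with constants independent of the large cutoff radius, and both parts then scale like
  t^(n-\<nu>+\<tau>). Bounded wide functions correspond to \<tau> = 0, Taylor remainders to \<tau> =
  L+\<gamma>'. At the endpoint L = M+\<nu> convergence of the far integral is exactly the strict
  inequality \<gamma>' < \<gamma>. For j < k this yields the exponent L-\<nu>+\<gamma>', which
  dominates the one with the integer part of L-\<nu>. Differentiation under the pairing is justified
  by viewing it as a convolution on R^2n of the distribution kernel with a tensor product; the
  derivatives are again pairings of test functions with the same number of vanishing moments, so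
  that a size bound for arbitrary such pairs is all that is needed.\<close>

lemma has_derivative_cong_open:
  assumes "open S" "x \<in> S" "\<And>y. y \<in> S \<Longrightarrow> f y = g y"
  shows "(f has_derivative D) (at x) \<longleftrightarrow> (g has_derivative D) (at x)"
  using assms has_derivative_transform_within_open[of f D x UNIV S g]
    has_derivative_transform_within_open[of g D x UNIV S f] by auto

lemma frechet_derivative_cong_open:
  assumes "open S" "x \<in> S" "\<And>y. y \<in> S \<Longrightarrow> f y = g y"
  shows "frechet_derivative f (at x) = frechet_derivative g (at x)"
  unfolding frechet_derivative_def using has_derivative_cong_open[OF assms] by simp

lemma Ck_on_cong:
  assumes "open S" "\<And>y. y \<in> S \<Longrightarrow> f y = g y"
  shows "Ck_on k S f \<longleftrightarrow> Ck_on k S g"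
  using assms(2)
proof (induction k arbitrary: f g)
  case 0
  then show ?case by (simp cong: continuous_on_cong)
next
  case (Suc k)
  have "Ck_on k S (\<lambda>x. frechet_derivative f (at x) b) \<longleftrightarrow> Ck_on k S (\<lambda>x. frechet_derivative g (at x) b)" for b
    by (rule Suc.IH) (use frechet_derivative_cong_open[OF assms(1)] Suc.prems in metis)
  moreover have "\<forall>x\<in>S. f differentiable (at x) \<longleftrightarrow> g differentiable (at x)"
    using has_derivative_cong_open[OF assms(1)] Suc.prems unfolding differentiable_def by metis
  ultimately show ?case by auto
qed

text \<open>Lets a candidate derivative be supplied by hand; the recursion of \<open>Ck_on\<close>
  speaks of \<open>frechet_derivative\<close>, a choice operator that cannot be computed with
  directly.\<close>

lemma Ck_on_SucI:
  assumes "open S" "\<And>x. x \<in> S \<Longrightarrow> (f has_derivative f' x) (at x)"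
    and "\<And>b. b \<in> Basis \<Longrightarrow> Ck_on k S (\<lambda>x. f' x b)"
  shows "Ck_on (Suc k) S f"
proof -
  have "Ck_on k S (\<lambda>x. frechet_derivative f (at x) b)" if "b \<in> Basis" for b
    using Ck_on_cong[OF assms(1), of "\<lambda>x. frechet_derivative f (at x) b" "\<lambda>x. f' x b" k]
      frechet_derivative_at[OF assms(2)] assms(3)[OF that] by metis
  then show ?thesis using assms(2) by (auto simp: differentiable_def)
qed

lemma Ck_on_has_derivative:
  assumes "Ck_on (Suc k) S f" "x \<in> S"
  shows "(f has_derivative frechet_derivative f (at x)) (at x)"
  using assms frechet_derivative_works by auto

lemma Ck_on_Suc_continuous:
  assumes "Ck_on (Suc k) S f"
  shows "continuous_on S f"
  using assms by (auto intro!: continuous_at_imp_continuous_on differentiable_imp_continuous_within)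

lemma Ck_on_continuous: "Ck_on k S f \<Longrightarrow> continuous_on S f"
  by (cases k) (use Ck_on_Suc_continuous in auto)

lemma Ck_on_Suc_le: "Ck_on (Suc k) S f \<Longrightarrow> Ck_on k S f"
proof (induction k arbitrary: f)
  case 0
  then show ?case using Ck_on_Suc_continuous[of 0 S f] by simp
qed auto

lemma Ck_on_le: "Ck_on k S f \<Longrightarrow> m \<le> k \<Longrightarrow> Ck_on m S f"
  by (induction k) (use Ck_on_Suc_le le_Suc_eq in blast)+

lemma Ck_on_const: "open S \<Longrightarrow> Ck_on k S (\<lambda>x. c)"
proof (induction k arbitrary: c)
  case (Suc k)
  show ?case by (rule Ck_on_SucI[where f' = "\<lambda>x h. 0"]) (use Suc in auto)
qed auto

lemma Ck_on_add:
  assumes "open S" "Ck_on k S f" "Ck_on k S g"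
  shows "Ck_on k S (\<lambda>x. f x + g x)"
  using assms(2,3)
proof (induction k arbitrary: f g)
  case (Suc k)
  show ?case
    by (rule Ck_on_SucI[where f' = "\<lambda>x h. frechet_derivative f (at x) h + frechet_derivative g (at x) h"])
      (use Suc assms(1) Ck_on_has_derivative in \<open>auto intro!: has_derivative_add simp del: Ck_on.simps(2)\<close>,
       use Suc in auto)
qed (auto intro: continuous_intros)

lemma Ck_on_sum:
  assumes "open S" "\<And>i. i \<in> I \<Longrightarrow> Ck_on k S (f i)"
  shows "Ck_on k S (\<lambda>x. \<Sum>i\<in>I. f i x)"
  using assms(2) by (induction I rule: infinite_finite_induct) (auto intro: Ck_on_const Ck_on_add assms(1))

lemma Ck_on_mult:
  assumes "open S" "Ck_on k S f" "Ck_on k S g"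
  shows "Ck_on k S (\<lambda>x. f x * g x)"
  using assms(2,3)
proof (induction k arbitrary: f g)
  case (Suc k)
  show ?case
  proof (rule Ck_on_SucI[where f' = "\<lambda>x h. f x * frechet_derivative g (at x) h + frechet_derivative f (at x) h * g x"])
    show "Ck_on k S (\<lambda>x. f x * frechet_derivative g (at x) b + frechet_derivative f (at x) b * g x)" if "b \<in> Basis" for b
      using Suc.prems that Suc.prems[THEN Ck_on_Suc_le] by (intro Ck_on_add Suc.IH assms(1)) auto
  qed (use Suc assms(1) Ck_on_has_derivative in \<open>auto intro!: has_derivative_mult simp del: Ck_on.simps(2)\<close>)
qed (auto intro: continuous_intros)

lemma Ck_on_prod:
  assumes "open S" "\<And>i. i \<in> I \<Longrightarrow> Ck_on k S (f i)"
  shows "Ck_on k S (\<lambda>x. \<Prod>i\<in>I. f i x)"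
  using assms(2) by (induction I rule: infinite_finite_induct) (auto intro: Ck_on_const Ck_on_mult assms(1))

lemma Ck_on_inverse:
  assumes "open S" "Ck_on k S f" "\<And>x. x \<in> S \<Longrightarrow> f x \<noteq> 0"
  shows "Ck_on k S (\<lambda>x. inverse (f x))"
  using assms(2,3)
proof (induction k arbitrary: f)
  case (Suc k)
  show ?case
  proof (rule Ck_on_SucI[where f' = "\<lambda>x h. - 1 * (inverse (f x) * frechet_derivative f (at x) h * inverse (f x))"])
    show "Ck_on k S (\<lambda>x. - 1 * (inverse (f x) * frechet_derivative f (at x) b * inverse (f x)))" if "b \<in> Basis" for b
      using Suc.prems that Suc.prems(1)[THEN Ck_on_Suc_le]
      by (intro Ck_on_mult Ck_on_const Suc.IH assms(1)) auto
    show "((\<lambda>x. inverse (f x)) has_derivative (\<lambda>h. - 1 * (inverse (f x) * frechet_derivative f (at x) h * inverse (f x)))) (at x)" if "x \<in> S" for x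
      using Deriv.has_derivative_inverse[OF Suc.prems(2)[OF that] Ck_on_has_derivative[OF Suc.prems(1) that]] by simp
  qed (use assms in auto)
qed (auto intro: continuous_intros)

lemma Ck_on_bounded_linear:
  assumes "open S" "bounded_linear f"
  shows "Ck_on k S f"
proof (cases k)
  case 0
  then show ?thesis using assms bounded_linear.continuous_on[OF assms(2) continuous_on_id] by auto
next
  case (Suc m)
  then show ?thesis using Ck_on_SucI[of S f "\<lambda>x. f" m] assms bounded_linear_imp_has_derivative Ck_on_const by blast
qed

text \<open>By the chain rule the directional derivatives of the composition are combinations, with
  coefficients independent of x, of the partial derivatives of f composed with the same affine map.
  The induction over k therefore stays within affine compositions.\<close>

lemma Ck_on_affine_comp:
  fixes A :: "'a::euclidean_space \<Rightarrow> 'b::euclidean_space"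
  assumes "open S" "open U" "bounded_linear A" "Ck_on k U f" "\<And>x. x \<in> S \<Longrightarrow> A x + c \<in> U"
  shows "Ck_on k S (\<lambda>x. f (A x + c))"
  using assms(4)
proof (induction k arbitrary: f)
  case 0
  have "continuous_on S (\<lambda>x. A x + c)"
    by (intro continuous_intros bounded_linear.continuous_on[OF assms(3)])
  then show ?case using 0 assms(5) by (auto intro!: continuous_on_compose2[of U f S])
next
  case (Suc k)
  define f' where "f' x h = (\<Sum>b\<in>Basis. of_real (A h \<bullet> b) * frechet_derivative f (at (A x + c)) b)" for x h
  show ?case
  proof (rule Ck_on_SucI[where f' = f'])
    fix x assume "x \<in> S"
    have d: "(f has_derivative frechet_derivative f (at (A x + c))) (at (A x + c))"
      using Ck_on_has_derivative[OF Suc.prems assms(5)[OF \<open>x \<in> S\<close>]] .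
    have "((\<lambda>x. A x + c) has_derivative A) (at x)"
      by (auto intro!: derivative_eq_intros bounded_linear_imp_has_derivative assms(3))
    from has_derivative_compose[OF this d]
    have *: "((\<lambda>x. f (A x + c)) has_derivative (\<lambda>h. frechet_derivative f (at (A x + c)) (A h))) (at x)" .
    interpret l: linear "frechet_derivative f (at (A x + c))" using d has_derivative_linear by blast
    have "frechet_derivative f (at (A x + c)) (A h) = f' x h" for h
    proof -
      have "frechet_derivative f (at (A x + c)) (A h) = frechet_derivative f (at (A x + c)) (\<Sum>b\<in>Basis. (A h \<bullet> b) *\<^sub>R b)"
        by (simp add: euclidean_representation)
      then show ?thesis unfolding f'_def by (simp add: l.sum l.scale scaleR_conv_of_real)
    qed
    then show "((\<lambda>x. f (A x + c)) has_derivative f' x) (at x)" using * by simp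
  next
    fix b :: 'a assume "b \<in> Basis"
    show "Ck_on k S (\<lambda>x. f' x b)" unfolding f'_def
      by (intro Ck_on_sum Ck_on_mult Ck_on_const assms(1) Suc.IH) (use Suc in auto)
  qed (use assms in auto)
qed

lemma smooth_const: "smooth (\<lambda>x. c)" and
  smooth_add: "smooth f \<Longrightarrow> smooth g \<Longrightarrow> smooth (\<lambda>x. f x + g x)" and
  smooth_mult: "smooth f \<Longrightarrow> smooth g \<Longrightarrow> smooth (\<lambda>x. f x * g x)" and
  smooth_inverse: "smooth f \<Longrightarrow> (\<And>x. f x \<noteq> 0) \<Longrightarrow> smooth (\<lambda>x. inverse (f x))" and
  smooth_sum: "(\<And>i. i \<in> I \<Longrightarrow> smooth (h i)) \<Longrightarrow> smooth (\<lambda>x. \<Sum>i\<in>I. h i x)" and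
  smooth_prod: "(\<And>i. i \<in> I \<Longrightarrow> smooth (h i)) \<Longrightarrow> smooth (\<lambda>x. \<Prod>i\<in>I. h i x)" and
  smooth_bounded_linear: "bounded_linear f \<Longrightarrow> smooth f"
  unfolding smooth_def
  by (auto intro: Ck_on_const Ck_on_add Ck_on_mult Ck_on_inverse Ck_on_sum Ck_on_prod Ck_on_bounded_linear)

lemma smooth_affine_comp:
  assumes "smooth f" "bounded_linear A"
  shows "smooth (\<lambda>x. f (A x + c))"
  using assms unfolding smooth_def by (auto intro: Ck_on_affine_comp)

lemma smooth_scale_comp:
  fixes f :: "'a::euclidean_space \<Rightarrow> complex"
  assumes "smooth f"
  shows "smooth (\<lambda>x. f (r *\<^sub>R x + c))"
  by (rule smooth_affine_comp[OF assms bounded_linear_scaleR_right])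

lemma smooth_diff: "smooth f \<Longrightarrow> smooth g \<Longrightarrow> smooth (\<lambda>x. f x - g x)"
  using smooth_add[of f "\<lambda>x. - 1 * g x"] smooth_mult[OF smooth_const, of g "- 1"] by simp

lemma smooth_cmult: "smooth f \<Longrightarrow> smooth (\<lambda>x. c * f x)"
  by (intro smooth_mult smooth_const)

lemma smooth_imp_continuous: "smooth f \<Longrightarrow> continuous_on S f"
  unfolding smooth_def using Ck_on_continuous continuous_on_subset by blast

lemma smooth_has_derivative: "smooth f \<Longrightarrow> (f has_derivative frechet_derivative f (at x)) (at x)"
  unfolding smooth_def using Ck_on_has_derivative by blast

text \<open>A coinduction principle for families whose derivatives stay in the family, such as
  Taylor polynomials and convolutions; no order of differentiability has to be tracked.\<close>

lemma smooth_I: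
  assumes "\<And>f. f \<in> F \<Longrightarrow> \<exists>f'. \<forall>x. (f has_derivative f' x) (at x) \<and> (\<forall>b\<in>Basis. (\<lambda>x. f' x b) \<in> F)" "f \<in> F"
  shows "smooth f"
proof -
  have "Ck_on k UNIV f" if "f \<in> F" for k f
    using that
  proof (induction k arbitrary: f)
    case 0
    then obtain f' where "\<forall>x. (f has_derivative f' x) (at x)" using assms(1) by blast
    then show ?case by (auto intro!: continuous_at_imp_continuous_on has_derivative_continuous)
  next
    case (Suc k)
    then obtain f' where f': "\<forall>x. (f has_derivative f' x) (at x) \<and> (\<forall>b\<in>Basis. (\<lambda>x. f' x b) \<in> F)" using assms(1) by blast
    show ?case by (rule Ck_on_SucI[where f' = f']) (use f' Suc in auto)
  qed
  then show ?thesis unfolding smooth_def using assms(2) by blast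
qed

section \<open>Iterated partial derivatives and Taylor polynomials\<close>

text \<open>Derivatives are indexed by lists of coordinates instead of multi-indices: inductions run
  over the list, and appending lists composes derivatives. The last element acts first.\<close>

definition iter_pd :: "'n::finite list \<Rightarrow> (real ^ 'n \<Rightarrow> complex) \<Rightarrow> real ^ 'n \<Rightarrow> complex"
  where "iter_pd is f = foldr partial_deriv is f"

lemma iter_pd_Nil [simp]: "iter_pd [] f = f"
  and iter_pd_Cons [simp]: "iter_pd (i # is) f = partial_deriv i (iter_pd is f)"
  and iter_pd_append: "iter_pd (is @ js) f = iter_pd is (iter_pd js f)"
  by (simp_all add: iter_pd_def)

lemma axis_1_Basis: "axis i (1::real) \<in> Basis"
  by (auto simp: Basis_vec_def)

lemma Basis_vec_real: "(Basis :: (real ^ 'n::finite) set) = range (\<lambda>i. axis i 1)"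
  by (auto simp: Basis_vec_def)

lemma partial_deriv_eq: "(f has_derivative D) (at x) \<Longrightarrow> partial_deriv i f x = D (axis i 1)"
  unfolding partial_deriv_def using frechet_derivative_at by metis

lemma has_derivative_partials:
  fixes f :: "real ^ 'n::finite \<Rightarrow> complex"
  assumes "(f has_derivative D) (at x)"
  shows "D h = (\<Sum>i\<in>UNIV. h $ i *\<^sub>R partial_deriv i f x)"
proof -
  interpret linear D using assms has_derivative_linear by blast
  have "D h = D (\<Sum>i\<in>UNIV. h $ i *\<^sub>R axis i 1)"
    using basis_expansion[of h] by (simp add: scalar_mult_eq_scaleR)
  then show ?thesis using partial_deriv_eq[OF assms] by (simp add: sum scale)
qed

lemma sum_axis: "(\<Sum>j\<in>UNIV. axis i 1 $ j *\<^sub>R F j) = (F i :: complex)"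
proof -
  have "(\<Sum>j\<in>UNIV. axis i 1 $ j *\<^sub>R F j) = (\<Sum>j\<in>UNIV. if j = i then F j else 0)"
    by (rule sum.cong) (auto simp: axis_def)
  then show ?thesis by simp
qed

lemma Ck_on_iter_pd: "Ck_on (length is + k) S f \<Longrightarrow> Ck_on k S (iter_pd is f)"
proof (induction "is" arbitrary: k)
  case (Cons i "is")
  then have "Ck_on (Suc k) S (iter_pd is f)" by (simp del: Ck_on.simps)
  then show ?case unfolding iter_pd_Cons partial_deriv_def[abs_def] using axis_1_Basis[of i] by auto
qed simp

lemma smooth_iter_pd: "smooth f \<Longrightarrow> smooth (iter_pd is f)"
  unfolding smooth_def using Ck_on_iter_pd by blast

lemma smooth_partial_deriv: "smooth f \<Longrightarrow> smooth (partial_deriv i f)"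
  using smooth_iter_pd[of f "[i]"] by simp

lemma iter_pd_cong_open:
  assumes "open S" "\<And>y. y \<in> S \<Longrightarrow> f y = g y"
  shows "x \<in> S \<Longrightarrow> iter_pd is f x = iter_pd is g x"
proof (induction "is" arbitrary: x)
  case (Cons i "is")
  then show ?case using frechet_derivative_cong_open[OF assms(1) Cons.prems(1), of "iter_pd is f" "iter_pd is g"]
    by (simp add: partial_deriv_def)
qed (use assms in simp)

section \<open>Symmetry of mixed partial derivatives\<close>

lemma has_vector_derivative_along_line:
  assumes "(f has_derivative D) (at (p + t *\<^sub>R v))"
  shows "((\<lambda>t. f (p + t *\<^sub>R v)) has_vector_derivative D v) (at t)"
proof -
  interpret linear D using assms has_derivative_linear by blast
  have "((\<lambda>t. p + t *\<^sub>R v) has_derivative (\<lambda>h. h *\<^sub>R v)) (at t)"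
    by (auto intro!: derivative_eq_intros)
  from has_derivative_compose[OF this assms] show ?thesis
    by (simp add: has_vector_derivative_def scale)
qed

lemma interval_mvt_bound:
  fixes g :: "real \<Rightarrow> 'a::real_normed_vector"
  assumes "\<And>t. 0 \<le> t \<Longrightarrow> t \<le> s \<Longrightarrow> (g has_vector_derivative g' t) (at t)"
    and "\<And>t. 0 \<le> t \<Longrightarrow> t \<le> s \<Longrightarrow> norm (g' t) \<le> B" and "0 \<le> s"
  shows "norm (g s - g 0) \<le> B * s"
proof -
  have "norm (g s - g 0) \<le> B * norm (s - 0)"
  proof (rule differentiable_bound[of "{0..s}" g "\<lambda>t h. h *\<^sub>R g' t"])
    fix t assume t: "t \<in> {0..s}"
    show "(g has_derivative (\<lambda>h. h *\<^sub>R g' t)) (at t within {0..s})"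
      using assms(1)[of t] t by (auto simp: has_vector_derivative_def intro: has_derivative_at_withinI)
    have "onorm (\<lambda>h. h *\<^sub>R g' t) = norm (g' t)" using onorm_scaleR_left[of "\<lambda>x. x" "g' t"]
      by (simp add: onorm_id bounded_linear_ident)
    then show "onorm (\<lambda>h. h *\<^sub>R g' t) \<le> B" using assms(2) t by simp
  qed (use assms(3) in auto)
  then show ?thesis using assms(3) by simp
qed

text \<open>The mean value inequality is used twice, in the direction j for
  \<open>partial_deriv i f\<close> and then in the direction i for f, each time after subtracting
  the linear term with the constant c. With c the mixed derivative at a and e its oscillation on the
  ball, the second difference divided by s^2 is within e of c.\<close>

lemma mixed_difference_bound:
  fixes f :: "real ^ 'n::finite \<Rightarrow> complex"
  assumes f: "Ck_on 2 S f" and "ball a d \<subseteq> S" and s: "0 < s" "2 * s < d"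
    and b: "\<And>z. z \<in> ball a d \<Longrightarrow> norm (partial_deriv j (partial_deriv i f) z - c) \<le> e"
  shows "norm (f (a + s *\<^sub>R axis i 1 + s *\<^sub>R axis j 1) - f (a + s *\<^sub>R axis i 1)
    - f (a + s *\<^sub>R axis j 1) + f a - (s * s) *\<^sub>R c) \<le> e * s * s"
proof -
  have mem: "a + u *\<^sub>R axis i 1 + w *\<^sub>R axis j 1 \<in> ball a d"
    if "0 \<le> u" "u \<le> s" "0 \<le> w" "w \<le> s" for u w :: real
  proof -
    have "norm (u *\<^sub>R axis i (1::real) + w *\<^sub>R axis j 1) \<le> u + w"
      using norm_triangle_ineq[of "u *\<^sub>R axis i (1::real)" "w *\<^sub>R axis j 1"] that by simp
    moreover have "dist a (a + (u *\<^sub>R axis i 1 + w *\<^sub>R axis j 1)) = norm (u *\<^sub>R axis i (1::real) + w *\<^sub>R axis j 1)"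
      by (simp only: dist_norm norm_minus_commute[of a] add_diff_cancel_left')
    ultimately show ?thesis using that s unfolding mem_ball add.assoc by linarith
  qed
  have d1: "(f has_derivative frechet_derivative f (at z)) (at z)" if "z \<in> ball a d" for z
    using Ck_on_has_derivative[of 1 S f z] f that assms(2) by (auto simp: numeral_2_eq_2)
  have C1: "Ck_on (Suc 0) S (partial_deriv i f)"
    using Ck_on_iter_pd[of "[i]" "Suc 0" S f] f by (simp add: numeral_2_eq_2 del: Ck_on.simps)
  have d2: "(partial_deriv i f has_derivative frechet_derivative (partial_deriv i f) (at z)) (at z)"
    if "z \<in> ball a d" for z
    using Ck_on_has_derivative[OF C1, of z] that assms(2) by auto
  have inner: "norm (partial_deriv i f (a + u *\<^sub>R axis i 1 + s *\<^sub>R axis j 1) - partial_deriv i f (a + u *\<^sub>R axis i 1) - s *\<^sub>R c) \<le> e * s"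
    if u: "0 \<le> u" "u \<le> s" for u
  proof -
    let ?g = "\<lambda>w. partial_deriv i f ((a + u *\<^sub>R axis i 1) + w *\<^sub>R axis j 1) - w *\<^sub>R c"
    have "norm (?g s - ?g 0) \<le> e * s"
    proof (rule interval_mvt_bound)
      fix t assume t: "0 \<le> t" "t \<le> s"
      show "(?g has_vector_derivative (partial_deriv j (partial_deriv i f) ((a + u *\<^sub>R axis i 1) + t *\<^sub>R axis j 1) - c)) (at t)"
        using has_vector_derivative_along_line[OF d2[OF mem[OF u t]]]
        unfolding partial_deriv_def[of j "partial_deriv i f"]
        by (auto intro!: derivative_eq_intros)
      show "norm (partial_deriv j (partial_deriv i f) ((a + u *\<^sub>R axis i 1) + t *\<^sub>R axis j 1) - c) \<le> e"
        by (rule b[OF mem[OF u t]])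
    qed (use s in auto)
    then show ?thesis by (simp add: algebra_simps)
  qed
  let ?g = "\<lambda>u. f ((a + s *\<^sub>R axis j 1) + u *\<^sub>R axis i 1) - f (a + u *\<^sub>R axis i 1) - u *\<^sub>R (s *\<^sub>R c)"
  have "norm (?g s - ?g 0) \<le> (e * s) * s"
  proof (rule interval_mvt_bound)
    fix t assume t: "0 \<le> t" "t \<le> s"
    have m1: "(a + s *\<^sub>R axis j 1) + t *\<^sub>R axis i 1 \<in> ball a d"
      using mem[of t s] t s by (simp add: algebra_simps)
    have m2: "a + t *\<^sub>R axis i 1 \<in> ball a d" using mem[of t 0] t s by simp
    show "(?g has_vector_derivative (partial_deriv i f ((a + s *\<^sub>R axis j 1) + t *\<^sub>R axis i 1)
        - partial_deriv i f (a + t *\<^sub>R axis i 1) - s *\<^sub>R c)) (at t)"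
      using has_vector_derivative_along_line[OF d1[OF m1]] has_vector_derivative_along_line[OF d1[OF m2]]
      unfolding partial_deriv_def by (auto intro!: derivative_eq_intros)
    show "norm (partial_deriv i f ((a + s *\<^sub>R axis j 1) + t *\<^sub>R axis i 1)
        - partial_deriv i f (a + t *\<^sub>R axis i 1) - s *\<^sub>R c) \<le> e * s"
      using inner[OF t] by (simp add: algebra_simps)
  qed (use s in auto)
  then show ?thesis by (simp add: algebra_simps)
qed

lemma partial_deriv_commute:
  fixes f :: "real ^ 'n::finite \<Rightarrow> complex"
  assumes "open S" "Ck_on 2 S f" "a \<in> S"
  shows "partial_deriv i (partial_deriv j f) a = partial_deriv j (partial_deriv i f) a"
proof -
  let ?P = "partial_deriv i (partial_deriv j f)" and ?Q = "partial_deriv j (partial_deriv i f)"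
  have cont: "continuous_on S (partial_deriv i (partial_deriv j f))" for i j
    using Ck_on_continuous[OF Ck_on_iter_pd[of "[i,j]" 0 S f]] assms(2) by (simp add: numeral_2_eq_2)
  have "norm (?P a - ?Q a) \<le> e" if "e > 0" for e
  proof -
    have "\<exists>d>0. \<forall>z. dist z a < d \<longrightarrow> dist (partial_deriv i (partial_deriv j f) z) (partial_deriv i (partial_deriv j f) a) < e/2" for i j
    proof -
      have "continuous (at a) (partial_deriv i (partial_deriv j f))"
        using cont assms(1,3) continuous_on_eq_continuous_at by blast
      then show ?thesis using that unfolding continuous_at_eps_delta by (metis half_gt_zero)
    qed
    then obtain d1 d2 where d12: "d1 > 0" "d2 > 0"
      "\<forall>z. dist z a < d1 \<longrightarrow> dist (?P z) (?P a) < e/2"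
      "\<forall>z. dist z a < d2 \<longrightarrow> dist (?Q z) (?Q a) < e/2" by meson
    obtain d3 where d3: "d3 > 0" "ball a d3 \<subseteq> S" using assms openE by blast
    define d where "d = min d1 (min d2 d3)"
    have d: "d > 0" "ball a d \<subseteq> S" using d12 d3 by (auto simp: d_def)
    define s where "s = d / 3"
    have s: "0 < s" "2 * s < d" using d by (auto simp: s_def)
    let ?D = "f (a + s *\<^sub>R axis i 1 + s *\<^sub>R axis j 1) - f (a + s *\<^sub>R axis i 1) - f (a + s *\<^sub>R axis j 1) + f a"
    have 1: "norm (?D - (s * s) *\<^sub>R ?Q a) \<le> e/2 * s * s"
      by (rule mixed_difference_bound[OF assms(2) d(2) s])
        (use d12 in \<open>auto simp: d_def dist_norm norm_minus_commute intro: less_imp_le\<close>)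
    have "norm (f (a + s *\<^sub>R axis j 1 + s *\<^sub>R axis i 1) - f (a + s *\<^sub>R axis j 1) - f (a + s *\<^sub>R axis i 1) + f a - (s * s) *\<^sub>R ?P a) \<le> e/2 * s * s"
      by (rule mixed_difference_bound[OF assms(2) d(2) s])
        (use d12 in \<open>auto simp: d_def dist_norm norm_minus_commute intro: less_imp_le\<close>)
    \<comment> \<open>The second difference is symmetric in i and j, so both mixed derivatives
      approximate the same quantity.\<close>
    then have 2: "norm (?D - (s * s) *\<^sub>R ?P a) \<le> e/2 * s * s" by (simp add: algebra_simps)
    have "norm ((s * s) *\<^sub>R (?P a - ?Q a)) = norm ((?D - (s * s) *\<^sub>R ?Q a) - (?D - (s * s) *\<^sub>R ?P a))"
      by (simp add: algebra_simps)
    also have "\<dots> \<le> e/2 * s * s + e/2 * s * s"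
      using norm_triangle_ineq4[of "?D - (s * s) *\<^sub>R ?Q a" "?D - (s * s) *\<^sub>R ?P a"] 1 2 by linarith
    finally have "(s * s) * norm (?P a - ?Q a) \<le> (s * s) * e"
      using s unfolding norm_scaleR by (simp add: mult_ac)
    then show ?thesis using s by simp
  qed
  then have "norm (?P a - ?Q a) \<le> 0" using field_le_epsilon[of "norm (?P a - ?Q a)" 0] by simp
  then show ?thesis by simp
qed

lemma iter_pd_move_front:
  assumes "open S" "Ck_on (length as + Suc (length bs)) S f" "x \<in> S"
  shows "iter_pd (as @ i # bs) f x = iter_pd (i # as @ bs) f x"
  using assms(2,3)
proof (induction as arbitrary: x)
  case (Cons j as)
  have "Ck_on (length as + Suc (length bs)) S f"
    by (rule Ck_on_le[OF Cons.prems(1)]) simp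
  then have "iter_pd [j] (iter_pd (as @ i # bs) f) x = iter_pd [j] (iter_pd (i # as @ bs) f) x"
    by (intro iter_pd_cong_open[OF assms(1)] Cons.IH Cons.prems(2))
  then have "iter_pd (j # as @ i # bs) f x = iter_pd (j # i # as @ bs) f x" by (simp only: iter_pd_Cons iter_pd_Nil)
  also have "\<dots> = iter_pd (i # j # as @ bs) f x"
    using partial_deriv_commute[OF assms(1) Ck_on_iter_pd[of "as @ bs" 2] Cons.prems(2)] Cons.prems(1)
    by (simp add: numeral_2_eq_2 del: Ck_on.simps)
  finally show ?case by simp
qed simp

text \<open>Induction on the first list: its head is located in the second list and moved to the
  front there.\<close>

lemma iter_pd_permute:
  assumes "open S" "mset is = mset js" "Ck_on (length is) S f" "x \<in> S"
  shows "iter_pd is f x = iter_pd js f x"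
  using assms(2-)
proof (induction "is" arbitrary: js x)
  case (Cons i "is")
  then have "i \<in> set js" by (metis list.set_intros(1) set_mset_mset)
  then obtain as bs where js: "js = as @ i # bs" by (meson split_list)
  have ms: "mset is = mset (as @ bs)" using Cons.prems(1) js by simp
  then have len: "length is = length as + length bs" using size_mset by (metis length_append)
  have "Ck_on (length is) S f" by (rule Ck_on_le[OF Cons.prems(2)]) simp
  then have "iter_pd [i] (iter_pd is f) x = iter_pd [i] (iter_pd (as @ bs) f) x"
    by (intro iter_pd_cong_open[OF assms(1)] Cons.IH ms Cons.prems(3))
  then have "iter_pd (i # is) f x = iter_pd (i # as @ bs) f x" by simp
  also have "\<dots> = iter_pd js f x"
    using iter_pd_move_front[OF assms(1), of as bs f x i] js Cons.prems len by simp
  finally show ?case .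
qed simp

section \<open>Multi-indices and coordinate lists\<close>

text \<open>The particular list along which \<open>multi_deriv\<close> differentiates. Up to
  reordering, its inverse sends a list to \<open>count (mset is)\<close>, which is how bounds for
  multi-indices and for lists are exchanged.\<close>

definition mi_list :: "('n::finite \<Rightarrow> nat) \<Rightarrow> 'n list"
  where "mi_list \<alpha> = concat (map (\<lambda>i. replicate (\<alpha> i) i) coords)"

lemma coords: "distinct (coords :: 'n::finite list)" "set (coords :: 'n list) = UNIV"
proof -
  have "\<exists>is::'n list. distinct is \<and> set is = UNIV" 
    using finite_distinct_list[of "UNIV :: 'n set"] by auto
  from someI_ex[OF this] show "distinct (coords :: 'n list)" "set (coords :: 'n list) = UNIV"
    unfolding coords_def by auto
qed

lemma multi_deriv_conv_iter_pd: "multi_deriv \<alpha> f = iter_pd (mi_list \<alpha>) f"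
proof -
  have "foldr (\<lambda>i. partial_deriv i ^^ \<alpha> i) cs f = foldr partial_deriv (concat (map (\<lambda>i. replicate (\<alpha> i) i) cs)) f" for cs
    by (induction cs) (simp_all add: foldr_replicate)
  then show ?thesis by (simp add: multi_deriv_def iter_pd_def mi_list_def)
qed

lemma length_mi_list: "length (mi_list \<alpha>) = mi_order \<alpha>"
  using sum.distinct_set_conv_list[OF coords(1), of \<alpha>]
  by (simp add: mi_list_def mi_order_def length_concat comp_def coords(2))

lemma count_mi_list: "count (mset (mi_list \<alpha>)) = \<alpha>"
proof
  fix x
  have "count (mset (concat (map (\<lambda>i. replicate (\<alpha> i) i) cs))) x = (if x \<in> set cs then \<alpha> x else 0)"
    if "distinct cs" for cs
    using that by (induction cs) auto
  from this[of coords] show "count (mset (mi_list \<alpha>)) x = \<alpha> x"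
    unfolding mi_list_def by (simp add: coords)
qed

lemma mset_mi_list: "mset (mi_list (count (mset is))) = mset is"
  by (rule multiset_eqI) (simp add: count_mi_list)

lemma iter_pd_conv_multi_deriv:
  assumes "open S" "Ck_on (length is) S f" "x \<in> S"
  shows "iter_pd is f x = multi_deriv (count (mset is)) f x"
  unfolding multi_deriv_conv_iter_pd
  by (rule iter_pd_permute[OF assms(1) _ assms(2,3)]) (simp add: mset_mi_list)

lemma mi_order_count: "mi_order (count (mset is)) = length is"
  by (metis length_mi_list mset_mi_list size_mset)

lemma multi_deriv_0 [simp]: "multi_deriv (\<lambda>_. 0) f = f"
proof -
  have "mi_list (\<lambda>_::'a. 0) = []" using length_mi_list[of "\<lambda>_::'a. 0"] by (simp add: mi_order_def)
  then show ?thesis by (simp add: multi_deriv_conv_iter_pd)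
qed

lemma mi_order_0 [simp]: "mi_order (\<lambda>_. 0) = 0"
  by (simp add: mi_order_def)

section \<open>Linearity, products and scaling of iterated derivatives\<close>

lemma iter_pd_add:
  assumes "smooth f" "smooth g"
  shows "iter_pd is (\<lambda>x. f x + g x) = (\<lambda>x. iter_pd is f x + iter_pd is g x)"
proof (induction "is")
  case (Cons i "is")
  have "partial_deriv i (\<lambda>x. iter_pd is f x + iter_pd is g x) x = partial_deriv i (iter_pd is f) x + partial_deriv i (iter_pd is g) x" for x
    using partial_deriv_eq[OF has_derivative_add[OF smooth_has_derivative[OF smooth_iter_pd[OF assms(1)]]
        smooth_has_derivative[OF smooth_iter_pd[OF assms(2)]]]]
    by (simp add: partial_deriv_def)
  then show ?case using Cons by auto
qed simp

lemma partial_deriv_mult: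
  assumes "smooth f" "smooth g"
  shows "partial_deriv i (\<lambda>x. f x * g x) = (\<lambda>x. f x * partial_deriv i g x + partial_deriv i f x * g x)"
proof
  fix x
  show "partial_deriv i (\<lambda>x. f x * g x) x = f x * partial_deriv i g x + partial_deriv i f x * g x"
    using partial_deriv_eq[OF has_derivative_mult[OF assms[THEN smooth_has_derivative]]]
    by (simp add: partial_deriv_def)
qed

lemma partial_deriv_const: "partial_deriv i (\<lambda>x. c) = (\<lambda>x. 0)"
  using partial_deriv_eq[OF has_derivative_const] by auto

lemma iter_pd_cmult:
  assumes "smooth f"
  shows "iter_pd is (\<lambda>x. c * f x) = (\<lambda>x. c * iter_pd is f x)"
proof (induction "is")
  case (Cons i "is")
  then show ?case
    using partial_deriv_mult[OF smooth_const smooth_iter_pd[OF assms], of i c "is"] by (simp add: partial_deriv_const)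
qed simp

lemma iter_pd_diff:
  assumes "smooth f" "smooth g"
  shows "iter_pd is (\<lambda>x. f x - g x) = (\<lambda>x. iter_pd is f x - iter_pd is g x)"
  using iter_pd_add[OF assms(1) smooth_cmult[OF assms(2), of "-1"], of "is"]
  unfolding iter_pd_cmult[OF assms(2)] by simp

lemma iter_pd_sum:
  assumes "\<And>i. i \<in> I \<Longrightarrow> smooth (f i)"
  shows "iter_pd is (\<lambda>x. \<Sum>i\<in>I. f i x) = (\<lambda>x. \<Sum>i\<in>I. iter_pd is (f i) x)"
  using assms
proof (induction I rule: infinite_finite_induct)
  case (insert a I)
  then show ?case using iter_pd_add[of "f a" "\<lambda>x. \<Sum>i\<in>I. f i x" "is"] smooth_sum[of I f] by simp
next
  case empty
  have "iter_pd is (\<lambda>x. 0) = (\<lambda>x. 0 :: complex)" by (induction "is") (auto simp: partial_deriv_const)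
  then show ?case by simp
next
  case (infinite I)
  have "iter_pd is (\<lambda>x. 0) = (\<lambda>x. 0 :: complex)" by (induction "is") (auto simp: partial_deriv_const)
  then show ?case using infinite by simp
qed

text \<open>Each differentiation doubles the number of terms, which accounts for 2 ^ length. The
  induction removes the last list element, the one acting first, so that the product rule applies to
  f and g themselves and the two resulting products satisfy the hypotheses with A or B multiplied by
  r.\<close>

lemma iter_pd_mult_bound:
  fixes f g :: "real ^ 'n::finite \<Rightarrow> complex"
  assumes "smooth f" "smooth g" "0 < r"
    and "\<And>js. length js \<le> length is \<Longrightarrow> norm (iter_pd js f u) \<le> A * r ^ length js"
    and "\<And>js. length js \<le> length is \<Longrightarrow> norm (iter_pd js g u) \<le> B * r ^ length js"
  shows "norm (iter_pd is (\<lambda>x. f x * g x) u) \<le> 2 ^ length is * A * B * r ^ length is"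
  using assms
proof (induction "is" arbitrary: f g A B rule: rev_induct)
  case Nil
  then have "norm (f u) \<le> A" "norm (g u) \<le> B" by (metis iter_pd_Nil le_refl list.size(3) mult_1_right power_0)+
  then show ?case by (auto simp: norm_mult intro!: mult_mono intro: order_trans[OF norm_ge_zero])
next
  case (snoc i "is")
  have A: "norm (iter_pd js f u) \<le> A * r ^ length js" if "length js \<le> length is" for js
    using snoc.prems(4) that by simp
  have B: "norm (iter_pd js g u) \<le> B * r ^ length js" if "length js \<le> length is" for js
    using snoc.prems(5) that by simp
  have A': "norm (iter_pd js (partial_deriv i f) u) \<le> (A * r) * r ^ length js" if "length js \<le> length is" for js
    using snoc.prems(4)[of "js @ [i]"] that by (simp add: iter_pd_append mult_ac)
  have B': "norm (iter_pd js (partial_deriv i g) u) \<le> (B * r) * r ^ length js" if "length js \<le> length is" for js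
    using snoc.prems(5)[of "js @ [i]"] that by (simp add: iter_pd_append mult_ac)
  note sm = snoc.prems(1,2) smooth_partial_deriv[OF snoc.prems(1)] smooth_partial_deriv[OF snoc.prems(2)]
  have "iter_pd (is @ [i]) (\<lambda>x. f x * g x) u
      = iter_pd is (\<lambda>x. f x * partial_deriv i g x) u + iter_pd is (\<lambda>x. partial_deriv i f x * g x) u"
    using iter_pd_add[of "\<lambda>x. f x * partial_deriv i g x" "\<lambda>x. partial_deriv i f x * g x" "is"] sm
    by (simp add: iter_pd_append partial_deriv_mult smooth_mult)
  also have "norm \<dots> \<le> 2 ^ length is * A * (B * r) * r ^ length is + 2 ^ length is * (A * r) * B * r ^ length is"
    by (intro norm_triangle_mono snoc.IH sm snoc.prems(3) A B A' B')
  finally show ?case by (simp add: algebra_simps)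
qed

lemma iter_pd_scale:
  fixes f :: "real ^ 'n::finite \<Rightarrow> complex"
  assumes "smooth f"
  shows "iter_pd is (\<lambda>x. f (r *\<^sub>R x + c)) = (\<lambda>x. of_real (r ^ length is) * iter_pd is f (r *\<^sub>R x + c))"
proof (induction "is")
  case (Cons i "is")
  let ?g = "iter_pd is f"
  have s: "smooth (\<lambda>x. ?g (r *\<^sub>R x + c))" using smooth_scale_comp smooth_iter_pd assms by blast
  have "partial_deriv i (\<lambda>x. ?g (r *\<^sub>R x + c)) x = of_real r * partial_deriv i ?g (r *\<^sub>R x + c)" for x
  proof -
    have d: "(?g has_derivative frechet_derivative ?g (at (r *\<^sub>R x + c))) (at (r *\<^sub>R x + c))"
      using smooth_has_derivative smooth_iter_pd assms by blast
    interpret linear "frechet_derivative ?g (at (r *\<^sub>R x + c))" using d has_derivative_linear by blast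
    have "((\<lambda>x. r *\<^sub>R x + c) has_derivative (\<lambda>h. r *\<^sub>R h)) (at x)" by (auto intro!: derivative_eq_intros)
    from partial_deriv_eq[OF has_derivative_compose[OF this d], of i]
    have "partial_deriv i (\<lambda>x. ?g (r *\<^sub>R x + c)) x = r *\<^sub>R partial_deriv i ?g (r *\<^sub>R x + c)"
      by (simp only: partial_deriv_def scale)
    then show ?thesis by (simp only: scaleR_conv_of_real)
  qed
  then show ?case unfolding iter_pd_Cons Cons
    using partial_deriv_mult[OF smooth_const s, of i] by (auto simp: partial_deriv_const mult_ac)
qed simp

section \<open>Taylor polynomials and their remainders\<close>

text \<open>The form sum of c [i1,...,im] h_i1 ... h_im over all ordered tuples. Each multi-index is
  met as often as it has orderings, which is why \<open>taylor\<close> carries the weight 1/m! and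
  no multinomial coefficients.\<close>

fun tay_hom :: "nat \<Rightarrow> ('n::finite list \<Rightarrow> complex) \<Rightarrow> real ^ 'n \<Rightarrow> complex"
  where
    "tay_hom 0 c h = c []"
  | "tay_hom (Suc m) c h = (\<Sum>i\<in>UNIV. h $ i *\<^sub>R tay_hom m (\<lambda>is. c (i # is)) h)"

definition taylor :: "nat \<Rightarrow> (real ^ 'n::finite \<Rightarrow> complex) \<Rightarrow> real ^ 'n \<Rightarrow> real ^ 'n \<Rightarrow> complex"
  where "taylor L f a u = (\<Sum>m\<le>L. (1 / fact m) *\<^sub>R tay_hom m (\<lambda>is. iter_pd is f a) (u - a))"

lemma tay_hom_diff: "tay_hom m (\<lambda>is. c is - d is) h = tay_hom m c h - tay_hom m d h"
  by (induction m arbitrary: c d) (auto simp: scaleR_diff_right sum_subtractf)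

lemma tay_hom_sum: "tay_hom m (\<lambda>is. \<Sum>i\<in>I. r i *\<^sub>R c i is) h = (\<Sum>i\<in>I. r i *\<^sub>R tay_hom m (c i) h)"
proof (induction m arbitrary: c)
  case (Suc m)
  have "tay_hom (Suc m) (\<lambda>is. \<Sum>i\<in>I. r i *\<^sub>R c i is) h = (\<Sum>j\<in>UNIV. \<Sum>i\<in>I. h $ j *\<^sub>R r i *\<^sub>R tay_hom m (\<lambda>is. c i (j # is)) h)"
    by (simp add: Suc scaleR_sum_right)
  also have "\<dots> = (\<Sum>i\<in>I. r i *\<^sub>R tay_hom (Suc m) (c i) h)"
    by (subst sum.swap) (simp add: scaleR_sum_right mult.commute)
  finally show ?case .
qed simp

text \<open>There are n^m ordered tuples, and each contributes at most |h|^m B.\<close>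

lemma tay_hom_bound:
  fixes h :: "real ^ 'n::finite"
  assumes "\<And>is. length is = m \<Longrightarrow> norm (c is) \<le> B"
  shows "norm (tay_hom m c h) \<le> (real CARD('n) * norm h) ^ m * B"
  using assms
proof (induction m arbitrary: c)
  case (Suc m)
  have "norm (tay_hom (Suc m) c h) \<le> (\<Sum>i\<in>(UNIV::'n set). norm h * ((real CARD('n) * norm h) ^ m * B))"
    unfolding tay_hom.simps
  proof (rule sum_norm_le)
    fix i :: 'n
    have "norm (tay_hom m (\<lambda>is. c (i # is)) h) \<le> (real CARD('n) * norm h) ^ m * B"
      by (rule Suc.IH) (use Suc.prems in auto)
    then show "norm (h $ i *\<^sub>R tay_hom m (\<lambda>is. c (i # is)) h) \<le> norm h * ((real CARD('n) * norm h) ^ m * B)"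
      using component_le_norm_cart[of h i] by (auto intro!: mult_mono)
  qed
  then show ?case by (simp add: mult_ac)
qed simp

lemma tay_hom_has_vector_derivative:
  assumes "\<And>is. length is = m \<Longrightarrow> ((\<lambda>t. c t is) has_vector_derivative c' is) (at t)"
  shows "((\<lambda>t. tay_hom m (c t) h) has_vector_derivative tay_hom m c' h) (at t)"
  using assms
proof (induction m arbitrary: c c')
  case (Suc m)
  have "((\<lambda>t. tay_hom m (\<lambda>is. c t (i # is)) h) has_vector_derivative tay_hom m (\<lambda>is. c' (i # is)) h) (at t)" for i
    by (rule Suc.IH) (use Suc.prems in auto)
  then show ?case by (auto intro!: derivative_eq_intros)
qed simp

text \<open>Symmetric coefficients make the m+1 slots interchangeable, so that the product rule
  yields m+1 equal terms. This factor later cancels against the factorial in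
  \<open>taylor\<close>.\<close>

lemma tay_hom_has_derivative:
  fixes h :: "real ^ 'n::finite"
  assumes "\<And>is js. mset is = mset js \<Longrightarrow> c is = c js"
  shows "(tay_hom (Suc m) c has_derivative (\<lambda>k. real (Suc m) *\<^sub>R (\<Sum>j\<in>UNIV. k $ j *\<^sub>R tay_hom m (\<lambda>is. c (j # is)) h))) (at h)"
  using assms
proof (induction m arbitrary: c)
  case 0
  have "tay_hom (Suc 0) c = (\<lambda>h. \<Sum>i\<in>UNIV. h $ i *\<^sub>R c [i])" by (simp add: fun_eq_iff)
  moreover have "((\<lambda>h. \<Sum>i\<in>UNIV. h $ i *\<^sub>R c [i]) has_derivative (\<lambda>k. \<Sum>i\<in>UNIV. k $ i *\<^sub>R c [i])) (at h)"
    by (intro has_derivative_sum has_derivative_scaleR_left bounded_linear_imp_has_derivative bounded_linear_vec_nth)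
  ultimately show ?case by simp
next
  case (Suc m)
  have sym: "c (i # j # is) = c (j # i # is)" for i j "is" by (rule Suc.prems) simp
  have IH: "(tay_hom (Suc m) (\<lambda>is. c (i # is)) has_derivative
      (\<lambda>k. real (Suc m) *\<^sub>R (\<Sum>j\<in>UNIV. k $ j *\<^sub>R tay_hom m (\<lambda>is. c (i # j # is)) h))) (at h)" for i
    by (rule Suc.IH) (use Suc.prems in auto)
  have "((\<lambda>h. \<Sum>i\<in>UNIV. h $ i *\<^sub>R tay_hom (Suc m) (\<lambda>is. c (i # is)) h) has_derivative
     (\<lambda>k. \<Sum>i\<in>UNIV. h $ i *\<^sub>R (real (Suc m) *\<^sub>R (\<Sum>j\<in>UNIV. k $ j *\<^sub>R tay_hom m (\<lambda>is. c (i # j # is)) h))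
       + k $ i *\<^sub>R tay_hom (Suc m) (\<lambda>is. c (i # is)) h)) (at h)"
    by (intro has_derivative_sum has_derivative_scaleR IH bounded_linear_imp_has_derivative bounded_linear_vec_nth)
  moreover have "(\<Sum>i\<in>UNIV. h $ i *\<^sub>R (real (Suc m) *\<^sub>R (\<Sum>j\<in>UNIV. k $ j *\<^sub>R tay_hom m (\<lambda>is. c (i # j # is)) h))
       + k $ i *\<^sub>R tay_hom (Suc m) (\<lambda>is. c (i # is)) h)
     = real (Suc (Suc m)) *\<^sub>R (\<Sum>j\<in>UNIV. k $ j *\<^sub>R tay_hom (Suc m) (\<lambda>is. c (j # is)) h)" for k
  proof -
    have "(\<Sum>i\<in>UNIV. h $ i *\<^sub>R (real (Suc m) *\<^sub>R (\<Sum>j\<in>UNIV. k $ j *\<^sub>R tay_hom m (\<lambda>is. c (i # j # is)) h)))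
      = (\<Sum>i\<in>UNIV. \<Sum>j\<in>UNIV. real (Suc m) *\<^sub>R k $ j *\<^sub>R h $ i *\<^sub>R tay_hom m (\<lambda>is. c (i # j # is)) h)"
      by (simp add: scaleR_sum_right mult_ac)
    also have "\<dots> = real (Suc m) *\<^sub>R (\<Sum>j\<in>UNIV. k $ j *\<^sub>R tay_hom (Suc m) (\<lambda>is. c (j # is)) h)"
      by (subst sum.swap) (simp add: scaleR_sum_right sym)
    finally show ?thesis
      unfolding sum.distrib of_nat_Suc[of "Suc m"] by (simp only: scaleR_left_distrib scaleR_one add.commute)
  qed
  ultimately show ?case by (simp only: tay_hom.simps(2)[of "Suc m", abs_def])
qed

text \<open>Here \<phi> m stands for the m-th derivative. The derivative of a Taylor remainder is
  the remainder of the derivative with one degree less, and the mean value inequality on [0,1]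
  carries the bound A through each step without loss. Assuming only an increment bound for the top
  derivative covers the Hoelder and the Lipschitz version at once.\<close>

lemma taylor_1d:
  fixes \<phi> :: "nat \<Rightarrow> real \<Rightarrow> 'a::real_normed_vector"
  assumes "\<And>m t. m < M \<Longrightarrow> 0 \<le> t \<Longrightarrow> t \<le> 1 \<Longrightarrow> (\<phi> m has_vector_derivative \<phi> (Suc m) t) (at t)"
    and "\<And>t. 0 \<le> t \<Longrightarrow> t \<le> 1 \<Longrightarrow> norm (\<phi> M t - \<phi> M 0) \<le> A"
    and "0 \<le> t" "t \<le> 1"
  shows "norm (\<phi> 0 t - (\<Sum>m\<le>M. (t ^ m / fact m) *\<^sub>R \<phi> m 0)) \<le> A"
  using assms
proof (induction M arbitrary: \<phi> t)
  case (Suc M)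
  let ?p = "\<lambda>t. \<phi> 0 t - (\<Sum>m\<le>Suc M. (t ^ m / fact m) *\<^sub>R \<phi> m 0)"
  let ?p' = "\<lambda>t. \<phi> (Suc 0) t - (\<Sum>m\<le>M. (t ^ m / fact m) *\<^sub>R \<phi> (Suc m) 0)"
  have eq: "?p s = \<phi> 0 s - \<phi> 0 0 - (\<Sum>m\<le>M. (s ^ Suc m / fact (Suc m)) *\<^sub>R \<phi> (Suc m) 0)" for s
    by (subst sum.atMost_Suc_shift) simp
  have d: "(?p has_vector_derivative ?p' s) (at s)" if "0 \<le> s" "s \<le> 1" for s
  proof -
    have "((\<lambda>s. (s ^ Suc m / fact (Suc m)) *\<^sub>R \<phi> (Suc m) 0) has_vector_derivative (s ^ m / fact m) *\<^sub>R \<phi> (Suc m) 0) (at s)" for m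
    proof -
      have "((\<lambda>s. s ^ Suc m / fact (Suc m)) has_real_derivative s ^ m / fact m) (at s)"
        using DERIV_cdivide[OF DERIV_pow[of "Suc m" s UNIV], of "fact (Suc m)"]
        by (simp del: of_nat_Suc power_Suc)
      from has_vector_derivative_scaleR[OF this has_vector_derivative_const] show ?thesis by simp
    qed
    then have "((\<lambda>s. \<Sum>m\<le>M. (s ^ Suc m / fact (Suc m)) *\<^sub>R \<phi> (Suc m) 0) has_vector_derivative
        (\<Sum>m\<le>M. (s ^ m / fact m) *\<^sub>R \<phi> (Suc m) 0)) (at s)"
      by (intro has_vector_derivative_sum)
    from has_vector_derivative_diff[OF has_vector_derivative_diff[OF Suc.prems(1)[of 0 s] has_vector_derivative_const[of "\<phi> 0 0"]] this]
    show ?thesis unfolding eq using that by simp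
  qed
  have b: "norm (?p' s) \<le> A" if "0 \<le> s" "s \<le> 1" for s
    by (rule Suc.IH[of "\<lambda>m. \<phi> (Suc m)"]) (use Suc.prems that in auto)
  have "norm (?p t - ?p 0) \<le> A * t"
    by (rule interval_mvt_bound[where g = ?p and g' = ?p']) (use d b Suc.prems(3,4) order_trans in blast)+
  moreover have "?p 0 = 0" unfolding eq by simp
  moreover have "0 \<le> A" using Suc.prems(2)[of 0] by simp
  then have "A * t \<le> A" using Suc.prems(4) by (simp add: mult_left_le)
  ultimately show ?case by (metis (lifting) diff_zero order_trans)
qed simp

text \<open>The one-variable estimate along the segment from a to u, the m-th derivative there being
  the form \<open>tay_hom m\<close> in the direction u - a.\<close>

lemma taylor_bound:
  fixes f :: "real ^ 'n::finite \<Rightarrow> complex"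
  assumes "open S" "Ck_on M S f" "\<And>t. 0 \<le> t \<Longrightarrow> t \<le> 1 \<Longrightarrow> a + t *\<^sub>R (u - a) \<in> S"
    and "\<And>is t. length is = M \<Longrightarrow> 0 \<le> t \<Longrightarrow> t \<le> 1 \<Longrightarrow>
      norm (iter_pd is f (a + t *\<^sub>R (u - a)) - iter_pd is f a) \<le> A"
  shows "norm (f u - taylor M f a u) \<le> (real CARD('n) * norm (u - a)) ^ M * A"
proof -
  define \<phi> where "\<phi> m t = tay_hom m (\<lambda>is. iter_pd is f (a + t *\<^sub>R (u - a))) (u - a)" for m t
  have "norm (\<phi> 0 1 - (\<Sum>m\<le>M. (1 ^ m / fact m) *\<^sub>R \<phi> m 0)) \<le> (real CARD('n) * norm (u - a)) ^ M * A"
  proof (rule taylor_1d)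
    fix m and t :: real assume m: "m < M" and t: "0 \<le> t" "t \<le> 1"
    have "((\<lambda>t. iter_pd is f (a + t *\<^sub>R (u - a))) has_vector_derivative
        (\<Sum>i\<in>UNIV. (u - a) $ i *\<^sub>R iter_pd (i # is) f (a + t *\<^sub>R (u - a)))) (at t)" if "length is = m" for "is"
    proof -
      have "Ck_on (Suc 0) S (iter_pd is f)"
        by (rule Ck_on_iter_pd, rule Ck_on_le[OF assms(2)]) (use that m in auto)
      from Ck_on_has_derivative[OF this assms(3)[OF t]]
      show ?thesis
        using has_vector_derivative_along_line has_derivative_partials by fastforce
    qed
    from tay_hom_has_vector_derivative[where c = "\<lambda>t is. iter_pd is f (a + t *\<^sub>R (u - a))", OF this]
    show "(\<phi> m has_vector_derivative \<phi> (Suc m) t) (at t)"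
      unfolding \<phi>_def[abs_def] tay_hom_sum tay_hom.simps by blast
  next
    fix t :: real assume t: "0 \<le> t" "t \<le> 1"
    show "norm (\<phi> M t - \<phi> M 0) \<le> (real CARD('n) * norm (u - a)) ^ M * A"
      unfolding \<phi>_def tay_hom_diff[symmetric] by (rule tay_hom_bound) (use assms(4) t in auto)
  qed auto
  then show ?thesis by (simp add: \<phi>_def taylor_def)
qed

lemma iter_pd_smooth_permute: "smooth f \<Longrightarrow> mset is = mset js \<Longrightarrow> iter_pd is f x = iter_pd js f x"
  using iter_pd_permute[OF open_UNIV] unfolding smooth_def by blast

lemma taylor_0 [simp]: "taylor 0 f a = (\<lambda>u. f a)"
  by (simp add: taylor_def fun_eq_iff)

text \<open>Each homogeneous part loses one slot j, and moving j from the front of the coordinate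
  list to its end, by symmetry of mixed derivatives, turns the coefficients into those of
  \<open>partial_deriv j f\<close>.\<close>

lemma taylor_has_derivative:
  fixes f :: "real ^ 'n::finite \<Rightarrow> complex"
  assumes "smooth f"
  shows "(taylor (Suc L) f a has_derivative (\<lambda>k. \<Sum>j\<in>UNIV. k $ j *\<^sub>R taylor L (partial_deriv j f) a u)) (at u)"
proof -
  have eq: "taylor (Suc L) f a u = f a + (\<Sum>m\<le>L. (1 / fact (Suc m)) *\<^sub>R tay_hom (Suc m) (\<lambda>is. iter_pd is f a) (u - a))" for u
    unfolding taylor_def by (subst sum.atMost_Suc_shift) simp
  have c: "iter_pd (j # is) f a = iter_pd is (partial_deriv j f) a" for j "is"
    using iter_pd_smooth_permute[OF assms, of "j # is" "is @ [j]"] by (simp add: iter_pd_append)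
  have d: "(tay_hom (Suc m) (\<lambda>is. iter_pd is f a) has_derivative
     (\<lambda>k. real (Suc m) *\<^sub>R (\<Sum>j\<in>UNIV. k $ j *\<^sub>R tay_hom m (\<lambda>is. iter_pd is (partial_deriv j f) a) h))) (at h)" for m h
    using tay_hom_has_derivative[of "\<lambda>is. iter_pd is f a" m h, OF iter_pd_smooth_permute[OF assms]] unfolding c by simp
  have sh: "((\<lambda>u. u - a) has_derivative (\<lambda>k. k)) (at u)" by (auto intro!: derivative_eq_intros)
  have "((\<lambda>u. f a + (\<Sum>m\<le>L. (1 / fact (Suc m)) *\<^sub>R tay_hom (Suc m) (\<lambda>is. iter_pd is f a) (u - a))) has_derivative
     (\<lambda>k. 0 + (\<Sum>m\<le>L. (1 / fact (Suc m)) *\<^sub>R (real (Suc m) *\<^sub>R (\<Sum>j\<in>UNIV. k $ j *\<^sub>R tay_hom m (\<lambda>is. iter_pd is (partial_deriv j f) a) (u - a)))))) (at u)"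
    by (intro has_derivative_add has_derivative_const has_derivative_sum has_derivative_scaleR_right has_derivative_compose[OF sh d])
  moreover have "(\<Sum>m\<le>L. (1 / fact (Suc m)) *\<^sub>R (real (Suc m) *\<^sub>R (\<Sum>j\<in>UNIV. k $ j *\<^sub>R tay_hom m (\<lambda>is. iter_pd is (partial_deriv j f) a) (u - a))))
     = (\<Sum>j\<in>UNIV. k $ j *\<^sub>R taylor L (partial_deriv j f) a u)" for k
  proof -
    have "(1 / fact (Suc m)) *\<^sub>R real (Suc m) *\<^sub>R z = (1 / fact m) *\<^sub>R (z::complex)" for m z
      by (simp add: divide_simps del: of_nat_Suc)
    then have "(\<Sum>m\<le>L. (1 / fact (Suc m)) *\<^sub>R (real (Suc m) *\<^sub>R (\<Sum>j\<in>UNIV. k $ j *\<^sub>R tay_hom m (\<lambda>is. iter_pd is (partial_deriv j f) a) (u - a))))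
      = (\<Sum>m\<le>L. \<Sum>j\<in>UNIV. k $ j *\<^sub>R (1 / fact m) *\<^sub>R tay_hom m (\<lambda>is. iter_pd is (partial_deriv j f) a) (u - a))"
      by (simp only: scaleR_sum_right) (simp add: mult_ac)
    then show ?thesis unfolding taylor_def scaleR_sum_right by (simp add: sum.swap[of _ "{..L}"])
  qed
  ultimately show ?thesis unfolding eq[abs_def] by simp
qed

lemma smooth_taylor:
  assumes "smooth f"
  shows "smooth (taylor L f a)"
proof (rule smooth_I)
  let ?F = "{\<lambda>u. taylor L f a u |L f. smooth f} \<union> {\<lambda>u. c |c. True}"
  fix g assume "g \<in> ?F"
  then consider L f where "g = taylor L f a" "smooth f" | c where "g = (\<lambda>u. c)" by auto
  then show "\<exists>f'. \<forall>x. (g has_derivative f' x) (at x) \<and> (\<forall>b\<in>Basis. (\<lambda>x. f' x b) \<in> ?F)"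
  proof cases
    case 1
    show ?thesis
    proof (cases L)
      case 0
      then have "g = (\<lambda>u. f a)" using 1 by auto
      then show ?thesis by (intro exI[of _ "\<lambda>x h. 0"]) auto
    next
      case (Suc m)
      have "(\<lambda>x. \<Sum>j\<in>UNIV. b $ j *\<^sub>R taylor m (partial_deriv j f) a x) \<in> ?F" if bB: "b \<in> Basis" for b :: "real ^ 'a"
      proof -
        obtain i where b: "b = axis i 1" using bB unfolding Basis_vec_real by auto
        have "(\<Sum>j\<in>UNIV. b $ j *\<^sub>R taylor m (partial_deriv j f) a x) = taylor m (partial_deriv i f) a x" for x
          unfolding b by (rule sum_axis)
        then show ?thesis using smooth_partial_deriv[OF 1(2), of i] by auto
      qed
      then show ?thesis using taylor_has_derivative[OF 1(2)] 1 Suc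
        by (intro exI[of _ "\<lambda>x k. \<Sum>j\<in>UNIV. k $ j *\<^sub>R taylor m (partial_deriv j f) a x"]) auto
    qed
  next
    case 2
    then show ?thesis by (intro exI[of _ "\<lambda>x h. 0"]) auto
  qed
qed (use assms in auto)

lemma partial_deriv_taylor:
  fixes f :: "real ^ 'n::finite \<Rightarrow> complex"
  assumes "smooth f"
  shows "partial_deriv i (taylor (Suc L) f a) = taylor L (partial_deriv i f) a"
  by (rule ext) (simp only: partial_deriv_eq[OF taylor_has_derivative[OF assms]] sum_axis)

lemma iter_pd_taylor:
  assumes "smooth f" "length is \<le> L"
  shows "iter_pd is (taylor L f a) = taylor (L - length is) (iter_pd is f) a"
  using assms(2)
proof (induction "is")
  case (Cons i "is")
  then have "L - length is = Suc (L - length (i # is))" by simp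
  then show ?case using Cons partial_deriv_taylor[OF smooth_iter_pd[OF assms(1)]] by simp
qed simp

text \<open>The last L+1 entries of the list act before the others: L of them reduce the polynomial
  to a constant, the next one annihilates it.\<close>

lemma iter_pd_taylor_0:
  assumes "smooth f" "L < length is"
  shows "iter_pd is (taylor L f a) = (\<lambda>u. 0)"
proof -
  define js where "js = take (length is - Suc L) is"
  obtain i ks where ks: "drop (length is - Suc L) is = i # ks" "length ks = L"
    using assms(2) by (metis Suc_diff_Suc Suc_le_eq diff_diff_cancel length_Suc_conv length_drop)
  have "is = js @ i # ks" using ks(1) js_def by (metis append_take_drop_id)
  moreover have "iter_pd (i # ks) (taylor L f a) = (\<lambda>u. 0)"
    using iter_pd_taylor[OF assms(1), of ks L a] ks(2) partial_deriv_const
    by (simp add: taylor_def)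
  moreover have "iter_pd js (\<lambda>x. 0) = (\<lambda>x. 0 :: complex)" by (induction js) (auto simp: partial_deriv_const)
  ultimately show ?thesis by (simp add: iter_pd_append del: iter_pd_Cons)
qed

text \<open>The increment form of the remainder is applied in order L; the mean value inequality
  bounds the increments of the derivatives of order L by those of order L+1, at the price of one
  more factor n |u - a|.\<close>

lemma smooth_taylor_bound:
  fixes f :: "real ^ 'n::finite \<Rightarrow> complex"
  assumes "smooth f" and "\<And>is u. length is = Suc L \<Longrightarrow> norm (iter_pd is f u) \<le> B"
  shows "norm (f u - taylor L f a u) \<le> (real CARD('n) * norm (u - a)) ^ Suc L * B"
proof -
  have B: "norm (iter_pd is f (a + t *\<^sub>R (u - a)) - iter_pd is f a) \<le> real CARD('n) * norm (u - a) * B"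
    if "length is = L" "0 \<le> t" "t \<le> 1" for "is" t
  proof -
    let ?g = "iter_pd is f"
    have "norm (?g (a + t *\<^sub>R (u - a)) - ?g (a + 0 *\<^sub>R (u - a))) \<le> (real CARD('n) * norm (u - a) * B) * t"
    proof (rule interval_mvt_bound)
      fix s
      have d: "(?g has_derivative frechet_derivative ?g (at (a + s *\<^sub>R (u - a)))) (at (a + s *\<^sub>R (u - a)))"
        using smooth_has_derivative[OF smooth_iter_pd[OF assms(1)]] .
      show "((\<lambda>t. ?g (a + t *\<^sub>R (u - a))) has_vector_derivative
          tay_hom (Suc 0) (\<lambda>js. iter_pd (js @ is) f (a + s *\<^sub>R (u - a))) (u - a)) (at s)"
        using has_vector_derivative_along_line[OF d] has_derivative_partials[OF d] by simp
      have "norm (tay_hom (Suc 0) (\<lambda>js. iter_pd (js @ is) f (a + s *\<^sub>R (u - a))) (u - a)) \<le> (real CARD('n) * norm (u - a)) ^ Suc 0 * B"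
        by (rule tay_hom_bound) (use assms(2) that in auto)
      then show "norm (tay_hom (Suc 0) (\<lambda>js. iter_pd (js @ is) f (a + s *\<^sub>R (u - a))) (u - a)) \<le> real CARD('n) * norm (u - a) * B"
        by simp
    qed (use that in auto)
    \<comment> \<open>Any list of length L+1 shows that B bounds some norm.\<close>
    moreover have "0 \<le> B" using assms(2)[of "replicate (Suc L) undefined"] norm_ge_zero order_trans by (metis length_replicate)
    then have "(real CARD('n) * norm (u - a) * B) * t \<le> real CARD('n) * norm (u - a) * B"
      using that by (intro mult_left_le) auto
    ultimately show ?thesis by (simp only: scaleR_zero_left add_0_right)
  qed
  have "norm (f u - taylor L f a u) \<le> (real CARD('n) * norm (u - a)) ^ L * (real CARD('n) * norm (u - a) * B)"
    by (rule taylor_bound[OF open_UNIV]) (use assms(1) B smooth_def in auto)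
  then show ?thesis by (simp add: mult_ac)
qed

section \<open>Test functions, cutoffs and vanishing moments\<close>

text \<open>The inverse powers of t make the family closed under differentiation: the derivative of
  member k is a combination of members k+1 and k+2. Member 0 is the classical flat function.\<close>

definition flat_exp :: "nat \<Rightarrow> real \<Rightarrow> real"
  where "flat_exp k t = (if t \<le> 0 then 0 else inverse t ^ k * exp (- inverse t))"

lemma flat_exp_tendsto_0: "(flat_exp k \<longlongrightarrow> 0) (at 0)"
proof (rule filterlim_split_at)
  show "(flat_exp k \<longlongrightarrow> 0) (at_left 0)"
    by (rule tendsto_eventually) (auto simp: flat_exp_def eventually_at_filter)
  have "((\<lambda>t. inverse t ^ k / exp (inverse t)) \<longlongrightarrow> (0::real)) (at_right 0)"
    using filterlim_compose[OF tendsto_power_div_exp_0 filterlim_inverse_at_top_right] .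
  moreover have "eventually (\<lambda>t. inverse t ^ k / exp (inverse t) = flat_exp k t) (at_right 0)"
    by (auto simp: flat_exp_def eventually_at_filter exp_minus field_simps)
  ultimately show "(flat_exp k \<longlongrightarrow> 0) (at_right 0)"
    by (rule Lim_transform_eventually)
qed

text \<open>At t = 0 the difference quotient of member k is member k+1, so differentiability there
  reduces to \<open>flat_exp_tendsto_0\<close>.\<close>

lemma flat_exp_deriv:
  "(flat_exp k has_real_derivative flat_exp (Suc (Suc k)) t - real k * flat_exp (Suc k) t) (at t)"
proof -
  consider "t < 0" | "t = 0" | "t > 0" by linarith
  then show ?thesis
  proof cases
    case 1
    have "((\<lambda>t::real. 0::real) has_real_derivative 0) (at t)" by simp
    then have "(flat_exp k has_real_derivative 0) (at t)"
      by (rule DERIV_cong_ev[THEN iffD1, rotated -1, OF _ refl _ refl])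
        (use 1 eventually_nhds_in_open[of "{..<0}" t] in \<open>auto simp: flat_exp_def elim!: eventually_mono\<close>)
    then show ?thesis using 1 by (simp add: flat_exp_def)
  next
    case 2
    have "(\<lambda>h. (flat_exp k (0 + h) - flat_exp k 0) / h) = flat_exp (Suc k)"
      by (auto simp: flat_exp_def field_simps)
    then have "(flat_exp k has_real_derivative 0) (at 0)"
      using flat_exp_tendsto_0[of "Suc k"] by (simp add: DERIV_def)
    then show ?thesis using 2 by (simp add: flat_exp_def)
  next
    case 3
    have "((\<lambda>t. inverse t ^ k * exp (- inverse t)) has_real_derivative
       inverse t ^ Suc (Suc k) * exp (- inverse t) - real k * (inverse t ^ Suc k * exp (- inverse t))) (at t)"
    proof -
      have d: "((\<lambda>s. s ^ k * exp (- s)) has_real_derivative real k * s ^ (k - 1) * exp (- s) - s ^ k * exp (- s)) (at s)" for s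
        by (auto intro!: derivative_eq_intros simp: algebra_simps)
      have "(real k * s ^ (k - 1) * exp (- s) - s ^ k * exp (- s)) * (- (s ^ Suc (Suc 0)))
        = s ^ Suc (Suc k) * exp (- s) - real k * (s ^ Suc k * exp (- s))" for s :: real
        by (cases k) (auto simp: algebra_simps)
      then show ?thesis using DERIV_chain2[OF d DERIV_inverse, of t] 3 by simp
    qed
    then have "(flat_exp k has_real_derivative
       inverse t ^ Suc (Suc k) * exp (- inverse t) - real k * (inverse t ^ Suc k * exp (- inverse t))) (at t)"
      by (rule DERIV_cong_ev[THEN iffD1, rotated -1, OF _ refl _ refl])
        (use 3 eventually_nhds_in_open[of "{0<..}" t] in \<open>auto simp: flat_exp_def elim!: eventually_mono\<close>)
    then show ?thesis using 3 by (simp add: flat_exp_def)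
  qed
qed

lemma smooth_flat_exp: "smooth (\<lambda>t. complex_of_real (flat_exp k t))"
proof -
  have "Ck_on m UNIV (\<lambda>t. complex_of_real (flat_exp k t))" for m k
  proof (induction m arbitrary: k)
    case 0
    have "isCont (flat_exp k) t" for t using flat_exp_deriv DERIV_isCont by blast
    then show ?case by (auto intro!: continuous_at_imp_continuous_on)
  next
    case (Suc m)
    show ?case
    proof (rule Ck_on_SucI[where f' = "\<lambda>t h. complex_of_real (h * (flat_exp (Suc (Suc k)) t - real k * flat_exp (Suc k) t))"])
      show "((\<lambda>t. complex_of_real (flat_exp k t)) has_derivative (\<lambda>h. complex_of_real (h * (flat_exp (Suc (Suc k)) t - real k * flat_exp (Suc k) t)))) (at t)" for t
        using bounded_linear.has_derivative[OF bounded_linear_of_real flat_exp_deriv[of k t, unfolded has_field_derivative_def]]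
        by (simp add: mult.commute)
      have "Ck_on m UNIV (\<lambda>t. complex_of_real (flat_exp (Suc (Suc k)) t) + (- of_nat k) * complex_of_real (flat_exp (Suc k) t))"
        by (intro Ck_on_add Ck_on_mult Ck_on_const Suc.IH open_UNIV)
      then show "Ck_on m UNIV (\<lambda>t. complex_of_real (b * (flat_exp (Suc (Suc k)) t - real k * flat_exp (Suc k) t)))" if "b \<in> Basis" for b
        using that by simp
    qed auto
  qed
  then show ?thesis by (simp add: smooth_def)
qed

text \<open>The quotient e(t) / (e(t) + e(1-t)) with e = \<open>flat_exp 0\<close>; the denominator
  has no zero because t and 1-t are not both nonpositive.\<close>

lemma exists_smooth_step:
  "\<exists>s :: real \<Rightarrow> complex. smooth s \<and> (\<forall>t\<ge>1. s t = 1) \<and> (\<forall>t\<le>0. s t = 0)"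
proof -
  let ?e = "\<lambda>t. complex_of_real (flat_exp 0 t)"
  have r: "smooth (\<lambda>t. ?e (1 - t))"
    using smooth_scale_comp[OF smooth_flat_exp[of 0], of "-1" 1] by simp
  have "?e t + ?e (1 - t) \<noteq> 0" for t
  proof -
    have "flat_exp 0 t + flat_exp 0 (1 - t) > 0"
      by (cases "t \<le> 0") (auto simp: flat_exp_def add_pos_nonneg)
    then show ?thesis by (metis of_real_add of_real_eq_0_iff less_irrefl)
  qed
  then have "smooth (\<lambda>t. ?e t * inverse (?e t + ?e (1 - t)))"
    by (intro smooth_mult smooth_inverse smooth_add smooth_flat_exp r)
  then show ?thesis
    by (intro exI[of _ "\<lambda>t. ?e t * inverse (?e t + ?e (1 - t))"]) (auto simp: flat_exp_def)
qed

section \<open>Test functions and their closure properties\<close>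

lemma test_fns_iff: "f \<in> test_fns \<longleftrightarrow> smooth f \<and> (\<exists>r. \<forall>x. r < norm x \<longrightarrow> f x = 0)"
proof -
  have "compact (supp f) \<longleftrightarrow> bounded {x. f x \<noteq> 0}" by (simp add: supp_def compact_closure)
  also have "\<dots> \<longleftrightarrow> (\<exists>r. \<forall>x. r < norm x \<longrightarrow> f x = 0)"
    unfolding bounded_iff by (metis (mono_tags, lifting) mem_Collect_eq linorder_not_less)
  finally show ?thesis by (simp add: test_fns_def)
qed

lemma test_fnsI: "smooth f \<Longrightarrow> (\<And>x. r < norm x \<Longrightarrow> f x = 0) \<Longrightarrow> f \<in> test_fns"
  unfolding test_fns_iff by blast

lemma test_fns_smooth: "f \<in> test_fns \<Longrightarrow> smooth f"
  by (simp add: test_fns_iff)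

lemma test_fns_radius:
  assumes "f \<in> test_fns"
  obtains r where "r \<ge> 1" "\<And>x. r < norm x \<Longrightarrow> f x = 0"
proof -
  obtain r where "\<And>x. r < norm x \<Longrightarrow> f x = 0" using assms test_fns_iff by blast
  then show ?thesis using that[of "max r 1"] by auto
qed

lemma test_fns_mult: "f \<in> test_fns \<Longrightarrow> smooth g \<Longrightarrow> (\<lambda>x. g x * f x) \<in> test_fns"
  unfolding test_fns_iff by (auto intro: smooth_mult)

lemma test_fns_add:
  assumes "f \<in> test_fns" "g \<in> test_fns"
  shows "(\<lambda>x. f x + g x) \<in> test_fns"
proof -
  obtain r where "\<And>x. r < norm x \<Longrightarrow> f x = 0" using assms(1) test_fns_radius by blast
  moreover obtain s where "\<And>x. s < norm x \<Longrightarrow> g x = 0" using assms(2) test_fns_radius by blast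
  ultimately show ?thesis
    by (intro test_fnsI[where r = "max r s"] smooth_add[OF assms[THEN test_fns_smooth]]) auto
qed

lemma test_fns_cmult: "f \<in> test_fns \<Longrightarrow> (\<lambda>x. c * f x) \<in> test_fns"
  using test_fns_mult[OF _ smooth_const] by blast

lemma test_fns_diff: "f \<in> test_fns \<Longrightarrow> g \<in> test_fns \<Longrightarrow> (\<lambda>x. f x - g x) \<in> test_fns"
  using test_fns_add[of f "\<lambda>x. -1 * g x"] test_fns_cmult[of g "-1"] by simp

lemma test_fns_scale:
  fixes f :: "real ^ 'n::finite \<Rightarrow> complex"
  assumes "f \<in> test_fns" "r \<noteq> 0"
  shows "(\<lambda>x. f (r *\<^sub>R x + b)) \<in> test_fns"
proof -
  obtain s where s: "\<And>x. s < norm x \<Longrightarrow> f x = 0" using assms test_fns_radius by blast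
  show ?thesis
  proof (rule test_fnsI[where r = "(s + norm b) / \<bar>r\<bar>"])
    fix x :: "real ^ 'n" assume "(s + norm b) / \<bar>r\<bar> < norm x"
    then have "s + norm b < norm (r *\<^sub>R x)" using assms(2) by (simp add: divide_less_eq mult.commute)
    then have "s < norm (r *\<^sub>R x + b)" using norm_triangle_ineq2[of "r *\<^sub>R x" "- b"] by simp
    then show "f (r *\<^sub>R x + b) = 0" by (rule s)
  qed (use assms test_fns_smooth smooth_scale_comp in auto)
qed

lemma iter_pd_eq_0:
  assumes "open S" "x \<in> S" "\<And>y. y \<in> S \<Longrightarrow> f y = 0"
  shows "iter_pd is f x = 0"
proof -
  have "iter_pd is f x = iter_pd is (\<lambda>x. 0) x" by (rule iter_pd_cong_open[OF assms(1)]) (use assms in auto)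
  also have "iter_pd is (\<lambda>x. 0) = (\<lambda>x. 0 :: complex)" by (induction "is") (auto simp: partial_deriv_const)
  finally show ?thesis by simp
qed

lemma iter_pd_eq_0_outside:
  assumes "\<And>x. r < norm (x - a) \<Longrightarrow> f x = 0" "r < norm (x - a)"
  shows "iter_pd is f x = 0"
proof -
  have "open {x. r < norm (x - a)}" by (intro open_Collect_less continuous_intros)
  then show ?thesis using iter_pd_eq_0[of "{x. r < norm (x - a)}"] assms by blast
qed

lemma test_fns_iter_pd: "f \<in> test_fns \<Longrightarrow> iter_pd is f \<in> test_fns"
  unfolding test_fns_iff using smooth_iter_pd iter_pd_eq_0_outside[of _ 0 f] by (metis diff_zero)

lemma test_fns_bounded:
  assumes "f \<in> test_fns"
  obtains B where "B > 0" "\<And>x. norm (f x) \<le> B"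
proof -
  obtain r where r: "\<And>x. r < norm x \<Longrightarrow> f x = 0" using assms test_fns_radius by blast
  have "compact (f ` cball 0 r)"
    by (intro compact_continuous_image smooth_imp_continuous test_fns_smooth assms compact_cball)
  then obtain B where B: "\<And>y. y \<in> f ` cball 0 r \<Longrightarrow> norm y \<le> B"
    using compact_imp_bounded bounded_iff by metis
  have "norm (f x) \<le> max B 1" for x
    by (cases "norm x \<le> r") (use B r in \<open>force simp: le_max_iff_disj\<close>)+
  then show ?thesis using that[of "max B 1"] by auto
qed

lemma finite_lists_length_le_UNIV: "finite {is :: 'n::finite list. length is \<le> N}"
  using finite_lists_length_le[of "UNIV :: 'n set" N] by simp

lemma test_fns_derivs_bounded:
  assumes "f \<in> test_fns"
  obtains B where "B > 0" "\<And>is x. length is \<le> N \<Longrightarrow> norm (iter_pd is f x) \<le> B"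
proof -
  have "\<exists>B>0. \<forall>x. norm (iter_pd is f x) \<le> B" for "is"
    by (rule test_fns_bounded[OF test_fns_iter_pd[OF assms, of "is"]]) blast
  then obtain B where B: "\<And>is. B is > 0" "\<And>is x. norm (iter_pd is f x) \<le> B is" by metis
  let ?I = "{is :: 'a list. length is \<le> N}"
  have "norm (iter_pd is f x) \<le> 1 + sum B ?I" if "length is \<le> N" for "is" x
  proof -
    have "B is \<le> sum B ?I"
      by (rule member_le_sum) (use that B(1) finite_lists_length_le_UNIV in \<open>auto intro: less_imp_le\<close>)
    then show ?thesis using B(2)[of "is" x] by linarith
  qed
  moreover have "1 + sum B ?I > 0" using B(1) by (intro add_pos_nonneg sum_nonneg) (auto intro: less_imp_le)
  ultimately show ?thesis using that by blast
qed

text \<open>A product over the coordinates of steps in 2 - x_i and 2 + x_i: all factors are 1 as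
  long as every |x_i| \<le> 1, and one of them is 0 as soon as some |x_i| \<ge> 2. The radius 2n
  comes from bounding the norm by the sum of the |x_i|.\<close>

lemma exists_cutoff:
  "\<exists>\<xi>\<in>test_fns. \<forall>x \<in> ball (0 :: real ^ 'n::finite) 1. \<xi> x = 1"
proof -
  obtain s :: "real \<Rightarrow> complex" where s: "smooth s" "\<And>t. t \<ge> 1 \<Longrightarrow> s t = 1" "\<And>t. t \<le> 0 \<Longrightarrow> s t = 0"
    using exists_smooth_step by blast
  define \<xi> :: "real ^ 'n \<Rightarrow> complex" where "\<xi> x = (\<Prod>i\<in>UNIV. s (- (x $ i) + 2) * s (x $ i + 2))" for x
  have "smooth \<xi>" unfolding \<xi>_def
    by (intro smooth_prod smooth_mult smooth_affine_comp[OF s(1)] bounded_linear_minus bounded_linear_vec_nth)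
  moreover have "\<xi> x = 0" if "real CARD('n) * 2 < norm x" for x
  proof -
    have "\<exists>i. \<bar>x $ i\<bar> \<ge> 2"
    proof (rule ccontr)
      assume "\<not> ?thesis"
      then have "(\<Sum>i\<in>UNIV. \<bar>x $ i\<bar>) \<le> (\<Sum>i\<in>(UNIV::'n set). 2)" by (intro sum_mono) (auto simp: not_le intro: less_imp_le)
      then show False using norm_le_l1_cart[of x] that by simp
    qed
    then obtain i where "\<bar>x $ i\<bar> \<ge> 2" by blast
    then have "- (x $ i) + 2 \<le> 0 \<or> x $ i + 2 \<le> 0" by linarith
    then have "s (- (x $ i) + 2) * s (x $ i + 2) = 0" using s(3) by auto
    with prod_zero[of UNIV "\<lambda>i. s (- (x $ i) + 2) * s (x $ i + 2)"]
    show ?thesis unfolding \<xi>_def using finite by blast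
  qed
  moreover have "\<xi> x = 1" if "x \<in> ball 0 1" for x
  proof -
    have "s (- (x $ i) + 2) * s (x $ i + 2) = 1" for i
    proof -
      have "\<bar>x $ i\<bar> \<le> 1" using component_le_norm_cart[of x i] that by simp
      then have "1 \<le> - (x $ i) + 2" "1 \<le> x $ i + 2" by linarith+
      then show ?thesis using s(2) by simp
    qed
    then show ?thesis unfolding \<xi>_def by simp
  qed
  ultimately show ?thesis using test_fnsI by blast
qed

section \<open>Polynomials of bounded degree\<close>

text \<open>An upper bound for the degree instead of a normal form: closure under affine changes of
  variable and under products follows by rule induction, with no bookkeeping of
  coefficients.\<close>

inductive poly_deg :: "nat \<Rightarrow> (real ^ 'n::finite \<Rightarrow> complex) \<Rightarrow> bool"
  where
    const: "poly_deg d (\<lambda>x. c)"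
  | add: "poly_deg d p \<Longrightarrow> poly_deg d q \<Longrightarrow> poly_deg d (\<lambda>x. p x + q x)"
  | coord: "poly_deg d p \<Longrightarrow> poly_deg (Suc d) (\<lambda>x. of_real (x $ i) * p x)"

lemma poly_deg_Suc: "poly_deg d p \<Longrightarrow> poly_deg (Suc d) p"
  by (induction rule: poly_deg.induct) (auto intro: poly_deg.intros)

lemma poly_deg_mono: "poly_deg d p \<Longrightarrow> d \<le> e \<Longrightarrow> poly_deg e p"
  by (induction e) (auto simp: le_Suc_eq intro: poly_deg_Suc)

lemma poly_deg_cmult: "poly_deg d p \<Longrightarrow> poly_deg d (\<lambda>x. c * p x)"
proof (induction rule: poly_deg.induct)
  case (coord d p i)
  then have "poly_deg (Suc d) (\<lambda>x. of_real (x $ i) * (c * p x))" by (intro poly_deg.coord)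
  then show ?case by (simp add: mult_ac)
qed (auto simp: distrib_left intro: poly_deg.intros)

lemma poly_deg_affine: "poly_deg d p \<Longrightarrow> poly_deg d (\<lambda>x. p (r *\<^sub>R x + b))"
proof (induction rule: poly_deg.induct)
  case (coord d p i)
  have "poly_deg (Suc d) (\<lambda>x. of_real r * (of_real (x $ i) * p (r *\<^sub>R x + b)) + of_real (b $ i) * p (r *\<^sub>R x + b))"
    by (intro poly_deg.add poly_deg_cmult poly_deg.coord poly_deg_Suc coord)
  then show ?case by (simp add: algebra_simps)
qed (auto intro: poly_deg.intros)

lemma poly_deg_sum:
  assumes "\<And>i. i \<in> I \<Longrightarrow> poly_deg d (f i)"
  shows "poly_deg d (\<lambda>x. \<Sum>i\<in>I. f i x)"
  using assms by (induction I rule: infinite_finite_induct) (auto intro: poly_deg.intros)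

lemma smooth_coord: "smooth (\<lambda>x :: real ^ 'n::finite. complex_of_real (x $ i))"
  using smooth_bounded_linear bounded_linear_compose[OF bounded_linear_of_real bounded_linear_vec_nth] .

lemma poly_deg_smooth: "poly_deg d p \<Longrightarrow> smooth p"
  by (induction rule: poly_deg.induct) (auto intro: smooth_const smooth_add smooth_mult smooth_coord)

lemma poly_deg_tay_hom: "poly_deg m (tay_hom m c)"
proof (induction m arbitrary: c)
  case 0
  then show ?case using poly_deg.const[of 0 "c []"] by (simp add: fun_eq_iff[symmetric])
next
  case (Suc m)
  then show ?case using poly_deg_sum[OF poly_deg.coord[OF Suc]] by (simp add: scaleR_conv_of_real)
qed

lemma poly_deg_taylor: "poly_deg L (taylor L f a)"
proof -
  have "poly_deg L (\<lambda>u. of_real (1 / fact m) * tay_hom m c (1 *\<^sub>R u + (- a)))" if "m \<le> L" for m c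
    by (intro poly_deg_cmult poly_deg_affine poly_deg_mono[OF poly_deg_tay_hom that])
  then have "poly_deg L (\<lambda>u. \<Sum>m\<le>L. of_real (1 / fact m) * tay_hom m (\<lambda>is. iter_pd is f a) (1 *\<^sub>R u + (- a)))"
    by (intro poly_deg_sum) auto
  then show ?thesis unfolding taylor_def scaleR_conv_of_real by simp
qed

text \<open>Returns to monomials, in which \<open>vanishing_moments\<close> and
  \<open>annihilates_monomial\<close> are phrased. A list of pairs may repeat a multi-index, so sums
  are handled by appending.\<close>

lemma poly_deg_monomials:
  assumes "poly_deg d p"
  shows "\<exists>xs. (\<forall>(c, \<alpha>)\<in>set xs. mi_order \<alpha> \<le> d) \<and> (\<forall>x. p x = (\<Sum>(c, \<alpha>)\<leftarrow>xs. c * of_real (vpow x \<alpha>)))"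
  using assms
proof (induction rule: poly_deg.induct)
  case (const d c)
  show ?case by (intro exI[of _ "[(c, \<lambda>_. 0)]"]) (simp add: vpow_def)
next
  case (add d p q)
  then obtain xs ys where "(\<forall>(c, \<alpha>)\<in>set xs. mi_order \<alpha> \<le> d) \<and> (\<forall>x. p x = (\<Sum>(c, \<alpha>)\<leftarrow>xs. c * of_real (vpow x \<alpha>)))"
    "(\<forall>(c, \<alpha>)\<in>set ys. mi_order \<alpha> \<le> d) \<and> (\<forall>x. q x = (\<Sum>(c, \<alpha>)\<leftarrow>ys. c * of_real (vpow x \<alpha>)))" by blast
  then show ?case by (intro exI[of _ "xs @ ys"]) auto
next
  case (coord d p i)
  then obtain xs where xs: "\<forall>(c, \<alpha>)\<in>set xs. mi_order \<alpha> \<le> d" "\<And>x. p x = (\<Sum>(c, \<alpha>)\<leftarrow>xs. c * of_real (vpow x \<alpha>))" by blast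
  let ?f = "\<lambda>(c :: complex, \<alpha>). (c, \<alpha>(i := Suc (\<alpha> i)))"
  have o: "mi_order (\<alpha>(i := Suc (\<alpha> i))) = Suc (mi_order \<alpha>)" for \<alpha> :: "'a \<Rightarrow> nat"
    unfolding mi_order_def by (subst (1 2) sum.remove[of _ i]) auto
  have v: "vpow x (\<alpha>(i := Suc (\<alpha> i))) = x $ i * vpow x \<alpha>" for \<alpha> :: "'a \<Rightarrow> nat" and x
    unfolding vpow_def by (subst (1 2) prod.remove[of _ i]) auto
  have "of_real (x $ i) * p x = (\<Sum>(c, \<alpha>)\<leftarrow>map ?f xs. c * of_real (vpow x \<alpha>))" for x
    unfolding xs(2) sum_list_const_mult[symmetric] map_map
    by (rule arg_cong[where f = sum_list]) (auto simp: v mult_ac)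
  moreover have "\<forall>(c, \<alpha>)\<in>set (map ?f xs). mi_order \<alpha> \<le> Suc d" using xs(1) by (auto simp: o)
  ultimately show ?case by blast
qed

lemma poly_deg_vpow: "poly_deg (mi_order \<alpha>) (\<lambda>x. of_real (vpow x \<alpha>))"
proof -
  have pw: "poly_deg d p \<Longrightarrow> poly_deg (k + d) (\<lambda>x. of_real ((x $ i) ^ k) * p x)" for d p k and i :: 'a
  proof (induction k)
    case (Suc k)
    from poly_deg.coord[OF Suc.IH[OF Suc.prems], of i] show ?case by (simp add: mult_ac)
  qed simp
  have "finite A \<Longrightarrow> poly_deg (\<Sum>i\<in>A. \<alpha> i) (\<lambda>x. of_real (\<Prod>i\<in>A. (x $ i) ^ \<alpha> i))" for A
  proof (induction A rule: finite_induct)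
    case (insert i A)
    then show ?case using pw[OF insert.IH, of "\<alpha> i" i] by simp
  qed (auto intro: poly_deg.const)
  then show ?thesis unfolding mi_order_def vpow_def by simp
qed

section \<open>Vanishing moments under dilation, translation and differentiation\<close>

lemma integrable_compact_support:
  fixes g :: "'a::euclidean_space \<Rightarrow> complex"
  assumes "continuous_on UNIV g" "\<And>x. r < norm x \<Longrightarrow> g x = 0"
  shows "integrable lborel g"
proof -
  have "integrable lborel (\<lambda>x. indicator (cball 0 r) x *\<^sub>R g x)"
    by (intro borel_integrable_compact compact_cball continuous_on_subset[OF assms(1)]) auto
  moreover have "(\<lambda>x. indicator (cball 0 r) x *\<^sub>R g x) = g"
    using assms(2) by (auto simp: indicator_def not_le)
  ultimately show ?thesis by simp
qed

lemma test_fns_integrable: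
  assumes "f \<in> test_fns"
  shows "integrable lborel f"
  using assms integrable_compact_support smooth_imp_continuous unfolding test_fns_iff by metis

text \<open>The class of polynomials of degree at most P is invariant under affine substitutions,
  which a single monomial is not; in this form vanishing moments can be transported.\<close>

lemma vanishing_moments_iff:
  fixes f :: "real ^ 'n::finite \<Rightarrow> complex"
  assumes "f \<in> test_fns"
  shows "vanishing_moments P f \<longleftrightarrow> (\<forall>p. poly_deg P p \<longrightarrow> (LINT x|lborel. p x * f x) = 0)"
proof safe
  fix p :: "real ^ 'n \<Rightarrow> complex" assume v: "vanishing_moments P f" and "poly_deg P p"
  then obtain xs :: "(complex \<times> ('n \<Rightarrow> nat)) list"
    where xs: "\<forall>(c, \<alpha>)\<in>set xs. mi_order \<alpha> \<le> P" "\<And>x. p x = (\<Sum>(c, \<alpha>)\<leftarrow>xs. c * of_real (vpow x \<alpha>))"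
    using poly_deg_monomials by blast
  have "integrable lborel (\<lambda>x. (\<Sum>(c, \<alpha>)\<leftarrow>xs. c * of_real (vpow x \<alpha>)) * f x) \<and>
    (LINT x|lborel. (\<Sum>(c, \<alpha>)\<leftarrow>xs. c * of_real (vpow x \<alpha>)) * f x) = 0"
    using xs(1)
  proof (induction xs)
    case (Cons a xs)
    obtain c and \<alpha> :: "'n \<Rightarrow> nat" where a: "a = (c, \<alpha>)" by fastforce
    have 1: "integrable lborel (\<lambda>x. of_real (vpow x \<alpha>) * f x)"
      by (intro test_fns_integrable test_fns_mult assms poly_deg_smooth[OF poly_deg_vpow])
    have 2: "(LINT x|lborel. of_real (vpow x \<alpha>) * f x) = 0"
      using v Cons.prems a unfolding vanishing_moments_def scaleR_conv_of_real by auto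
    have eq: "(\<Sum>(c, \<alpha>)\<leftarrow>a # xs. c * of_real (vpow x \<alpha>)) * f x = c * (of_real (vpow x \<alpha>) * f x) + (\<Sum>(c, \<alpha>)\<leftarrow>xs. c * of_real (vpow x \<alpha>)) * f x" for x
      by (simp add: a algebra_simps)
    show ?case unfolding eq using Cons 1 2 by (auto simp: integral_add)
  qed simp
  then show "(LINT x|lborel. p x * f x) = 0" by (simp add: xs(2))
next
  assume "\<forall>p :: real ^ 'n \<Rightarrow> complex. poly_deg P p \<longrightarrow> (LINT x|lborel. p x * f x) = 0"
  then show "vanishing_moments P f"
    unfolding vanishing_moments_def scaleR_conv_of_real using poly_deg_mono[OF poly_deg_vpow] by blast
qed

lemma test_fns0_iff: "f \<in> test_fns0 P \<longleftrightarrow> f \<in> test_fns \<and> (\<forall>p. poly_deg P p \<longrightarrow> (LINT x|lborel. p x * f x) = 0)"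
  using vanishing_moments_iff by (auto simp: test_fns0_def)

lemma test_fns0_imp: "f \<in> test_fns0 P \<Longrightarrow> f \<in> test_fns"
  by (simp add: test_fns0_def)

lemma test_fns0_mono: "f \<in> test_fns0 P \<Longrightarrow> Q \<le> P \<Longrightarrow> f \<in> test_fns0 Q"
  by (auto simp: test_fns0_def vanishing_moments_def)

lemma lborel_integral_affine:
  fixes f :: "'a::euclidean_space \<Rightarrow> 'b::{banach, second_countable_topology}"
  assumes "f \<in> borel_measurable borel" "c \<noteq> 0"
  shows "(LINT x|lborel. f x) = \<bar>c\<bar> ^ DIM('a) *\<^sub>R (LINT x|lborel. f (c *\<^sub>R x + t))"
proof -
  note [measurable] = assms(1)
  have "(LINT x|lborel. f x) = (LINT x|density (distr lborel borel (\<lambda>x. t + c *\<^sub>R x)) (\<lambda>_. \<bar>c\<bar> ^ DIM('a)). f x)"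
    using lborel_affine[OF assms(2), of t] by simp
  also have "\<dots> = \<bar>c\<bar> ^ DIM('a) *\<^sub>R (LINT x|lborel. f (c *\<^sub>R x + t))"
    by (simp add: integral_density integral_distr add.commute)
  finally show ?thesis .
qed

lemma test_fns_measurable: "f \<in> test_fns \<Longrightarrow> f \<in> borel_measurable borel"
  by (intro borel_measurable_continuous_onI smooth_imp_continuous test_fns_smooth)

text \<open>A change of variables puts the inverse affine map on the polynomial, whose degree bound
  does not change.\<close>

lemma test_fns0_scale:
  assumes "f \<in> test_fns0 P" "r \<noteq> 0"
  shows "(\<lambda>x. f (r *\<^sub>R x + b)) \<in> test_fns0 P"
  unfolding test_fns0_iff
proof (intro conjI allI impI)
  show t: "(\<lambda>x. f (r *\<^sub>R x + b)) \<in> test_fns" using test_fns_scale assms test_fns0_imp by blast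
  fix p :: "real ^ 'a \<Rightarrow> complex" assume p: "poly_deg P p"
  let ?q = "\<lambda>x. p ((1/r) *\<^sub>R x + (- (1/r) *\<^sub>R b))"
  have q: "poly_deg P ?q" by (rule poly_deg_affine[OF p])
  have "(\<lambda>x. ?q x * f x) \<in> borel_measurable borel"
    by (intro test_fns_measurable test_fns_mult poly_deg_smooth[OF q] test_fns0_imp[OF assms(1)])
  from lborel_integral_affine[OF this assms(2), of b]
  have "(LINT x|lborel. ?q x * f x) = \<bar>r\<bar> ^ DIM(real ^ 'a) *\<^sub>R (LINT x|lborel. p x * f (r *\<^sub>R x + b))"
    using assms(2) by (simp add: scaleR_right_distrib)
  moreover have "(LINT x|lborel. ?q x * f x) = 0" using assms(1) q test_fns0_iff by blast
  ultimately show "(LINT x|lborel. p x * f (r *\<^sub>R x + b)) = 0" using assms(2) by simp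
qed

lemma vector_derivative_quotient_tendsto:
  fixes g :: "real \<Rightarrow> 'a::real_normed_vector"
  assumes "(g has_vector_derivative d) (at a)"
  shows "((\<lambda>s. (g s - g a) /\<^sub>R (s - a)) \<longlongrightarrow> d) (at a)"
proof -
  have "((\<lambda>s. inverse (norm (s - a)) *\<^sub>R (g s - (g a + (s - a) *\<^sub>R d))) \<longlongrightarrow> 0) (at a)"
    using assms by (simp add: has_vector_derivative_def has_derivative_at2 inverse_eq_divide)
  then have n: "((\<lambda>s. norm (inverse (norm (s - a)) *\<^sub>R (g s - (g a + (s - a) *\<^sub>R d)))) \<longlongrightarrow> 0) (at a)"
    by (rule tendsto_norm_zero)
  have "norm (inverse (norm (s - a)) *\<^sub>R (g s - (g a + (s - a) *\<^sub>R d))) = dist ((g s - g a) /\<^sub>R (s - a)) d"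
    if "s \<noteq> a" for s
  proof -
    have "(g s - g a) /\<^sub>R (s - a) - d = (g s - (g a + (s - a) *\<^sub>R d)) /\<^sub>R (s - a)"
      using that by (simp add: scaleR_diff_right scaleR_add_right)
    then show ?thesis by (simp add: dist_norm)
  qed
  then have "((\<lambda>s. dist ((g s - g a) /\<^sub>R (s - a)) d) \<longlongrightarrow> 0) (at a)"
    by (intro Lim_transform_eventually[OF n]) (auto simp: eventually_at_filter)
  then show ?thesis by (rule tendsto_dist_iff[THEN iffD2])
qed

text \<open>Each difference quotient has vanishing moments, being a combination of f and a translate
  of f, and dominated convergence passes to the derivative. This takes the place of an integration
  by parts.\<close>

lemma test_fns0_partial_deriv:
  assumes "f \<in> test_fns0 P"
  shows "partial_deriv i f \<in> test_fns0 P"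
  unfolding test_fns0_iff
proof (intro conjI allI impI)
  have f: "f \<in> test_fns" using assms test_fns0_imp by blast
  show pf: "partial_deriv i f \<in> test_fns" using test_fns_iter_pd[OF f, of "[i]"] by simp
  fix p :: "real ^ 'a \<Rightarrow> complex" assume p: "poly_deg P p"
  obtain r where r: "\<And>x. r < norm x \<Longrightarrow> f x = 0" using f test_fns_radius by blast
  obtain B where B: "B > 0" "\<And>x. norm (partial_deriv i f x) \<le> B" using test_fns_bounded[OF pf] by blast
  have d: "(f has_derivative frechet_derivative f (at x)) (at x)" for x
    using smooth_has_derivative test_fns_smooth f by blast
  define e where "e = (axis i 1 :: real ^ 'a)"
  have e: "norm e = 1" by (simp add: e_def)
  have vd: "((\<lambda>t. f (x + t *\<^sub>R e)) has_vector_derivative partial_deriv i f (x + t *\<^sub>R e)) (at t)" for x t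
    using has_vector_derivative_along_line[OF d] by (simp add: partial_deriv_def e_def)
  \<comment> \<open>Steps of length at most 1 keep the supports of all translates in the ball of
    radius r + 1, so one dominating function serves for all n.\<close>
  define t where "t n = inverse (real (Suc n))" for n
  have t: "0 < t n" "t n \<le> 1" for n by (auto simp: t_def field_simps)
  define g where "g n x = p x * ((f (x + t n *\<^sub>R e) - f x) /\<^sub>R t n)" for n x
  have g0: "(LINT x|lborel. g n x) = 0" for n
  proof -
    have s: "(\<lambda>x. f (1 *\<^sub>R x + t n *\<^sub>R e)) \<in> test_fns0 P" by (rule test_fns0_scale[OF assms]) simp
    have "(LINT x|lborel. p x * f (x + t n *\<^sub>R e)) = 0" "(LINT x|lborel. p x * f x) = 0"
      using s assms p unfolding test_fns0_iff by auto
    moreover have "integrable lborel (\<lambda>x. p x * f (x + t n *\<^sub>R e))" "integrable lborel (\<lambda>x. p x * f x)"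
      using test_fns_integrable[OF test_fns_mult[OF test_fns0_imp[OF s] poly_deg_smooth[OF p]]]
        test_fns_integrable[OF test_fns_mult[OF f poly_deg_smooth[OF p]]] by simp_all
    moreover have "g n = (\<lambda>x. inverse (t n) *\<^sub>R (p x * f (x + t n *\<^sub>R e) - p x * f x))"
      by (auto simp: g_def fun_eq_iff scaleR_conv_of_real algebra_simps)
    ultimately show ?thesis by simp
  qed
  have pc: "continuous_on S p" for S using smooth_imp_continuous poly_deg_smooth p by blast
  have fc: "continuous_on S f" for S using smooth_imp_continuous test_fns_smooth f by blast
  have "(\<lambda>n. LINT x|lborel. g n x) \<longlonglongrightarrow> (LINT x|lborel. p x * partial_deriv i f x)"
  proof (rule integral_dominated_convergence[where w = "\<lambda>x. indicator (cball 0 (r + 1)) x *\<^sub>R (norm (p x) * B)"])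
    show "(\<lambda>x. p x * partial_deriv i f x) \<in> borel_measurable lborel"
      using test_fns_measurable[OF test_fns_mult[OF pf poly_deg_smooth[OF p]]] by simp
    show "g n \<in> borel_measurable lborel" for n
    proof -
      have "continuous_on UNIV (g n)" unfolding g_def
        by (intro continuous_intros pc fc continuous_on_compose2[OF fc[of UNIV]]) auto
      then show ?thesis by (simp add: borel_measurable_continuous_onI)
    qed
    show "integrable lborel (\<lambda>x. indicator (cball 0 (r + 1)) x *\<^sub>R (norm (p x) * B))"
      by (intro borel_integrable_compact continuous_intros pc) auto
    show "AE x in lborel. (\<lambda>n. g n x) \<longlonglongrightarrow> p x * partial_deriv i f x"
    proof (rule AE_I2)
      fix x
      have "((\<lambda>s. (f (x + s *\<^sub>R e) - f (x + 0 *\<^sub>R e)) /\<^sub>R (s - 0)) \<longlongrightarrow> partial_deriv i f (x + 0 *\<^sub>R e)) (at 0)"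
        by (rule vector_derivative_quotient_tendsto[OF vd])
      moreover have "filterlim t (at 0) sequentially"
        unfolding filterlim_at t_def using LIMSEQ_inverse_real_of_nat by auto
      ultimately have "(\<lambda>n. (f (x + t n *\<^sub>R e) - f (x + 0 *\<^sub>R e)) /\<^sub>R (t n - 0)) \<longlonglongrightarrow> partial_deriv i f (x + 0 *\<^sub>R e)"
        using filterlim_compose by blast
      then show "(\<lambda>n. g n x) \<longlonglongrightarrow> p x * partial_deriv i f x"
        unfolding g_def by (intro tendsto_mult tendsto_const) simp
    qed
    show "AE x in lborel. norm (g n x) \<le> indicator (cball 0 (r + 1)) x *\<^sub>R (norm (p x) * B)" for n
    proof (rule AE_I2)
      fix x
      show "norm (g n x) \<le> indicator (cball 0 (r + 1)) x *\<^sub>R (norm (p x) * B)"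
      proof (cases "norm x \<le> r + 1")
        case True
        have "norm (f (x + t n *\<^sub>R e) - f (x + 0 *\<^sub>R e)) \<le> B * t n"
          by (rule interval_mvt_bound[where g = "\<lambda>s. f (x + s *\<^sub>R e)", OF vd]) (use B t[of n] in auto)
        then have "norm ((f (x + t n *\<^sub>R e) - f x) /\<^sub>R t n) \<le> B"
          unfolding norm_scaleR using t[of n] by (simp add: field_simps)
        then show ?thesis using True unfolding g_def norm_mult by (auto intro!: mult_left_mono)
      next
        case False
        have "norm x \<le> norm (x + t n *\<^sub>R e) + 1"
          using norm_triangle_ineq4[of "x + t n *\<^sub>R e" "t n *\<^sub>R e"] e t[of n] by simp
        then have "f (x + t n *\<^sub>R e) = 0" "f x = 0" using False r by auto
        then show ?thesis using B(1) by (simp add: g_def)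
      qed
    qed
  qed
  then show "(LINT x|lborel. p x * partial_deriv i f x) = 0" by (simp add: g0 LIMSEQ_const_iff)
qed

lemma test_fns0_iter_pd: "f \<in> test_fns0 P \<Longrightarrow> iter_pd is f \<in> test_fns0 P"
  by (induction "is") (auto intro: test_fns0_partial_deriv)

lemma test_fns0_cmult: "f \<in> test_fns0 P \<Longrightarrow> (\<lambda>x. c * f x) \<in> test_fns0 P"
  unfolding test_fns0_iff using test_fns_cmult by (auto simp: mult.left_commute[of _ c])

lemma vpow_scale: "vpow (c *\<^sub>R x) \<alpha> = c ^ mi_order \<alpha> * vpow x \<alpha>"
  by (simp add: vpow_def mi_order_def power_mult_distrib prod.distrib power_sum)

text \<open>Dilation by 2 multiplies the moments of order \<open>s\<close> by \<open>2\<^bsup>n+s\<^esup>\<close>, so a suitable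
  combination of a cutoff and its dilate has no moments of order \<open>s\<close>.\<close>

lemma exists_cutoff_moments:
  "\<exists>\<eta>\<in>test_fns0 Q. \<forall>x \<in> ball (0 :: real ^ 'n::finite) 1. \<eta> x = 1"
proof -
  have "\<exists>\<eta>\<in>test_fns. (\<forall>x \<in> ball (0 :: real ^ 'n) 1. \<eta> x = 1) \<and>
    (\<forall>\<alpha>. mi_order \<alpha> < s \<longrightarrow> (LINT x|lborel. vpow x \<alpha> *\<^sub>R \<eta> x) = 0)" for s
  proof (induction s)
    case 0
    then show ?case using exists_cutoff by auto
  next
    case (Suc s)
    then obtain \<eta> :: "real ^ 'n \<Rightarrow> complex" where \<eta>: "\<eta> \<in> test_fns" "\<And>x. x \<in> ball 0 1 \<Longrightarrow> \<eta> x = 1"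
      "\<And>\<alpha>. mi_order \<alpha> < s \<Longrightarrow> (LINT x|lborel. vpow x \<alpha> *\<^sub>R \<eta> x) = 0" by blast
    define c :: complex where "c = 2 ^ (CARD('n) + s)"
    have "(1::real) < 2 ^ (CARD('n) + s)" by (rule one_less_power) (auto simp: add_pos_nonneg)
    then have "(2::real) ^ (CARD('n) + s) \<noteq> 1" by (metis less_irrefl)
    then have c1: "1 - c \<noteq> 0" unfolding c_def
      by (metis eq_iff_diff_eq_0 of_real_eq_1_iff of_real_numeral of_real_power)
    \<comment> \<open>Both the cutoff and its dilate are 1 on the unit ball, so the prefactor
      restores the value 1 there. Moments of order below s stay zero, and the induction over s
      removes one order at a time.\<close>
    define \<zeta> where "\<zeta> x = inverse (1 - c) * (\<eta> ((1/2) *\<^sub>R x + 0) - c * \<eta> x)" for x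
    have h: "(\<lambda>x. \<eta> ((1/2) *\<^sub>R x + 0)) \<in> test_fns" by (rule test_fns_scale[OF \<eta>(1)]) simp
    have "\<zeta> \<in> test_fns" unfolding \<zeta>_def[abs_def] by (intro test_fns_cmult test_fns_diff h \<eta>(1))
    moreover have "\<zeta> x = 1" if "x \<in> ball 0 1" for x
      using \<eta>(2)[of x] \<eta>(2)[of "(1/2) *\<^sub>R x"] that c1 by (simp add: \<zeta>_def)
    moreover have "(LINT x|lborel. vpow x \<alpha> *\<^sub>R \<zeta> x) = 0" if "mi_order \<alpha> < Suc s" for \<alpha>
    proof -
      let ?m = "LINT x|lborel. vpow x \<alpha> *\<^sub>R \<eta> x"
      have vs: "smooth (\<lambda>x :: real ^ 'n. complex_of_real (vpow x \<alpha>))" by (rule poly_deg_smooth[OF poly_deg_vpow])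
      note i1 = test_fns_mult[OF h vs] and i2 = test_fns_mult[OF \<eta>(1) vs]
      have "(LINT x|lborel. of_real (vpow x \<alpha>) * \<eta> ((1/2) *\<^sub>R x + 0)) =
        \<bar>2\<bar> ^ DIM(real ^ 'n) *\<^sub>R (LINT x|lborel. of_real (vpow (2 *\<^sub>R x + 0) \<alpha>) * \<eta> ((1/2) *\<^sub>R (2 *\<^sub>R x + 0) + 0))"
        by (rule lborel_integral_affine[OF test_fns_measurable[OF i1]]) simp
      also have "\<dots> = 2 ^ CARD('n) * 2 ^ mi_order \<alpha> * ?m"
        unfolding add_0_right vpow_scale scaleR_scaleR
        by (simp add: mult.assoc) (simp add: scaleR_conv_of_real)
      finally have m2: "(LINT x|lborel. of_real (vpow x \<alpha>) * \<eta> ((1/2) *\<^sub>R x + 0)) = 2 ^ CARD('n) * 2 ^ mi_order \<alpha> * ?m" .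
      have "(LINT x|lborel. vpow x \<alpha> *\<^sub>R \<zeta> x) = (LINT x|lborel. inverse (1 - c) *
          (of_real (vpow x \<alpha>) * \<eta> ((1/2) *\<^sub>R x + 0) - c * (of_real (vpow x \<alpha>) * \<eta> x)))"
        by (simp add: \<zeta>_def scaleR_conv_of_real algebra_simps)
      also have "\<dots> = inverse (1 - c) * (2 ^ CARD('n) * 2 ^ mi_order \<alpha> * ?m - c * ?m)"
        using test_fns_integrable[OF i1] test_fns_integrable[OF i2] m2 by (simp add: scaleR_conv_of_real)
      also have "\<dots> = 0"
      proof (cases "mi_order \<alpha> < s")
        case True
        then show ?thesis using \<eta>(3) by simp
      next
        case False
        then have "mi_order \<alpha> = s" using that by simp
        then show ?thesis by (simp add: c_def power_add)
      qed
      finally show ?thesis .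
    qed
    ultimately show ?case by blast
  qed
  from this[of "Suc Q"] show ?thesis
    by (auto simp: test_fns0_def vanishing_moments_def less_Suc_eq_le)
qed

section \<open>Kernels acting on functions with vanishing moments\<close>

text \<open>The expansion is in the first variable, which is always that of the narrow function; in
  the application \<sigma> = M+\<gamma> and N = n+\<nu>+M+\<gamma>. In this form a kernel and its
  transpose are treated alike.\<close>

definition taylor_kernel :: "nat \<Rightarrow> real \<Rightarrow> real \<Rightarrow> (real ^ 'n::finite \<Rightarrow> real ^ 'n \<Rightarrow> complex) \<Rightarrow> bool"
  where "taylor_kernel M \<sigma> N K \<longleftrightarrow> continuous_on {(x, y). x \<noteq> y} (\<lambda>(x, y). K x y) \<and>
    (\<exists>C\<ge>0. \<forall>v c h. norm h < norm (c - v) / 2 \<longrightarrow>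
      norm (K (c + h) v - taylor M (\<lambda>u. K u v) c (c + h)) \<le> C * norm h powr \<sigma> * norm (c - v) powr - N)"

text \<open>The segment from c to c+h avoids v because |h| < |c-v|/2. On it the Hoelder bound for
  the derivatives of order M supplies the increment bound demanded by
  \<open>taylor_bound\<close>.\<close>

lemma taylor_hoelder_bound:
  fixes f :: "real ^ 'n::finite \<Rightarrow> complex"
  assumes "Ck_on M {u. u \<noteq> v} f" "0 < \<gamma>" "norm h < norm (c - v) / 2" "X \<ge> 0"
    and "\<And>\<alpha> h'. mi_order \<alpha> = M \<Longrightarrow> norm h' \<le> norm h \<Longrightarrow>
      norm (multi_deriv \<alpha> f (c + h') - multi_deriv \<alpha> f c) \<le> X * norm h' powr \<gamma>"
  shows "norm (f (c + h) - taylor M f c (c + h)) \<le> real CARD('n) ^ M * X * norm h powr (real M + \<gamma>)"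
proof -
  have S: "open {u. u \<noteq> v}" by (simp add: open_Collect_neq)
  have ne: "c + t *\<^sub>R h \<noteq> v" if "0 \<le> t" "t \<le> 1" for t
  proof
    assume "c + t *\<^sub>R h = v"
    then have v: "v = c + t *\<^sub>R h" by simp
    have "c - v = - (t *\<^sub>R h)" unfolding v by simp
    then have "norm (c - v) = norm (t *\<^sub>R h)" by simp
    also have "\<dots> \<le> norm h" using that by (simp add: mult_left_le_one_le)
    finally show False using assms(3) norm_ge_zero[of "c - v"] by linarith
  qed
  have "norm (f (c + h) - taylor M f c (c + h)) \<le> (real CARD('n) * norm (c + h - c)) ^ M * (X * norm h powr \<gamma>)"
  proof (rule taylor_bound[OF S assms(1)])
    fix t :: real assume t: "0 \<le> t" "t \<le> 1"
    show "c + t *\<^sub>R (c + h - c) \<in> {u. u \<noteq> v}" using ne[OF t] by simp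
    fix "is" :: "'n list" assume l: "length is = M"
    have n: "norm (t *\<^sub>R h) \<le> norm h" using t by (simp add: mult_left_le_one_le)
    have "iter_pd is f z = multi_deriv (count (mset is)) f z" if "z \<noteq> v" for z
      using iter_pd_conv_multi_deriv[OF S, of "is" f z] assms(1) l that by simp
    then have "norm (iter_pd is f (c + t *\<^sub>R h) - iter_pd is f c) \<le> X * norm (t *\<^sub>R h) powr \<gamma>"
      using assms(5)[OF _ n, of "count (mset is)"] ne[OF t] ne[of 0] l by (simp add: mi_order_count)
    also have "\<dots> \<le> X * norm h powr \<gamma>" using n assms by (intro mult_left_mono powr_mono2) auto
    finally show "norm (iter_pd is f (c + t *\<^sub>R (c + h - c)) - iter_pd is f c) \<le> X * norm h powr \<gamma>" by simp
  qed
  also have "\<dots> = real CARD('n) ^ M * X * norm h powr (real M + \<gamma>)"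
    by (cases "h = 0") (auto simp: power_mult_distrib powr_add powr_realpow mult_ac)
  finally show ?thesis .
qed

lemma taylor_kernelI:
  fixes K :: "real ^ 'n::finite \<Rightarrow> real ^ 'n \<Rightarrow> complex"
  assumes "continuous_on {(x, y). x \<noteq> y} (\<lambda>(x, y). K x y)" and Ck: "\<And>v. Ck_on M {u. u \<noteq> v} (\<lambda>u. K u v)" and \<gamma>: "0 < \<gamma>"
    and C: "\<And>\<alpha> c v h. mi_order \<alpha> = M \<Longrightarrow> norm h < norm (c - v) / 2 \<Longrightarrow>
      norm (multi_deriv \<alpha> (\<lambda>u. K u v) (c + h) - multi_deriv \<alpha> (\<lambda>u. K u v) c) \<le> C * norm h powr \<gamma> * norm (c - v) powr - N"
  shows "taylor_kernel M (real M + \<gamma>) N K"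
proof -
  have "norm (K (c + h) v - taylor M (\<lambda>u. K u v) c (c + h))
      \<le> (real CARD('n) ^ M * \<bar>C\<bar>) * norm h powr (real M + \<gamma>) * norm (c - v) powr - N"
    if h: "norm h < norm (c - v) / 2" for v c h
  proof -
    have "norm (K (c + h) v - taylor M (\<lambda>u. K u v) c (c + h))
       \<le> real CARD('n) ^ M * (\<bar>C\<bar> * norm (c - v) powr - N) * norm h powr (real M + \<gamma>)"
    proof (rule taylor_hoelder_bound[OF Ck \<gamma> h])
      fix \<alpha> :: "'n \<Rightarrow> nat" and h' :: "real ^ 'n" assume \<alpha>: "mi_order \<alpha> = M" and "norm h' \<le> norm h"
      then have "norm h' < norm (c - v) / 2" using h by simp
      note C[OF \<alpha> this]
      also have "C * norm h' powr \<gamma> * norm (c - v) powr - N \<le> \<bar>C\<bar> * norm h' powr \<gamma> * norm (c - v) powr - N"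
        by (intro mult_right_mono) auto
      finally show "norm (multi_deriv \<alpha> (\<lambda>u. K u v) (c + h') - multi_deriv \<alpha> (\<lambda>u. K u v) c)
          \<le> \<bar>C\<bar> * norm (c - v) powr - N * norm h' powr \<gamma>" by (simp add: mult_ac)
    qed simp
    then show ?thesis by (simp add: mult_ac)
  qed
  moreover have "0 \<le> real CARD('n) ^ M * \<bar>C\<bar>" by simp
  ultimately show ?thesis using assms(1) unfolding taylor_kernel_def by blast
qed

text \<open>The expansion in one variable uses the pure derivatives of order M in that variable,
  obtained by setting the other multi-index to 0.\<close>

lemma SIO_kernel_imp_taylor_kernel:
  fixes K :: "real ^ 'n::finite \<Rightarrow> real ^ 'n \<Rightarrow> complex"
  assumes K: "SIO_kernel \<nu> M \<gamma> K" and \<gamma>: "0 < \<gamma>"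
  shows "taylor_kernel M (real M + \<gamma>) (real CARD('n) + \<nu> + real M + \<gamma>) K"
    and "taylor_kernel M (real M + \<gamma>) (real CARD('n) + \<nu> + real M + \<gamma>) (\<lambda>x y. K y x)"
proof -
  let ?N = "real CARD('n) + \<nu> + real M + \<gamma>"
  let ?D = "{(x :: real ^ 'n, y :: real ^ 'n). x \<noteq> y}"
  have Ck: "Ck_on M ?D (\<lambda>(x, y). K x y)" using K by (simp add: SIO_kernel_def)
  have cont: "continuous_on ?D (\<lambda>(x, y). K x y)" by (rule Ck_on_continuous[OF Ck])
  have "continuous_on ?D ((\<lambda>(x, y). K x y) \<circ> (\<lambda>(x, y). (y, x)))"
    by (intro continuous_on_compose continuous_on_subset[OF cont]) (auto simp: case_prod_unfold intro!: continuous_intros)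
  then have cont': "continuous_on ?D (\<lambda>(x, y). K y x)" by (simp add: comp_def case_prod_unfold)
  have D: "open ?D" by (simp add: case_prod_unfold open_Collect_neq continuous_on_fst continuous_on_snd continuous_on_id)
  have o: "open {u :: real ^ 'n. u \<noteq> v}" for v by (simp add: open_Collect_neq)
  obtain C where C: "\<And>\<alpha> \<beta> x y h. mi_order \<alpha> + mi_order \<beta> = M \<Longrightarrow> norm h < norm (x - y) / 2 \<Longrightarrow>
       norm (multi_deriv2 \<alpha> \<beta> K (x + h) y - multi_deriv2 \<alpha> \<beta> K x y)
       + norm (multi_deriv2 \<alpha> \<beta> K x y - multi_deriv2 \<alpha> \<beta> K x (y + h))
         \<le> C * norm h powr \<gamma> * norm (x - y) powr - ?N"
    using K unfolding SIO_kernel_def by blast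
  show "taylor_kernel M (real M + \<gamma>) ?N K"
  proof (rule taylor_kernelI[OF cont _ \<gamma>])
    have "bounded_linear (\<lambda>u :: real ^ 'n. (u, 0 :: real ^ 'n))" by (intro bounded_linear_intros)
    then have "Ck_on M {u. u \<noteq> v} (\<lambda>u. case (u, 0) + (0, v) of (x, y) \<Rightarrow> K x y)" for v
      by (intro Ck_on_affine_comp[OF o D _ Ck]) auto
    then show "Ck_on M {u. u \<noteq> v} (\<lambda>u. K u v)" for v by simp
    fix \<alpha> :: "'n \<Rightarrow> nat" and c v h :: "real ^ 'n" assume "mi_order \<alpha> = M" "norm h < norm (c - v) / 2"
    then show "norm (multi_deriv \<alpha> (\<lambda>u. K u v) (c + h) - multi_deriv \<alpha> (\<lambda>u. K u v) c) \<le> C * norm h powr \<gamma> * norm (c - v) powr - ?N"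
      using C[of \<alpha> "\<lambda>_. 0" h c v] norm_ge_zero unfolding multi_deriv2_def multi_deriv_0 mi_order_0
      by (smt (verit, best) add.right_neutral)
  qed
  show "taylor_kernel M (real M + \<gamma>) ?N (\<lambda>x y. K y x)"
  proof (rule taylor_kernelI[OF cont' _ \<gamma>])
    have "bounded_linear (\<lambda>u :: real ^ 'n. (0 :: real ^ 'n, u))" by (intro bounded_linear_intros)
    then have "Ck_on M {u. u \<noteq> v} (\<lambda>u. case (0, u) + (v, 0) of (x, y) \<Rightarrow> K x y)" for v
      by (intro Ck_on_affine_comp[OF o D _ Ck]) auto
    then show "Ck_on M {u. u \<noteq> v} (\<lambda>u. K v u)" for v by simp
    fix \<alpha> :: "'n \<Rightarrow> nat" and c v h :: "real ^ 'n" assume "mi_order \<alpha> = M" "norm h < norm (c - v) / 2"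
    then show "norm (multi_deriv \<alpha> (\<lambda>u. K v u) (c + h) - multi_deriv \<alpha> (\<lambda>u. K v u) c) \<le> C * norm h powr \<gamma> * norm (c - v) powr - ?N"
      using C[of "\<lambda>_. 0" \<alpha> h v c] norm_ge_zero norm_minus_commute[of c v]
        norm_minus_commute[of "multi_deriv \<alpha> (\<lambda>u. K v u) (c + h)"]
      unfolding multi_deriv2_def multi_deriv_0 mi_order_0
      by (smt (verit, best) add.left_neutral)
  qed
qed

section \<open>Dilates, and integrals of radial tails\<close>

text \<open>No factor t^(-n) is included, and the argument is reflected as in
  \<open>dil_trans\<close>. A real scale t in place of 2^(-k) keeps powers of two out of the
  operator estimates.\<close>

definition dil :: "(real ^ 'n::finite \<Rightarrow> complex) \<Rightarrow> real \<Rightarrow> real ^ 'n \<Rightarrow> real ^ 'n \<Rightarrow> complex"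
  where "dil g t a u = g ((a - u) /\<^sub>R t)"

lemma dil_conv_scale: "dil g t a = (\<lambda>u. g ((- inverse t) *\<^sub>R u + inverse t *\<^sub>R a))"
  by (simp add: dil_def fun_eq_iff algebra_simps)

lemma dil_eq_0: "\<forall>x. \<rho> < norm x \<longrightarrow> g x = 0 \<Longrightarrow> 0 < t \<Longrightarrow> \<rho> * t < norm (u - a) \<Longrightarrow> dil g t a u = 0"
  unfolding dil_def by (simp add: norm_minus_commute divide_inverse[symmetric] less_divide_eq inverse_eq_divide del: scaleR_diff_right)

lemma dil_test_fns: "g \<in> test_fns \<Longrightarrow> 0 < t \<Longrightarrow> dil g t a \<in> test_fns"
  unfolding dil_conv_scale by (rule test_fns_scale) auto

lemma dil_test_fns0: "g \<in> test_fns0 P \<Longrightarrow> 0 < t \<Longrightarrow> dil g t a \<in> test_fns0 P"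
  unfolding dil_conv_scale by (rule test_fns0_scale) auto

lemma iter_pd_dil: "smooth g \<Longrightarrow> iter_pd is (dil g t a) u = of_real ((- inverse t) ^ length is) * dil (iter_pd is g) t a u"
  unfolding dil_conv_scale by (simp only: iter_pd_scale)

lemma norm_iter_pd_dil:
  "smooth g \<Longrightarrow> 0 < t \<Longrightarrow> norm (iter_pd is (dil g t a) u) = inverse t ^ length is * norm (dil (iter_pd is g) t a u)"
  unfolding iter_pd_dil norm_mult norm_of_real power_abs by simp

lemma lborel_integrable_affine:
  fixes f :: "'a::euclidean_space \<Rightarrow> 'b::{banach, second_countable_topology}"
  assumes "integrable lborel f" "c \<noteq> 0"
  shows "integrable lborel (\<lambda>x. f (c *\<^sub>R x + t))"
proof -
  have [measurable]: "f \<in> borel_measurable borel" using assms(1) borel_measurable_integrable by fastforce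
  have "integrable (density (distr lborel borel (\<lambda>x. t + c *\<^sub>R x)) (\<lambda>_. \<bar>c\<bar> ^ DIM('a))) f"
    using lborel_affine[OF assms(2), of t] assms(1) by simp
  then have "integrable (distr lborel borel (\<lambda>x. t + c *\<^sub>R x)) (\<lambda>x. \<bar>c\<bar> ^ DIM('a) *\<^sub>R f x)"
    by (subst (asm) integrable_density) auto
  then have "integrable lborel (\<lambda>x. \<bar>c\<bar> ^ DIM('a) *\<^sub>R f (t + c *\<^sub>R x))"
    by (subst (asm) integrable_distr_eq) auto
  then have "integrable lborel (\<lambda>x. inverse (\<bar>c\<bar> ^ DIM('a)) *\<^sub>R (\<bar>c\<bar> ^ DIM('a) *\<^sub>R f (t + c *\<^sub>R x)))"
    by (rule integrable_scaleR_right)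
  then show ?thesis using assms(2) by (simp add: add.commute)
qed

text \<open>Dyadic decomposition: a point with 2^m \<le> |w| \<le> 2^(m+1) lies in the ball of
  radius 2^(m+1), and the integrand at that point is at most c m. The volume of this ball times c m
  is a constant times 2^(-sm), a geometric series.\<close>

lemma radial_tail_integrable_unit:
  assumes "0 < s"
  shows "integrable lborel (\<lambda>w :: 'a::euclidean_space. indicator {w. 1 \<le> norm w} w * norm w powr - (real DIM('a) + s))"
proof -
  let ?d = "real DIM('a)"
  define f where "f w = indicator {w :: 'a. 1 \<le> norm w} w * norm w powr - (?d + s)" for w
  define c where "c m = 2 powr (- (real m * (?d + s)))" for m :: nat
  have m[measurable]: "f \<in> borel_measurable borel" unfolding f_def[abs_def] by measurable
  have "ennreal (f w) \<le> (\<Sum>m. ennreal (c m) * indicator (cball 0 (2 ^ Suc m)) w)" for w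
  proof (cases "1 \<le> norm w")
    case True
    define m where "m = nat \<lfloor>log 2 (norm w)\<rfloor>"
    have l0: "0 \<le> log 2 (norm w)" using True by (subst zero_le_log_cancel_iff) auto
    have l: "real m \<le> log 2 (norm w)" "log 2 (norm w) \<le> real (Suc m)"
      using l0 unfolding m_def by linarith+
    have w0: "0 < norm w" using True by linarith
    have "2 powr real m \<le> norm w" using l(1) w0 by (simp add: le_log_iff)
    then have a: "norm w powr - (?d + s) \<le> c m"
      unfolding c_def using assms
      by (subst powr_minus, subst powr_minus, subst powr_powr[symmetric])
         (auto intro!: le_imp_inverse_le powr_mono2)
    have "norm w \<le> 2 powr real (Suc m)" using l(2) w0 by (simp add: log_le_iff del: of_nat_Suc)
    then have b: "w \<in> cball 0 (2 ^ Suc m)" by (simp only: powr_realpow) simp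
    have "ennreal (f w) \<le> ennreal (c m) * indicator (cball 0 (2 ^ Suc m)) w"
      using a b True by (auto simp: f_def intro: ennreal_leI)
    also have "\<dots> \<le> (\<Sum>m. ennreal (c m) * indicator (cball 0 (2 ^ Suc m)) w)"
    proof -
      have "sum e {m} \<le> suminf e" for e :: "nat \<Rightarrow> ennreal" by (rule sum_le_suminf) auto
      then have "e m \<le> suminf e" for e :: "nat \<Rightarrow> ennreal" by simp
      then show ?thesis .
    qed
    finally show ?thesis .
  qed (simp add: f_def)
  then have "(\<integral>\<^sup>+w. ennreal (f w) \<partial>lborel) \<le> (\<integral>\<^sup>+w. (\<Sum>m. ennreal (c m) * indicator (cball (0::'a) (2 ^ Suc m)) w) \<partial>lborel)"
    by (intro nn_integral_mono) auto
  also have "\<dots> = (\<Sum>m. \<integral>\<^sup>+w. ennreal (c m) * indicator (cball (0::'a) (2 ^ Suc m)) w \<partial>lborel)"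
    by (rule nn_integral_suminf)
      (intro borel_measurable_times_ennreal borel_measurable_const borel_measurable_indicator, simp)
  also have "\<dots> = (\<Sum>m. ennreal (unit_ball_vol ?d * 2 ^ DIM('a) * (2 powr - s) ^ m))"
  proof (rule suminf_cong)
    fix m
    have "(2::real) ^ (m * DIM('a)) = 2 powr (real m * ?d)"
      by (metis of_nat_mult powr_realpow zero_less_numeral)
    moreover have "(2 powr - s) ^ m = 2 powr (- (real m * s))" by (simp add: powr_realpow[symmetric] powr_powr mult.commute)
    ultimately have "c m * (2 ^ m) ^ DIM('a) = (2 powr - s) ^ m"
      unfolding c_def by (simp add: power_mult[symmetric] powr_add[symmetric] algebra_simps)
    then have "c m * (unit_ball_vol ?d * (2 ^ Suc m) ^ DIM('a)) = unit_ball_vol ?d * 2 ^ DIM('a) * (2 powr - s) ^ m"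
      by (simp add: power_mult_distrib mult_ac)
    then show "(\<integral>\<^sup>+w. ennreal (c m) * indicator (cball (0::'a) (2 ^ Suc m)) w \<partial>lborel) = ennreal (unit_ball_vol ?d * 2 ^ DIM('a) * (2 powr - s) ^ m)"
      by (simp add: nn_integral_cmult_indicator emeasure_cball ennreal_mult[symmetric] c_def del: power_Suc)
  qed
  also have "\<dots> < \<infinity>"
  proof -
    have "summable (\<lambda>m. unit_ball_vol ?d * 2 ^ DIM('a) * (2 powr - s) ^ m)"
      using assms by (intro summable_mult summable_geometric) (simp add: powr_less_one)
    then show ?thesis by (subst suminf_ennreal2) auto
  qed
  finally have "(\<integral>\<^sup>+w. ennreal (norm (f w)) \<partial>lborel) < \<infinity>" by (simp add: f_def abs_mult)
  then show ?thesis by (intro integrableI_bounded) (auto simp: f_def[abs_def])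
qed

text \<open>Scaling by r reduces the tail to radius 1; of the power r^(-(n+s)) the Jacobian r^n
  leaves r^(-s).\<close>

lemma radial_tail_integral:
  fixes a :: "'a::euclidean_space"
  assumes "0 < s" "0 < r"
  defines "J \<equiv> LINT w|lborel. indicator {w :: 'a. 1 \<le> norm w} w * norm w powr - (real DIM('a) + s)"
  shows "integrable lborel (\<lambda>v. indicator {v. r \<le> norm (v - a)} v * norm (v - a) powr - (real DIM('a) + s))"
    and "(LINT v|lborel. indicator {v. r \<le> norm (v - a)} v * norm (v - a) powr - (real DIM('a) + s)) = J * r powr - s"
proof -
  let ?d = "real DIM('a)"
  let ?g = "\<lambda>w :: 'a. indicator {w. 1 \<le> norm w} w * norm w powr - (?d + s)"
  let ?f = "\<lambda>v. indicator {v. r \<le> norm (v - a)} v * norm (v - a) powr - (?d + s)"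
  have eq: "?f (r *\<^sub>R x + a) = r powr - (?d + s) * ?g x" for x
    using assms(2) by (auto simp: indicator_def powr_mult field_simps)
  have eq2: "?f = (\<lambda>v. r powr - (?d + s) * ?g (inverse r *\<^sub>R v + (- inverse r *\<^sub>R a)))"
  proof
    fix v
    have "?f (r *\<^sub>R (inverse r *\<^sub>R v + (- inverse r *\<^sub>R a)) + a) = r powr - (?d + s) * ?g (inverse r *\<^sub>R v + (- inverse r *\<^sub>R a))"
      by (rule eq)
    then show "?f v = r powr - (?d + s) * ?g (inverse r *\<^sub>R v + (- inverse r *\<^sub>R a))"
      using assms(2) by (simp add: scaleR_add_right scaleR_right_diff_distrib)
  qed
  have "integrable lborel (\<lambda>v. ?g (inverse r *\<^sub>R v + (- inverse r *\<^sub>R a)))"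
    by (rule lborel_integrable_affine[OF radial_tail_integrable_unit[OF assms(1)]]) (use assms(2) in auto)
  then show i: "integrable lborel ?f" unfolding eq2 by (rule integrable_mult_right)
  have "(LINT v|lborel. ?f v) = \<bar>r\<bar> ^ DIM('a) *\<^sub>R (LINT x|lborel. ?f (r *\<^sub>R x + a))"
    by (rule lborel_integral_affine) (use borel_measurable_integrable[OF i] assms(2) in auto)
  also have "\<dots> = r ^ DIM('a) * (r powr - (?d + s) * J)"
    unfolding eq J_def using assms(2) by simp
  also have "\<dots> = J * r powr - s"
    using assms(2) by (simp add: powr_realpow[symmetric] powr_add[symmetric] mult.assoc[symmetric]) 
  finally show "(LINT v|lborel. ?f v) = J * r powr - s" .
qed

section \<open>Decay gained from vanishing moments\<close>

text \<open>The moments of g annihilate the Taylor polynomial of K(., v) at a, so K may be replaced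
  by its remainder. On the support |u-a| \<le> \<rho> t the remainder is at most C (\<rho>
  t)^\<sigma> |v-a|^(-N), and integration over a ball of volume comparable to t^n gives the power
  n+\<sigma>. The factor 4 makes |u-a| \<le> |v-a|/4, inside the range of the expansion.\<close>

lemma kernel_moment_bound:
  fixes K :: "real ^ 'n::finite \<Rightarrow> real ^ 'n \<Rightarrow> complex" and g :: "real ^ 'n \<Rightarrow> complex"
  assumes K: "taylor_kernel M \<sigma> N K" and g: "g \<in> test_fns0 M" and \<rho>: "0 < \<rho>" "\<forall>x. \<rho> < norm x \<longrightarrow> g x = 0" and \<sigma>: "0 \<le> \<sigma>"
  shows "\<exists>C\<ge>0. \<forall>a v t. 0 < t \<and> 4 * \<rho> * t \<le> norm (v - a) \<longrightarrow>
    norm (LINT u|lborel. K u v * dil g t a u) \<le> C * t powr (real CARD('n) + \<sigma>) * norm (v - a) powr - N"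
proof -
  obtain C where C: "C \<ge> 0" "\<And>v c h. norm h < norm (c - v) / 2 \<Longrightarrow>
      norm (K (c + h) v - taylor M (\<lambda>u. K u v) c (c + h)) \<le> C * norm h powr \<sigma> * norm (c - v) powr - N"
    using K unfolding taylor_kernel_def by blast
  have cont: "continuous_on {(x, y). x \<noteq> y} (\<lambda>(x, y). K x y)" using K by (simp add: taylor_kernel_def)
  obtain B where B: "B > 0" "\<And>x. norm (g x) \<le> B" using test_fns_bounded[OF test_fns0_imp[OF g]] by blast
  define C' where "C' = C * \<rho> powr \<sigma> * B * (unit_ball_vol (real CARD('n)) * \<rho> ^ CARD('n))"
  have "norm (LINT u|lborel. K u v * dil g t a u) \<le> C' * t powr (real CARD('n) + \<sigma>) * norm (v - a) powr - N"
    if t: "0 < t" and va: "4 * \<rho> * t \<le> norm (v - a)" for a v t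
  proof -
    let ?S = "cball a (\<rho> * t)"
    let ?p = "taylor M (\<lambda>u. K u v) a"
    have rt: "0 < \<rho> * t" using \<rho> t by simp
    have z: "dil g t a u = 0" if "u \<notin> ?S" for u
      by (rule dil_eq_0[OF \<rho>(2) t]) (use that in \<open>simp add: dist_norm norm_minus_commute not_le\<close>)
    have d0: "dil g t a \<in> test_fns0 M" by (rule dil_test_fns0[OF g t])
    have p: "poly_deg M ?p" by (rule poly_deg_taylor)
    have p0: "(LINT u|lborel. ?p u * dil g t a u) = 0" using d0 p test_fns0_iff by blast
    have pi: "integrable lborel (\<lambda>u. ?p u * dil g t a u)"
      by (intro test_fns_integrable test_fns_mult test_fns0_imp[OF d0] poly_deg_smooth[OF p])
    have kc: "continuous_on ?S (\<lambda>u. K u v)"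
    proof -
      have "continuous_on ?S (\<lambda>u. case (u, v) of (x, y) \<Rightarrow> K x y)"
      proof (rule continuous_on_compose2[OF cont])
        have "v \<notin> ?S"
        proof
          assume "v \<in> ?S"
          then have "norm (v - a) \<le> \<rho> * t" by (simp add: dist_norm norm_minus_commute)
          then show False using va rt by linarith
        qed
        then show "(\<lambda>u. (u, v)) ` ?S \<subseteq> {(x, y). x \<noteq> y}" by auto
      qed (intro continuous_intros)
      then show ?thesis by simp
    qed
    have "integrable lborel (\<lambda>u. indicator ?S u *\<^sub>R (K u v * dil g t a u))"
      by (intro borel_integrable_compact compact_cball continuous_intros kc
          smooth_imp_continuous test_fns_smooth test_fns0_imp[OF d0])
    moreover have "(\<lambda>u. indicator ?S u *\<^sub>R (K u v * dil g t a u)) = (\<lambda>u. K u v * dil g t a u)"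
      using z by (auto simp: indicator_def)
    ultimately have ki: "integrable lborel (\<lambda>u. K u v * dil g t a u)" by simp
    let ?b = "C * (\<rho> * t) powr \<sigma> * norm (v - a) powr - N * B"
    have "norm (LINT u|lborel. K u v * dil g t a u) = norm (LINT u|lborel. K u v * dil g t a u - ?p u * dil g t a u)"
      using ki pi p0 by simp
    also have "\<dots> \<le> (LINT u|lborel. norm (K u v * dil g t a u - ?p u * dil g t a u))"
      by (rule integral_norm_bound)
    also have "\<dots> \<le> (LINT u|lborel. indicator ?S u *\<^sub>R ?b)"
    proof (rule integral_mono)
      show "integrable lborel (\<lambda>u. norm (K u v * dil g t a u - ?p u * dil g t a u))" using ki pi by auto
      show "integrable lborel (\<lambda>u. indicator ?S u *\<^sub>R ?b)"
        by (intro borel_integrable_compact compact_cball continuous_intros)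
      fix u
      show "norm (K u v * dil g t a u - ?p u * dil g t a u) \<le> indicator ?S u *\<^sub>R ?b"
      proof (cases "u \<in> ?S")
        case True
        define h where "h = u - a"
        have h: "norm h \<le> \<rho> * t" using True by (simp add: h_def dist_norm norm_minus_commute)
        have "norm (K (a + h) v - taylor M (\<lambda>u. K u v) a (a + h)) \<le> C * norm h powr \<sigma> * norm (a - v) powr - N"
          by (rule C(2)) (use h va rt norm_minus_commute[of a v] in linarith)
        also have "\<dots> \<le> C * (\<rho> * t) powr \<sigma> * norm (a - v) powr - N"
          using h \<sigma> C(1) by (intro mult_right_mono mult_left_mono powr_mono2) auto
        finally have 1: "norm (K u v - ?p u) \<le> C * (\<rho> * t) powr \<sigma> * norm (v - a) powr - N"
          by (simp add: h_def norm_minus_commute)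
        have "norm (K u v * dil g t a u - ?p u * dil g t a u) = norm (K u v - ?p u) * norm (dil g t a u)"
          by (simp add: left_diff_distrib flip: norm_mult)
        also have "\<dots> \<le> ?b"
          using 1 B by (intro mult_mono) (auto simp: dil_def C(1))
        finally show ?thesis using True by simp
      qed (use z in simp)
    qed
    also have "\<dots> = unit_ball_vol (real CARD('n)) * (\<rho> * t) ^ CARD('n) * ?b"
      using rt by (simp add: content_cball)
    also have "\<dots> = C' * t powr (real CARD('n) + \<sigma>) * norm (v - a) powr - N"
      using t \<rho> by (simp add: C'_def powr_mult powr_add powr_realpow power_mult_distrib mult_ac)
    finally show ?thesis .
  qed
  moreover have "C' \<ge> 0" using C(1) B(1) \<rho>(1) by (simp add: C'_def)
  ultimately show ?thesis by blast
qed

text \<open>The majorant W of |\<phi>(v)| |v-a|^(-N) is left open: later it is a radial tail in one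
  case and a constant on a ball in the other. Fubini's theorem is available because the integrand is
  continuous on a compact set that avoids the diagonal, and zero elsewhere.\<close>

lemma kernel_pairing_bound:
  fixes K :: "real ^ 'n::finite \<Rightarrow> real ^ 'n \<Rightarrow> complex" and g :: "real ^ 'n \<Rightarrow> complex"
  assumes K: "taylor_kernel M \<sigma> N K" and g: "g \<in> test_fns0 M" and \<rho>: "0 < \<rho>" "\<forall>x. \<rho> < norm x \<longrightarrow> g x = 0" and \<sigma>: "0 \<le> \<sigma>"
  shows "\<exists>C\<ge>0. \<forall>a t \<phi> W. 0 < t \<and> \<phi> \<in> test_fns \<and> (\<forall>v. norm (v - a) < 4 * \<rho> * t \<longrightarrow> \<phi> v = 0) \<and>
      integrable lborel W \<and> (\<forall>v. norm (\<phi> v) * norm (v - a) powr - N \<le> W v) \<longrightarrow>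
    norm (LINT (u, v)|lborel. K u v * dil g t a u * \<phi> v) \<le> C * t powr (real CARD('n) + \<sigma>) * (LINT v|lborel. W v)"
proof -
  obtain C where C: "C \<ge> 0" "\<And>a v t. 0 < t \<Longrightarrow> 4 * \<rho> * t \<le> norm (v - a) \<Longrightarrow>
    norm (LINT u|lborel. K u v * dil g t a u) \<le> C * t powr (real CARD('n) + \<sigma>) * norm (v - a) powr - N"
    using kernel_moment_bound[OF assms] by blast
  have cont: "continuous_on {(x, y). x \<noteq> y} (\<lambda>(x, y). K x y)" using K by (simp add: taylor_kernel_def)
  have "norm (LINT (u, v)|lborel. K u v * dil g t a u * \<phi> v) \<le> C * t powr (real CARD('n) + \<sigma>) * (LINT v|lborel. W v)"
    if t: "0 < t" and \<phi>: "\<phi> \<in> test_fns" and \<phi>0: "\<And>v. norm (v - a) < 4 * \<rho> * t \<Longrightarrow> \<phi> v = 0"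
      and W: "integrable lborel W" "\<And>v. norm (\<phi> v) * norm (v - a) powr - N \<le> W v" for a t \<phi> W
  proof -
    obtain R where R: "\<And>x. R < norm x \<Longrightarrow> \<phi> x = 0" using \<phi> test_fns_radius by blast
    let ?X = "C * t powr (real CARD('n) + \<sigma>)"
    have rt: "0 < \<rho> * t" using \<rho> t by simp
    define S where "S = cball a (\<rho> * t) \<times> (cball 0 R \<inter> {v. 4 * \<rho> * t \<le> norm (v - a)})"
    define F where "F = (\<lambda>(u, v). K u v * dil g t a u * \<phi> v)"
    have cS: "compact S" unfolding S_def
      by (intro compact_Times compact_cball compact_Int_closed closed_Collect_le continuous_intros)
    have ne: "u \<noteq> v" if "(u, v) \<in> S" for u v
      using that rt by (auto simp: S_def dist_norm norm_minus_commute)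
    have cd: "continuous_on X (dil g t a)" for X
      by (intro smooth_imp_continuous test_fns_smooth dil_test_fns test_fns0_imp[OF g] t)
    have cp: "continuous_on X \<phi>" for X by (intro smooth_imp_continuous test_fns_smooth \<phi>)
    have "continuous_on S F" unfolding F_def case_prod_unfold
    proof (intro continuous_intros)
      show "continuous_on S (\<lambda>x. K (fst x) (snd x))"
        using continuous_on_subset[OF cont, of S] ne by (force simp: case_prod_unfold)
      show "continuous_on S (\<lambda>x. dil g t a (fst x))"
        by (rule continuous_on_compose2[OF cd[of UNIV]]) (auto intro: continuous_intros)
      show "continuous_on S (\<lambda>x. \<phi> (snd x))"
        by (rule continuous_on_compose2[OF cp[of UNIV]]) (auto intro: continuous_intros)
    qed
    from borel_integrable_compact[OF cS this] have "integrable lborel (\<lambda>x. indicator S x *\<^sub>R F x)" .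
    moreover have "(\<lambda>x. indicator S x *\<^sub>R F x) = F"
    proof
      fix x
      show "indicator S x *\<^sub>R F x = F x"
      proof (cases "x \<in> S")
        case False
        obtain u v where x: "x = (u, v)" by fastforce
        consider "u \<notin> cball a (\<rho> * t)" | "norm v > R" | "norm (v - a) < 4 * \<rho> * t"
          using False by (auto simp: x S_def not_le)
        then have "F x = 0"
        proof cases
          case 1
          have "dil g t a u = 0"
            by (rule dil_eq_0[OF \<rho>(2) t]) (use 1 in \<open>simp add: dist_norm norm_minus_commute not_le\<close>)
          then show ?thesis by (simp add: F_def x)
        qed (simp_all add: F_def x R \<phi>0)
        then show ?thesis by simp
      qed simp
    qed
    ultimately have iF: "integrable (lborel \<Otimes>\<^sub>M lborel) F" by (simp add: lborel_prod)
    then have iF': "integrable (lborel \<Otimes>\<^sub>M lborel) (\<lambda>(u, v). F (u, v))" by simp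
    have eq: "(LINT x|lborel. F x) = (LINT v|lborel. LINT u|lborel. F (u, v))"
      using lborel_pair.integral_snd[OF iF'] by (simp add: lborel_prod)
    have iv: "integrable lborel (\<lambda>v. LINT u|lborel. F (u, v))"
      using lborel_pair.integrable_snd[OF iF'] by simp
    have "norm (LINT x|lborel. F x) \<le> (LINT v|lborel. norm (LINT u|lborel. F (u, v)))"
      unfolding eq by (rule integral_norm_bound)
    also have "\<dots> \<le> (LINT v|lborel. ?X * W v)"
    proof (rule integral_mono)
      fix v
      have Fv: "(LINT u|lborel. F (u, v)) = \<phi> v * (LINT u|lborel. K u v * dil g t a u)"
        unfolding F_def by (simp add: mult_ac)
      show "norm (LINT u|lborel. F (u, v)) \<le> ?X * W v"
      proof (cases "4 * \<rho> * t \<le> norm (v - a)")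
        case True
        have "norm (LINT u|lborel. F (u, v)) \<le> norm (\<phi> v) * (?X * norm (v - a) powr - N)"
          unfolding Fv norm_mult using C(2)[OF t True] by (intro mult_left_mono) (auto simp: mult_ac)
        also have "\<dots> = ?X * (norm (\<phi> v) * norm (v - a) powr - N)" by (simp add: mult_ac)
        also have "\<dots> \<le> ?X * W v" using W(2) C(1) by (intro mult_left_mono) auto
        finally show ?thesis .
      next
        case False
        then have "\<phi> v = 0" using \<phi>0 by auto
        moreover have "0 \<le> W v" using W(2)[of v] by (smt (verit) mult_nonneg_nonneg norm_ge_zero powr_ge_zero)
        ultimately show ?thesis unfolding Fv using C(1) by simp
      qed
    qed (use iv W(1) in auto)
    finally show ?thesis by (simp add: F_def)
  qed
  then show ?thesis using C(1) by blast
qed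

section \<open>Pairings of an operator with functions at a larger scale\<close>

text \<open>The normalization of the bumps in \<open>WBP\<close>, where lengths are measured by
  |B|^(1/n).\<close>

definition normalized :: "nat \<Rightarrow> real ^ 'n::finite \<Rightarrow> real \<Rightarrow> (real ^ 'n \<Rightarrow> complex) \<Rightarrow> bool"
  where "normalized N c r f \<longleftrightarrow> supp f \<subseteq> ball c r \<and> (\<forall>\<alpha> x. mi_order \<alpha> \<le> N \<longrightarrow>
    norm (multi_deriv \<alpha> f x) \<le> measure lborel (ball c r) powr (- real (mi_order \<alpha>) / real CARD('n)))"

text \<open>The properties that \<open>T\<close> and \<open>T\<^sup>*\<close> share.  The first variable of \<open>K\<close> is that of \<open>\<psi>\<close>, so for \<open>T\<close>
  this is the transposed kernel.\<close>

definition narrow_oper :: "nat \<Rightarrow> real \<Rightarrow> nat \<Rightarrow> real \<Rightarrow> ('n::finite) oper \<Rightarrow> bool"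
  where "narrow_oper P \<nu> M \<gamma> S \<longleftrightarrow>
    (\<forall>\<psi>\<in>test_fns0 P. \<forall>\<phi>1\<in>test_fns. \<forall>\<phi>2\<in>test_fns. S \<psi> (\<lambda>x. \<phi>1 x + \<phi>2 x) = S \<psi> \<phi>1 + S \<psi> \<phi>2) \<and>
    (\<forall>\<psi>\<in>test_fns0 P. \<forall>\<phi>\<in>test_fns. \<forall>c. S (\<lambda>x. c * \<psi> x) \<phi> = c * S \<psi> \<phi> \<and> S \<psi> (\<lambda>x. c * \<phi> x) = c * S \<psi> \<phi>) \<and>
    (\<exists>K. taylor_kernel M (real M + \<gamma>) (real CARD('n) + \<nu> + real M + \<gamma>) K \<and>
      (\<forall>\<psi>\<in>test_fns0 P. \<forall>\<phi>\<in>test_fns. supp \<psi> \<inter> supp \<phi> = {} \<longrightarrow>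
        S \<psi> \<phi> = (LINT (u, v)|lborel. K u v * \<psi> u * \<phi> v))) \<and>
    (\<exists>N C. C > 0 \<and> (\<forall>c r. \<forall>\<psi>\<in>test_fns0 P. \<forall>\<phi>\<in>test_fns. r > 0 \<and> normalized N c r \<psi> \<and> normalized N c r \<phi> \<longrightarrow>
      norm (S \<psi> \<phi>) \<le> C * measure lborel (ball c r) powr (1 - \<nu> / real CARD('n))))"

lemma narrow_oper_add:
  "narrow_oper P \<nu> M \<gamma> S \<Longrightarrow> \<psi> \<in> test_fns0 P \<Longrightarrow> \<phi>1 \<in> test_fns \<Longrightarrow> \<phi>2 \<in> test_fns \<Longrightarrow>
    S \<psi> (\<lambda>x. \<phi>1 x + \<phi>2 x) = S \<psi> \<phi>1 + S \<psi> \<phi>2"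
  and narrow_oper_cmult:
  "narrow_oper P \<nu> M \<gamma> S \<Longrightarrow> \<psi> \<in> test_fns0 P \<Longrightarrow> \<phi>1 \<in> test_fns \<Longrightarrow> S \<psi> (\<lambda>x. c * \<phi>1 x) = c * S \<psi> \<phi>1"
  by (simp_all add: narrow_oper_def)

lemma narrow_oper_kernel:
  fixes S :: "('n::finite) oper"
  assumes "narrow_oper P \<nu> M \<gamma> S"
  shows "\<exists>K. taylor_kernel M (real M + \<gamma>) (real CARD('n) + \<nu> + real M + \<gamma>) K \<and>
      (\<forall>\<psi>\<in>test_fns0 P. \<forall>\<phi>\<in>test_fns. supp \<psi> \<inter> supp \<phi> = {} \<longrightarrow>
        S \<psi> \<phi> = (LINT (u, v)|lborel. K u v * \<psi> u * \<phi> v))"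
  using assms unfolding narrow_oper_def by (elim conjE)

lemma supp_subset_closed: "closed X \<Longrightarrow> (\<And>u. f u \<noteq> 0 \<Longrightarrow> u \<in> X) \<Longrightarrow> supp f \<subseteq> X"
  unfolding supp_def by (rule closure_minimal) auto

text \<open>A counterpart of \<open>normalized\<close> with an explicit scale t and an amplitude A,
  each derivative costing a factor 1/t. The constants of supports and cutoffs go into \<kappa> and A
  instead of the ball.\<close>

definition adapted :: "nat \<Rightarrow> real \<Rightarrow> real \<Rightarrow> real ^ 'n::finite \<Rightarrow> real \<Rightarrow> (real ^ 'n \<Rightarrow> complex) \<Rightarrow> bool"
  where "adapted N \<kappa> t a A f \<longleftrightarrow> (\<forall>u. \<kappa> * t < norm (u - a) \<longrightarrow> f u = 0) \<and>
    (\<forall>is u. length is \<le> N \<longrightarrow> norm (iter_pd is f u) \<le> A * inverse t ^ length is)"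

text \<open>Weak boundedness is tested on functions normalized by the volume of the ball.
  Homogeneity in both arguments allows division by A and B and by a constant depending only on n,
  \<kappa> and N.\<close>

lemma narrow_oper_wbp:
  fixes S :: "('n::finite) oper"
  assumes S: "narrow_oper P \<nu> M \<gamma> S"
  shows "\<exists>N. \<forall>\<kappa>>0. \<exists>C\<ge>0. \<forall>a t A B. \<forall>\<psi>\<in>test_fns0 P. \<forall>\<phi>\<in>test_fns.
    0 < t \<and> 0 < A \<and> 0 < B \<and> adapted N \<kappa> t a A \<psi> \<and> adapted N \<kappa> t a B \<phi> \<longrightarrow>
    norm (S \<psi> \<phi>) \<le> C * A * B * t powr (real CARD('n) - \<nu>)"
proof -
  let ?n = "real CARD('n)"
  obtain N C where C: "C > 0" and W: "\<And>c r \<psi> \<phi>. \<psi> \<in> test_fns0 P \<Longrightarrow> \<phi> \<in> test_fns \<Longrightarrow>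
        r > 0 \<Longrightarrow> normalized N c r \<psi> \<Longrightarrow> normalized N c r \<phi> \<Longrightarrow>
        norm (S \<psi> \<phi>) \<le> C * measure lborel (ball c r) powr (1 - \<nu> / ?n)"
    using S unfolding narrow_oper_def by (elim conjE exE) blast
  have hom: "S (\<lambda>x. c * \<psi> x) \<phi> = c * S \<psi> \<phi>" "S \<psi> (\<lambda>x. c * \<phi> x) = c * S \<psi> \<phi>"
    if "\<psi> \<in> test_fns0 P" "\<phi> \<in> test_fns" for \<psi> \<phi> c
    using S that unfolding narrow_oper_def by blast+
  have "\<exists>C\<ge>0. \<forall>a t A B. \<forall>\<psi>\<in>test_fns0 P. \<forall>\<phi>\<in>test_fns.
    0 < t \<and> 0 < A \<and> 0 < B \<and> adapted N \<kappa> t a A \<psi> \<and> adapted N \<kappa> t a B \<phi> \<longrightarrow>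
    norm (S \<psi> \<phi>) \<le> C * A * B * t powr (?n - \<nu>)" if \<kappa>: "\<kappa> > 0" for \<kappa>
  proof -
    define V where "V = unit_ball_vol ?n"
    have V: "V > 0" by (simp add: V_def unit_ball_vol_pos)
    \<comment> \<open>Chosen so that the ball of radius 2 \<kappa> t has volume (w t)^n, which turns
      the bounds of the weak boundedness property into powers of t.\<close>
    define w where "w = V powr (1 / ?n) * (2 * \<kappa>)"
    have w: "w > 0" using V \<kappa> by (simp add: w_def)
    \<comment> \<open>The normalized bound for order m is (w t)^(-m), so a factor w^m has to be
      absorbed; D dominates it for all m \<le> N.\<close>
    define D where "D = max 1 w ^ N"
    have D: "D > 0" by (simp add: D_def)
    have wD: "w ^ m \<le> D" if "m \<le> N" for m
    proof -
      have "w ^ m \<le> max 1 w ^ m" using w by (intro power_mono) auto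
      also have "\<dots> \<le> D" unfolding D_def by (rule power_increasing[OF that]) simp
      finally show ?thesis .
    qed
    define C' where "C' = D * D * C * (V powr (1 - \<nu> / ?n) * (2 * \<kappa>) powr (?n - \<nu>))"
    have "norm (S \<psi> \<phi>) \<le> C' * A * B * t powr (?n - \<nu>)"
      if t: "0 < t" and A: "0 < A" and B: "0 < B" and \<psi>: "\<psi> \<in> test_fns0 P" and \<phi>: "\<phi> \<in> test_fns"
        and ad: "adapted N \<kappa> t a A \<psi>" "adapted N \<kappa> t a B \<phi>" for a t \<psi> \<phi> A B
    proof -
      \<comment> \<open>Twice the radius, so that the closed support fits into the open
        ball.\<close>
      define r where "r = 2 * \<kappa> * t"
      have r: "r > 0" "\<kappa> * t < r" using \<kappa> t by (simp_all add: r_def)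
      have vol: "measure lborel (ball a r) = V * r ^ CARD('n)"
        using r by (simp add: content_ball V_def)
      have "V * r ^ CARD('n) = (w * t) powr ?n"
        using V \<kappa> t by (simp add: w_def r_def powr_mult powr_powr powr_realpow power_mult_distrib mult_ac)
      then have vp: "measure lborel (ball a r) powr (- real m / ?n) = inverse (w ^ m) * inverse t ^ m" for m
      proof -
        have "measure lborel (ball a r) powr (- real m / ?n) = (w * t) powr (- real m)"
          unfolding vol \<open>V * r ^ CARD('n) = (w * t) powr ?n\<close> powr_powr by simp
        then show ?thesis using w t by (simp add: powr_minus powr_realpow power_mult_distrib power_inverse)
      qed
      have v1: "measure lborel (ball a r) powr (1 - \<nu> / ?n) = V powr (1 - \<nu> / ?n) * (2 * \<kappa>) powr (?n - \<nu>) * t powr (?n - \<nu>)"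
      proof -
        have e: "?n * (1 - \<nu> / ?n) = ?n - \<nu>" by (simp add: field_simps)
        have "measure lborel (ball a r) powr (1 - \<nu> / ?n) = V powr (1 - \<nu> / ?n) * (r powr ?n) powr (1 - \<nu> / ?n)"
          unfolding vol using V r(1) by (simp add: powr_mult powr_realpow)
        then show ?thesis unfolding powr_powr e unfolding r_def using \<kappa> t by (simp add: powr_mult)
      qed
      have norm_ad: "normalized N a r (\<lambda>x. of_real (inverse (X * D)) * f x)"
        if X: "X > 0" and f: "smooth f" and fa: "adapted N \<kappa> t a X f" for X f
        unfolding normalized_def
      proof (intro conjI allI impI)
        have "supp (\<lambda>x. of_real (inverse (X * D)) * f x) \<subseteq> cball a (\<kappa> * t)"
        proof (rule supp_subset_closed)
          fix u assume "of_real (inverse (X * D)) * f u \<noteq> 0"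
          then have "\<not> \<kappa> * t < norm (u - a)" using fa by (auto simp: adapted_def)
          then show "u \<in> cball a (\<kappa> * t)" by (simp add: dist_norm norm_minus_commute)
        qed simp
        also have "\<dots> \<subseteq> ball a r" using r by auto
        finally show "supp (\<lambda>x. of_real (inverse (X * D)) * f x) \<subseteq> ball a r" .
        fix \<alpha> :: "'n \<Rightarrow> nat" and u assume \<alpha>: "mi_order \<alpha> \<le> N"
        have "norm (multi_deriv \<alpha> (\<lambda>x. of_real (inverse (X * D)) * f x) u) = inverse (X * D) * norm (iter_pd (mi_list \<alpha>) f u)"
          unfolding multi_deriv_conv_iter_pd iter_pd_cmult[OF f] norm_mult norm_of_real using X D by simp
        also have "\<dots> \<le> inverse (X * D) * (X * inverse t ^ mi_order \<alpha>)"
          using fa \<alpha> X D unfolding adapted_def by (intro mult_left_mono) (auto simp: length_mi_list[symmetric])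
        also have "\<dots> = inverse D * inverse t ^ mi_order \<alpha>" using X by (simp add: field_simps)
        also have "\<dots> \<le> inverse (w ^ mi_order \<alpha>) * inverse t ^ mi_order \<alpha>"
          using wD[OF \<alpha>] w t by (intro mult_right_mono le_imp_inverse_le) auto
        finally show "norm (multi_deriv \<alpha> (\<lambda>x. of_real (inverse (X * D)) * f x) u)
          \<le> measure lborel (ball a r) powr (- real (mi_order \<alpha>) / ?n)" unfolding vp .
      qed
      let ?\<psi> = "\<lambda>x. of_real (inverse (A * D)) * \<psi> x" and ?\<phi> = "\<lambda>x. of_real (inverse (B * D)) * \<phi> x"
      have \<phi>': "?\<phi> \<in> test_fns" by (rule test_fns_cmult[OF \<phi>])
      have "norm (S ?\<psi> ?\<phi>) \<le> C * measure lborel (ball a r) powr (1 - \<nu> / ?n)"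
        by (rule W[OF test_fns0_cmult[OF \<psi>] \<phi>' r(1) norm_ad[OF A _ ad(1)] norm_ad[OF B _ ad(2)]])
          (intro test_fns_smooth test_fns0_imp[OF \<psi>] \<phi>)+
      moreover have S_eq: "S ?\<psi> ?\<phi> = of_real (inverse (A * D)) * (of_real (inverse (B * D)) * S \<psi> \<phi>)"
        unfolding hom(1)[OF \<psi> \<phi>'] hom(2)[OF \<psi> \<phi>] ..
      moreover have "norm (S ?\<psi> ?\<phi>) = inverse (A * D) * (inverse (B * D) * norm (S \<psi> \<phi>))"
      proof -
        have "0 < A * D" "0 < B * D" using A B D by simp_all
        note pos = this[THEN positive_imp_inverse_positive]
        show ?thesis
          by (simp only: S_eq norm_mult norm_of_real abs_of_pos[OF pos(1)] abs_of_pos[OF pos(2)])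
      qed
      ultimately have "inverse (A * D) * (inverse (B * D) * norm (S \<psi> \<phi>)) \<le> C * measure lborel (ball a r) powr (1 - \<nu> / ?n)"
        by (simp only:)
      then have "norm (S \<psi> \<phi>) \<le> (A * D) * (B * D) * (C * measure lborel (ball a r) powr (1 - \<nu> / ?n))"
        using A B D by (simp add: field_simps)
      then show ?thesis unfolding v1 C'_def by (simp add: mult_ac)
    qed
    moreover have "C' \<ge> 0" using C D by (simp add: C'_def)
    ultimately show ?thesis by blast
  qed
  then show ?thesis by blast
qed

text \<open>A function vanishing on the ball of radius 4 \<rho> t about a has support disjoint from
  that of the dilate, so the pairing is a kernel integral.\<close>

lemma narrow_oper_pairing_bound:
  fixes S :: "('n::finite) oper" and G :: "real ^ 'n \<Rightarrow> complex"
  assumes S: "narrow_oper P \<nu> M \<gamma> S" and "M \<le> P" "0 \<le> \<gamma>" and G: "G \<in> test_fns0 P"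
    and \<rho>: "0 < \<rho>" "\<forall>x. \<rho> < norm x \<longrightarrow> G x = 0"
  shows "\<exists>C\<ge>0. \<forall>a t \<phi> W. 0 < t \<and> \<phi> \<in> test_fns \<and> (\<forall>v. norm (v - a) < 4 * \<rho> * t \<longrightarrow> \<phi> v = 0) \<and>
      integrable lborel W \<and> (\<forall>v. norm (\<phi> v) * norm (v - a) powr - (real CARD('n) + \<nu> + real M + \<gamma>) \<le> W v) \<longrightarrow>
    norm (S (dil G t a) \<phi>) \<le> C * t powr (real CARD('n) + (real M + \<gamma>)) * (LINT v|lborel. W v)"
proof -
  obtain K where K: "taylor_kernel M (real M + \<gamma>) (real CARD('n) + \<nu> + real M + \<gamma>) K"
    and SK: "\<And>\<psi> \<phi>. \<psi> \<in> test_fns0 P \<Longrightarrow> \<phi> \<in> test_fns \<Longrightarrow> supp \<psi> \<inter> supp \<phi> = {} \<Longrightarrow>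
        S \<psi> \<phi> = (LINT (u, v)|lborel. K u v * \<psi> u * \<phi> v)"
    using narrow_oper_kernel[OF S] by blast
  have eq: "S (dil G t a) \<phi> = (LINT (u, v)|lborel. K u v * dil G t a u * \<phi> v)"
    if t: "0 < t" and \<phi>: "\<phi> \<in> test_fns" and z: "\<forall>v. norm (v - a) < 4 * \<rho> * t \<longrightarrow> \<phi> v = 0" for a t \<phi>
  proof (rule SK[OF dil_test_fns0[OF G t] \<phi>])
    have "supp (dil G t a) \<subseteq> cball a (\<rho> * t)"
    proof (rule supp_subset_closed)
      fix u assume "dil G t a u \<noteq> 0"
      then have "\<not> \<rho> * t < norm (u - a)" using dil_eq_0[OF \<rho>(2) t] by blast
      then show "u \<in> cball a (\<rho> * t)" by (simp add: dist_norm norm_minus_commute)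
    qed simp
    moreover have "supp \<phi> \<subseteq> {v. 4 * \<rho> * t \<le> norm (v - a)}"
    proof (rule supp_subset_closed)
      show "closed {v. 4 * \<rho> * t \<le> norm (v - a)}" by (intro closed_Collect_le continuous_intros)
      show "v \<in> {v. 4 * \<rho> * t \<le> norm (v - a)}" if "\<phi> v \<noteq> 0" for v
        using z that by (meson mem_Collect_eq not_less)
    qed
    moreover have "cball a (\<rho> * t) \<inter> {v. 4 * \<rho> * t \<le> norm (v - a)} = {}"
    proof -
      have "0 < \<rho> * t" using \<rho> t by simp
      then show ?thesis by (auto simp: dist_norm norm_minus_commute)
    qed
    ultimately show "supp (dil G t a) \<inter> supp \<phi> = {}" by blast
  qed
  have "0 \<le> real M + \<gamma>" using assms(3) by simp
  from kernel_pairing_bound[OF K test_fns0_mono[OF G assms(2)] \<rho> this]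
  obtain C where C: "C \<ge> 0" "\<forall>a t \<phi> W. 0 < t \<and> \<phi> \<in> test_fns \<and> (\<forall>v. norm (v - a) < 4 * \<rho> * t \<longrightarrow> \<phi> v = 0) \<and>
      integrable lborel W \<and> (\<forall>v. norm (\<phi> v) * norm (v - a) powr - (real CARD('n) + \<nu> + real M + \<gamma>) \<le> W v) \<longrightarrow>
    norm (LINT (u, v)|lborel. K u v * dil G t a u * \<phi> v) \<le> C * t powr (real CARD('n) + (real M + \<gamma>)) * (LINT v|lborel. W v)"
    by (elim exE conjE) (rule that)
  show ?thesis
  proof (intro exI[of _ C] conjI allI impI C(1))
    fix a :: "real ^ 'n" and t \<phi> W
    assume h: "0 < t \<and> \<phi> \<in> test_fns \<and> (\<forall>v. norm (v - a) < 4 * \<rho> * t \<longrightarrow> \<phi> v = 0) \<and>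
      integrable lborel W \<and> (\<forall>v. norm (\<phi> v) * norm (v - a) powr - (real CARD('n) + \<nu> + real M + \<gamma>) \<le> W v)"
    then have "S (dil G t a) \<phi> = (LINT (u, v)|lborel. K u v * dil G t a u * \<phi> v)" using eq by blast
    then show "norm (S (dil G t a) \<phi>) \<le> C * t powr (real CARD('n) + (real M + \<gamma>)) * (LINT v|lborel. W v)"
      using C(2)[rule_format, OF h] by (simp only:)
  qed
qed

lemma norm_iter_pd_dil_le:
  assumes "smooth g" "0 < t" "\<And>x. norm (iter_pd is g x) \<le> B"
  shows "norm (iter_pd is (dil g t a) u) \<le> B * inverse t ^ length is"
  unfolding norm_iter_pd_dil[OF assms(1,2)] using assms
  by (simp add: dil_def mult.commute[of B] mult_left_mono)

text \<open>Near a the amplitude of H is A t^\<tau>, and weak boundedness gives A t^\<tau>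
  t^(n-\<nu>). The far part gives t^(n+M+\<gamma>) times a tail integral of size t^(-s), where s =
  \<nu>+M+\<gamma>-\<tau> is positive. The two exponents agree. Derivatives of H are needed only
  within \<kappa> t of a, which is what lets a distant cutoff go unnoticed.\<close>

lemma narrow_oper_near_bound:
  fixes S :: "('n::finite) oper" and G :: "real ^ 'n \<Rightarrow> complex"
  assumes S: "narrow_oper P \<nu> M \<gamma> S" and "M \<le> P" "0 \<le> \<gamma>" and G: "G \<in> test_fns0 P" and \<tau>: "\<tau> < \<nu> + real M + \<gamma>"
  shows "\<exists>C N \<kappa>. 0 \<le> C \<and> 1 \<le> \<kappa> \<and> (\<forall>a t A H. 0 < t \<and> 0 < A \<and> H \<in> test_fns \<and>
      (\<forall>u. t \<le> norm (u - a) \<longrightarrow> norm (H u) \<le> A * norm (u - a) powr \<tau>) \<and>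
      (\<forall>is u. length is \<le> N \<and> norm (u - a) \<le> \<kappa> * t \<longrightarrow> norm (iter_pd is H u) \<le> A * t powr (\<tau> - real (length is))) \<longrightarrow>
    norm (S (dil G t a) H) \<le> C * A * t powr (real CARD('n) - \<nu> + \<tau>))"
proof -
  let ?n = "real CARD('n)"
  define s where "s = \<nu> + real M + \<gamma> - \<tau>"
  have s: "s > 0" using \<tau> by (simp add: s_def)
  obtain \<rho> where \<rho>: "\<rho> \<ge> 1" "\<forall>x. \<rho> < norm x \<longrightarrow> G x = 0" using test_fns_radius[OF test_fns0_imp[OF G]] by blast
  obtain \<xi> :: "real ^ 'n \<Rightarrow> complex" where \<xi>: "\<xi> \<in> test_fns" "\<And>x. x \<in> ball 0 1 \<Longrightarrow> \<xi> x = 1" using exists_cutoff by blast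
  obtain q where q: "q \<ge> 1" "\<forall>x. q < norm x \<longrightarrow> \<xi> x = 0" using test_fns_radius[OF \<xi>(1)] by blast
  have \<rho>0: "0 < \<rho>" using \<rho>(1) by simp
  \<comment> \<open>The cutoff at scale 4 \<rho> t is 1 for |u-a| < 4 \<rho> t, beyond which the
    kernel bound is available, and 0 for |u-a| > q 4 \<rho> t.\<close>
  define \<kappa> where "\<kappa> = q * (4 * \<rho>)"
  have qr: "1 \<le> q * \<rho>" "\<rho> \<le> q * \<rho>" using q(1) \<rho>(1) mult_mono[of 1 q 1 \<rho>] mult_mono[of 1 q \<rho> \<rho>] by auto
  have \<kappa>: "\<kappa> \<ge> 1" "\<rho> \<le> \<kappa>" using qr by (auto simp: \<kappa>_def)
  have \<kappa>0: "0 < \<kappa>" using \<kappa>(1) by simp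
  obtain N C0 where C0: "C0 \<ge> 0" and wbp: "\<And>a t A B \<psi> \<phi>. \<psi> \<in> test_fns0 P \<Longrightarrow> \<phi> \<in> test_fns \<Longrightarrow> 0 < t \<Longrightarrow> 0 < A \<Longrightarrow> 0 < B \<Longrightarrow>
    adapted N \<kappa> t a A \<psi> \<Longrightarrow> adapted N \<kappa> t a B \<phi> \<Longrightarrow> norm (S \<psi> \<phi>) \<le> C0 * A * B * t powr (?n - \<nu>)"
    using narrow_oper_wbp[OF S] \<kappa>0 by metis
  obtain BG where BG: "BG > 0" "\<And>is x. length is \<le> N \<Longrightarrow> norm (iter_pd is G x) \<le> BG"
    using test_fns_derivs_bounded[OF test_fns0_imp[OF G], of N] by blast
  obtain B\<xi> where B\<xi>: "B\<xi> > 0" "\<And>is x. length is \<le> N \<Longrightarrow> norm (iter_pd is \<xi> x) \<le> B\<xi>"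
    using test_fns_derivs_bounded[OF \<xi>(1), of N] by blast
  obtain C1 where C1: "C1 \<ge> 0" and far: "\<And>a t \<phi> W. 0 < t \<Longrightarrow> \<phi> \<in> test_fns \<Longrightarrow> (\<And>v. norm (v - a) < 4 * \<rho> * t \<Longrightarrow> \<phi> v = 0) \<Longrightarrow>
      integrable lborel W \<Longrightarrow> (\<And>v. norm (\<phi> v) * norm (v - a) powr - (?n + \<nu> + real M + \<gamma>) \<le> W v) \<Longrightarrow>
    norm (S (dil G t a) \<phi>) \<le> C1 * t powr (?n + (real M + \<gamma>)) * (LINT v|lborel. W v)"
    using narrow_oper_pairing_bound[OF S assms(2,3) G \<rho>0 \<rho>(2)] by blast
  define J where "J = (LINT w|lborel. indicator {w :: real ^ 'n. 1 \<le> norm w} w * norm w powr - (?n + s))"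
  have J: "J \<ge> 0" unfolding J_def by (intro integral_nonneg_AE) auto
  define Ca where "Ca = C0 * BG * (2 ^ N * B\<xi>)"
  define Cb where "Cb = C1 * (1 + B\<xi>) * J * (4 * \<rho>) powr - s"
  have main: "norm (S (dil G t a) H) \<le> (Ca + Cb) * A * t powr (?n - \<nu> + \<tau>)"
    if t: "0 < t" and A: "0 < A" and H: "H \<in> test_fns"
      and b1: "\<And>u. t \<le> norm (u - a) \<Longrightarrow> norm (H u) \<le> A * norm (u - a) powr \<tau>"
      and b2: "\<And>is u. length is \<le> N \<Longrightarrow> norm (u - a) \<le> \<kappa> * t \<Longrightarrow> norm (iter_pd is H u) \<le> A * t powr (\<tau> - real (length is))"
    for a t A H
  proof -
    define X where "X = dil \<xi> (4 * \<rho> * t) a"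
    have rt: "0 < 4 * \<rho> * t" "t \<le> 4 * \<rho> * t" using \<rho>(1) t by auto
    have X: "X \<in> test_fns" unfolding X_def by (rule dil_test_fns[OF \<xi>(1) rt(1)])
    note sm = test_fns_smooth[OF X] test_fns_smooth[OF H]
    have X1: "X u = 1" if "norm (u - a) < 4 * \<rho> * t" for u
      
    proof -
      have "norm ((a - u) /\<^sub>R (4 * \<rho> * t)) = norm (u - a) / (4 * \<rho> * t)"
      proof -
        have "\<bar>inverse (4 * \<rho> * t)\<bar> = inverse (4 * \<rho> * t)"
          by (rule abs_of_pos[OF positive_imp_inverse_positive[OF rt(1)]])
        then show ?thesis unfolding norm_scaleR norm_minus_commute[of a u] divide_inverse by (simp only: mult.commute)
      qed
      also have "\<dots> < 1" using that rt by (simp add: divide_less_eq)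
      finally show ?thesis unfolding X_def dil_def by (intro \<xi>(2)) (simp only: mem_ball dist_0_norm)
    qed
    have X0: "X u = 0" if "\<kappa> * t < norm (u - a)" for u
      unfolding X_def by (rule dil_eq_0[OF q(2) rt(1)]) (use that in \<open>simp add: \<kappa>_def mult.assoc\<close>)
    have XB: "norm (X u) \<le> B\<xi>" for u using B\<xi>(2)[of "[]"] by (simp add: X_def dil_def)
    define \<phi>1 where "\<phi>1 x = X x * H x" for x
    define \<phi>2 where "\<phi>2 x = H x - \<phi>1 x" for x
    have \<phi>1: "\<phi>1 \<in> test_fns" unfolding \<phi>1_def[abs_def] by (rule test_fns_mult[OF H sm(1)])
    have \<phi>2: "\<phi>2 \<in> test_fns" unfolding \<phi>2_def[abs_def] by (rule test_fns_diff[OF H \<phi>1])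
    have d0: "dil G t a \<in> test_fns0 P" by (rule dil_test_fns0[OF G t])
    have "S (dil G t a) (\<lambda>x. \<phi>1 x + \<phi>2 x) = S (dil G t a) \<phi>1 + S (dil G t a) \<phi>2"
      by (rule narrow_oper_add[OF S d0 \<phi>1 \<phi>2])
    then have split: "S (dil G t a) H = S (dil G t a) \<phi>1 + S (dil G t a) \<phi>2" by (simp add: \<phi>2_def)
    have Bpos: "0 < 2 ^ N * B\<xi> * (A * t powr \<tau>)" using B\<xi> A t by simp
    have "norm (S (dil G t a) \<phi>1) \<le> C0 * BG * (2 ^ N * B\<xi> * (A * t powr \<tau>)) * t powr (?n - \<nu>)"
    proof (rule wbp[OF d0 \<phi>1 t BG(1) Bpos]; unfold adapted_def; intro conjI allI impI)
      fix u assume u: "\<kappa> * t < norm (u - a)"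
      have "\<rho> * t \<le> \<kappa> * t" using \<kappa>(2) t by simp
      then show "dil G t a u = 0" using u by (intro dil_eq_0[OF \<rho>(2) t]) auto
      show "\<phi>1 u = 0" using X0[OF u] by (simp add: \<phi>1_def)
    next
      fix "is" :: "'n list" and u assume l: "length is \<le> N"
      show "norm (iter_pd is (dil G t a) u) \<le> BG * inverse t ^ length is"
        by (rule norm_iter_pd_dil_le[OF test_fns_smooth[OF test_fns0_imp[OF G]] t BG(2)[OF l]])
      show "norm (iter_pd is \<phi>1 u) \<le> 2 ^ N * B\<xi> * (A * t powr \<tau>) * inverse t ^ length is"
      proof (cases "\<kappa> * t < norm (u - a)")
        case True
        have "iter_pd is \<phi>1 u = 0"
          by (rule iter_pd_eq_0_outside[OF _ True]) (use X0 in \<open>simp add: \<phi>1_def\<close>)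
        then show ?thesis using Bpos t by simp
      next
        case False
        have "norm (iter_pd is (\<lambda>x. X x * H x) u) \<le> 2 ^ length is * B\<xi> * (A * t powr \<tau>) * inverse t ^ length is"
        proof (rule iter_pd_mult_bound[OF sm])
          fix js :: "'n list" assume js: "length js \<le> length is"
          have "norm (iter_pd js X u) \<le> B\<xi> * inverse (4 * \<rho> * t) ^ length js"
            unfolding X_def by (rule norm_iter_pd_dil_le[OF test_fns_smooth[OF \<xi>(1)] rt(1) B\<xi>(2)]) (use js l in simp)
          also have "\<dots> \<le> B\<xi> * inverse t ^ length js"
            using rt t B\<xi> by (intro mult_left_mono power_mono le_imp_inverse_le) auto
          finally show "norm (iter_pd js X u) \<le> B\<xi> * inverse t ^ length js" .
          have "norm (iter_pd js H u) \<le> A * t powr (\<tau> - real (length js))"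
            by (rule b2) (use js l False in auto)
          also have "\<dots> = A * t powr \<tau> * inverse t ^ length js"
            using t by (simp add: powr_diff powr_realpow power_inverse divide_inverse)
          finally show "norm (iter_pd js H u) \<le> A * t powr \<tau> * inverse t ^ length js" .
        qed (use t in auto)
        also have "\<dots> \<le> 2 ^ N * B\<xi> * (A * t powr \<tau>) * inverse t ^ length is"
          using l B\<xi> A t by (intro mult_right_mono power_increasing) auto
        finally show ?thesis by (simp add: \<phi>1_def[abs_def])
      qed
    qed
    also have "\<dots> = Ca * A * t powr (?n - \<nu> + \<tau>)" using t by (simp add: Ca_def powr_add mult_ac)
    finally have 1: "norm (S (dil G t a) \<phi>1) \<le> Ca * A * t powr (?n - \<nu> + \<tau>)" .
    \<comment> \<open>The far part is at most (1 + B\<xi>) A |v-a|^\<tau>, and the kernel weight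
      lowers the exponent \<tau> to -(n+s).\<close>
    let ?I = "\<lambda>v. indicator {v. 4 * \<rho> * t \<le> norm (v - a)} v * norm (v - a) powr - (?n + s)"
    note tail = radial_tail_integral[OF s rt(1), of a, simplified]
    have iW: "integrable lborel (\<lambda>v. (1 + B\<xi>) * A * ?I v)"
      using tail(1) by (intro integrable_mult_right) simp
    have "norm (S (dil G t a) \<phi>2) \<le> C1 * t powr (?n + (real M + \<gamma>)) * (LINT v|lborel. (1 + B\<xi>) * A * ?I v)"
    proof (rule far[OF t \<phi>2 _ iW])
      show "\<phi>2 v = 0" if "norm (v - a) < 4 * \<rho> * t" for v using X1[OF that] by (simp add: \<phi>2_def \<phi>1_def)
      then have in_ball: "\<phi>2 v = 0" if "norm (v - a) < 4 * \<rho> * t" for v using that by blast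
      fix v
      show "norm (\<phi>2 v) * norm (v - a) powr - (?n + \<nu> + real M + \<gamma>) \<le> (1 + B\<xi>) * A * ?I v"
      proof (cases "4 * \<rho> * t \<le> norm (v - a)")
        case True
        have "norm (\<phi>2 v) = norm (1 - X v) * norm (H v)" by (simp add: \<phi>2_def \<phi>1_def left_diff_distrib flip: norm_mult)
        also have "\<dots> \<le> (1 + B\<xi>) * (A * norm (v - a) powr \<tau>)"
          using norm_triangle_ineq4[of 1 "X v"] XB[of v] b1[of v] True rt B\<xi> by (intro mult_mono) auto
        finally have "norm (\<phi>2 v) * norm (v - a) powr - (?n + \<nu> + real M + \<gamma>)
          \<le> (1 + B\<xi>) * (A * norm (v - a) powr \<tau>) * norm (v - a) powr - (?n + \<nu> + real M + \<gamma>)"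
          by (rule mult_right_mono) simp
        also have "\<dots> = (1 + B\<xi>) * A * norm (v - a) powr - (?n + s)"
          by (simp add: s_def powr_add[symmetric] mult.assoc algebra_simps)
        finally show ?thesis using True by simp
      qed (use in_ball in simp)
    qed
    also have "\<dots> = C1 * t powr (?n + (real M + \<gamma>)) * ((1 + B\<xi>) * A * (J * (4 * \<rho> * t) powr - s))"
      using tail(2) by (simp add: J_def)
    also have "\<dots> = Cb * A * (t powr (?n + (real M + \<gamma>)) * t powr - s)"
      using t \<rho>(1) by (simp add: Cb_def powr_mult mult_ac)
    also have "t powr (?n + (real M + \<gamma>)) * t powr - s = t powr (?n - \<nu> + \<tau>)"
      by (simp add: s_def powr_add[symmetric] add_diff_eq diff_add_eq)
    finally have 2: "norm (S (dil G t a) \<phi>2) \<le> Cb * A * t powr (?n - \<nu> + \<tau>)" .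
    show ?thesis unfolding split using norm_triangle_ineq[of "S (dil G t a) \<phi>1" "S (dil G t a) \<phi>2"] 1 2
      unfolding distrib_right by linarith
  qed
  show ?thesis
  proof (rule exI[of _ "Ca + Cb"], rule exI[of _ N], rule exI[of _ \<kappa>], intro conjI allI impI)
    show "0 \<le> Ca + Cb" using C0 C1 BG(1) B\<xi>(1) J by (simp add: Ca_def Cb_def)
    show "1 \<le> \<kappa>" by (rule \<kappa>(1))
    fix a :: "real ^ 'n" and t A H
    assume h: "0 < t \<and> 0 < A \<and> H \<in> test_fns \<and>
      (\<forall>u. t \<le> norm (u - a) \<longrightarrow> norm (H u) \<le> A * norm (u - a) powr \<tau>) \<and>
      (\<forall>is u. length is \<le> N \<and> norm (u - a) \<le> \<kappa> * t \<longrightarrow> norm (iter_pd is H u) \<le> A * t powr (\<tau> - real (length is)))"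
    show "norm (S (dil G t a) H) \<le> (Ca + Cb) * A * t powr (?n - \<nu> + \<tau>)"
      by (rule main) (use h in blast)+
  qed
qed

text \<open>The whole support of the wide function has distance at least |a-b|/2 from a, so the
  kernel weight can be replaced by a multiple of |a-b|^(-N). The power t^(n+M+\<gamma>) is the gain
  from the moments of G, and s^n is the volume of the support of F up to a constant.\<close>

lemma narrow_oper_far_bound:
  fixes S :: "('n::finite) oper" and G F :: "real ^ 'n \<Rightarrow> complex"
  assumes S: "narrow_oper P \<nu> M \<gamma> S" and "M \<le> P" "0 \<le> \<gamma>" and G: "G \<in> test_fns0 P" and F: "F \<in> test_fns"
    and N: "0 \<le> real CARD('n) + \<nu> + real M + \<gamma>"
  shows "\<exists>C A. 0 \<le> C \<and> 1 \<le> A \<and> (\<forall>a b t s. 0 < t \<and> t \<le> s \<and> A * s \<le> norm (a - b) \<longrightarrow>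
    norm (S (dil G t a) (dil F s b)) \<le> C * t powr (real CARD('n) + (real M + \<gamma>)) * s powr real CARD('n) *
      norm (a - b) powr - (real CARD('n) + \<nu> + real M + \<gamma>))"
proof -
  let ?n = "real CARD('n)"
  let ?N = "?n + \<nu> + real M + \<gamma>"
  obtain \<rho>1 where \<rho>1: "\<rho>1 \<ge> 1" "\<forall>x. \<rho>1 < norm x \<longrightarrow> G x = 0" using test_fns_radius[OF test_fns0_imp[OF G]] by blast
  obtain \<rho>2 where \<rho>2: "\<rho>2 \<ge> 1" "\<forall>x. \<rho>2 < norm x \<longrightarrow> F x = 0" using test_fns_radius[OF F] by blast
  define \<rho> where "\<rho> = max \<rho>1 \<rho>2"
  have \<rho>: "\<rho> \<ge> 1" "0 < \<rho>" "\<forall>x. \<rho> < norm x \<longrightarrow> G x = 0" "\<forall>x. \<rho> < norm x \<longrightarrow> F x = 0"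
    using \<rho>1 \<rho>2 by (auto simp: \<rho>_def)
  obtain BF where BF: "BF > 0" "\<And>x. norm (F x) \<le> BF" using test_fns_bounded[OF F] by blast
  obtain C where C: "C \<ge> 0" and far: "\<And>a t \<phi> W. 0 < t \<Longrightarrow> \<phi> \<in> test_fns \<Longrightarrow> (\<And>v. norm (v - a) < 4 * \<rho> * t \<Longrightarrow> \<phi> v = 0) \<Longrightarrow>
      integrable lborel W \<Longrightarrow> (\<And>v. norm (\<phi> v) * norm (v - a) powr - ?N \<le> W v) \<Longrightarrow>
    norm (S (dil G t a) \<phi>) \<le> C * t powr (?n + (real M + \<gamma>)) * (LINT v|lborel. W v)"
    using narrow_oper_pairing_bound[OF S assms(2,3) G \<rho>(2,3)] by blast
  define C' where "C' = C * (BF * 2 powr ?N * (unit_ball_vol ?n * \<rho> ^ CARD('n)))"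
  \<comment> \<open>With 8 \<rho> s \<le> |a-b| the support of the wide function keeps the distance
    |a-b|/2 \<ge> 4 \<rho> s \<ge> 4 \<rho> t from a, as the kernel bound requires.\<close>
  have "norm (S (dil G t a) (dil F s b)) \<le> C' * t powr (?n + (real M + \<gamma>)) * s powr ?n * norm (a - b) powr - ?N"
    if t: "0 < t" "t \<le> s" and ab: "8 * \<rho> * s \<le> norm (a - b)" for a b t s
  proof -
    have s: "0 < s" using t by simp
    have rs: "\<rho> * t \<le> \<rho> * s" "0 < \<rho> * s" using t \<rho>(2) by auto
    have ab': "8 * (\<rho> * s) \<le> norm (a - b)" using ab by (simp add: mult.assoc)
    let ?c = "BF * (norm (a - b) / 2) powr - ?N"
    let ?W = "\<lambda>v. indicator (cball b (\<rho> * s)) v *\<^sub>R ?c"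
    have out: "dil F s b v = 0" if "v \<notin> cball b (\<rho> * s)" for v
      by (rule dil_eq_0[OF \<rho>(4) s]) (use that in \<open>simp add: dist_norm norm_minus_commute not_le\<close>)
    have half: "(x / 2) powr - y = 2 powr y * x powr - y" for x y :: real
      unfolding powr_divide unfolding powr_minus divide_inverse inverse_inverse_eq by (rule mult.commute)
    have "norm (S (dil G t a) (dil F s b)) \<le> C * t powr (?n + (real M + \<gamma>)) * (LINT v|lborel. ?W v)"
    proof (rule far[OF t(1) dil_test_fns[OF F s]])
      have dist: "norm (a - b) / 2 \<le> norm (v - a)" if "v \<in> cball b (\<rho> * s)" for v
      proof -
        have "norm (v - b) \<le> \<rho> * s" using that by (simp add: dist_norm norm_minus_commute)
        moreover have "norm (a - b) \<le> norm (v - a) + norm (v - b)"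
          using norm_triangle_ineq4[of "v - b" "v - a"] by simp
        ultimately show ?thesis using ab' norm_ge_zero[of "a - b"] by linarith
      qed
      show "dil F s b v = 0" if "norm (v - a) < 4 * \<rho> * t" for v
      proof (rule out)
        have "norm (v - a) < 4 * (\<rho> * t)" using that by (simp add: mult.assoc)
        then show "v \<notin> cball b (\<rho> * s)" using dist[of v] ab' rs by linarith
      qed
      show "integrable lborel ?W" by (intro borel_integrable_compact compact_cball continuous_intros)
      fix v
      show "norm (dil F s b v) * norm (v - a) powr - ?N \<le> ?W v"
      proof (cases "v \<in> cball b (\<rho> * s)")
        case True
        have "norm (v - a) powr - ?N \<le> (norm (a - b) / 2) powr - ?N"
          using dist[OF True] ab rs N by (intro powr_mono2') auto
        moreover have "norm (dil F s b v) \<le> BF" by (simp add: dil_def BF)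
        ultimately have "norm (dil F s b v) * norm (v - a) powr - ?N \<le> ?c"
          using BF by (intro mult_mono) auto
        then show ?thesis using True by simp
      qed (use out in simp)
    qed
    also have "(LINT v|lborel. ?W v) = unit_ball_vol ?n * (\<rho> * s) ^ CARD('n) * ?c"
      using rs by (simp add: content_cball)
    also have "(norm (a - b) / 2) powr - ?N = 2 powr ?N * norm (a - b) powr - ?N"
      by (rule half)
    also have "C * t powr (?n + (real M + \<gamma>)) * (unit_ball_vol ?n * (\<rho> * s) ^ CARD('n) * (BF * (2 powr ?N * norm (a - b) powr - ?N)))
      = C' * t powr (?n + (real M + \<gamma>)) * s powr ?n * norm (a - b) powr - ?N"
      using s by (simp add: C'_def power_mult_distrib powr_realpow mult_ac)
    finally show ?thesis .
  qed
  moreover have "0 \<le> C'" using C BF \<rho> by (simp add: C'_def)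
  moreover have "1 \<le> 8 * \<rho>" using \<rho> by simp
  ultimately show ?thesis by blast
qed

text \<open>A wide function is bounded and, as t \<le> s, its derivatives satisfy the bounds of the
  smaller scale; the case \<tau> = 0 of the preceding estimates applies.\<close>

lemma narrow_oper_wide_bound:
  fixes S :: "('n::finite) oper" and G F :: "real ^ 'n \<Rightarrow> complex"
  assumes S: "narrow_oper P \<nu> M \<gamma> S" and "M \<le> P" "0 \<le> \<gamma>" and G: "G \<in> test_fns0 P" and F: "F \<in> test_fns"
    and N: "0 < \<nu> + real M + \<gamma>"
  shows "\<exists>C\<ge>0. \<forall>a b t s. 0 < t \<and> t \<le> s \<longrightarrow>
    norm (S (dil G t a) (dil F s b)) \<le> C * t powr (real CARD('n) - \<nu>)"
proof -
  obtain C N \<kappa> where C: "0 \<le> C" and near: "\<And>a t A H. 0 < t \<Longrightarrow> 0 < A \<Longrightarrow> H \<in> test_fns \<Longrightarrow>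
      (\<And>u. t \<le> norm (u - a) \<Longrightarrow> norm (H u) \<le> A * norm (u - a) powr 0) \<Longrightarrow>
      (\<And>is u. length is \<le> N \<Longrightarrow> norm (u - a) \<le> \<kappa> * t \<Longrightarrow> norm (iter_pd is H u) \<le> A * t powr (0 - real (length is))) \<Longrightarrow>
    norm (S (dil G t a) H) \<le> C * A * t powr (real CARD('n) - \<nu> + 0)"
    using narrow_oper_near_bound[OF S assms(2,3) G N] by metis
  obtain B where B: "B > 0" "\<And>is x. length is \<le> N \<Longrightarrow> norm (iter_pd is F x) \<le> B"
    using test_fns_derivs_bounded[OF F, of N] by blast
  have "norm (S (dil G t a) (dil F s b)) \<le> C * B * t powr (real CARD('n) - \<nu>)" if t: "0 < t" "t \<le> s" for a b t s
  proof -
    have s: "0 < s" using t by simp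
    have "norm (S (dil G t a) (dil F s b)) \<le> C * B * t powr (real CARD('n) - \<nu> + 0)"
    proof (rule near[OF t(1) B(1) dil_test_fns[OF F s]])
      fix u assume "t \<le> norm (u - a)"
      \<comment> \<open>Needs u \<noteq> a, since 0 powr 0 is 0.\<close>
      then have "norm (u - a) powr 0 = 1" using t by auto
      then show "norm (dil F s b u) \<le> B * norm (u - a) powr 0" using B(2)[of "[]"] by (simp add: dil_def)
    next
      fix "is" :: "'n list" and u assume l: "length is \<le> N"
      have "norm (iter_pd is (dil F s b) u) \<le> B * inverse s ^ length is"
        by (rule norm_iter_pd_dil_le[OF test_fns_smooth[OF F] s B(2)[OF l]])
      also have "\<dots> \<le> B * inverse t ^ length is"
        using t B by (intro mult_left_mono power_mono le_imp_inverse_le) auto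
      also have "\<dots> = B * t powr (0 - real (length is))" using t by (simp add: powr_minus powr_realpow power_inverse)
      finally show "norm (iter_pd is (dil F s b) u) \<le> B * t powr (0 - real (length is))" .
    qed
    then show ?thesis by simp
  qed
  then show ?thesis using C B by (intro exI[of _ "C * B"]) auto
qed

text \<open>For |u-a| \<ge> s the power of degree L of |u-a|/s dominates all lower ones.\<close>

lemma norm_taylor_le:
  fixes f :: "real ^ 'n::finite \<Rightarrow> complex"
  assumes "\<And>is. length is \<le> L \<Longrightarrow> norm (iter_pd is f a) \<le> B * inverse s ^ length is"
    and s: "0 < s" and u: "s \<le> norm (u - a)" and B: "0 \<le> B"
  shows "norm (taylor L f a u) \<le> real (Suc L) * real CARD('n) ^ L * B * (norm (u - a) / s) ^ L"
proof -
  let ?n = "real CARD('n)"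
  have n: "1 \<le> ?n" by (simp add: Suc_le_eq)
  have x: "1 \<le> norm (u - a) / s" using s u by simp
  have "norm (taylor L f a u) \<le> (\<Sum>m\<le>L. ?n ^ L * B * (norm (u - a) / s) ^ L)"
    unfolding taylor_def
  proof (rule sum_norm_le)
    fix m assume "m \<in> {..L}"
    then have m: "m \<le> L" by simp
    let ?T = "tay_hom m (\<lambda>is. iter_pd is f a) (u - a)"
    have "norm ((1 / fact m) *\<^sub>R ?T) \<le> norm ?T"
      using mult_left_mono[OF fact_ge_1[of m, where 'a = real], of "norm ?T"] by (simp add: divide_le_eq)
    also have "\<dots> \<le> (?n * norm (u - a)) ^ m * (B * inverse s ^ m)"
      by (rule tay_hom_bound) (use assms(1) m in auto)
    also have "\<dots> = ?n ^ m * B * (norm (u - a) / s) ^ m"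
      by (simp add: power_mult_distrib divide_inverse mult_ac)
    also have "\<dots> \<le> ?n ^ L * B * (norm (u - a) / s) ^ L"
      using m n x B by (intro mult_mono power_increasing mult_nonneg_nonneg) auto
    finally show "norm ((1 / fact m) *\<^sub>R ?T) \<le> ?n ^ L * B * (norm (u - a) / s) ^ L" .
  qed
  then show ?thesis by (simp add: mult_ac)
qed

text \<open>Derivatives commute with forming Taylor polynomials up to a shift of the degree, so this
  is the remainder bound for the derivative in degree L - length.\<close>

lemma iter_pd_taylor_remainder_bound:
  fixes f :: "real ^ 'n::finite \<Rightarrow> complex"
  assumes f: "smooth f" and l: "length is \<le> L"
    and B: "\<And>js u. length js = Suc L \<Longrightarrow> norm (iter_pd js f u) \<le> B"
  shows "norm (iter_pd is (\<lambda>x. f x - taylor L f a x) u) \<le> (real CARD('n) * norm (u - a)) ^ (Suc L - length is) * B"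
proof -
  have "iter_pd is (\<lambda>x. f x - taylor L f a x) u = iter_pd is f u - taylor (L - length is) (iter_pd is f) a u"
    by (simp add: iter_pd_diff[OF f smooth_taylor[OF f]] iter_pd_taylor[OF f l])
  also have "norm \<dots> \<le> (real CARD('n) * norm (u - a)) ^ Suc (L - length is) * B"
    by (rule smooth_taylor_bound[OF smooth_iter_pd[OF f]]) (use B l in \<open>simp add: iter_pd_append[symmetric]\<close>)
  finally show ?thesis using l by (simp add: Suc_diff_le)
qed

text \<open>The paired function is \<open>f\<close> minus its Taylor polynomial, the latter cut off at a radius \<open>R\<close>
  which tends to infinity; the hypothesis on \<open>S\<close> makes the polynomial disappear in the limit.\<close>

lemma narrow_oper_cancellation_bound:
  fixes S :: "('n::finite) oper" and G F \<eta> :: "real ^ 'n \<Rightarrow> complex"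
  assumes S: "narrow_oper P \<nu> M \<gamma> S" and MP: "M \<le> P" and \<gamma>: "0 \<le> \<gamma>" and G: "G \<in> test_fns0 P" and F: "F \<in> test_fns"
    and \<theta>: "0 \<le> \<theta>" "\<theta> \<le> 1" and \<tau>: "real L + \<theta> < \<nu> + real M + \<gamma>"
    and \<eta>: "\<eta> \<in> test_fns" "\<And>x. x \<in> ball 0 1 \<Longrightarrow> \<eta> x = 1"
    and canc: "\<And>p \<psi>. poly_deg L p \<Longrightarrow> \<psi> \<in> test_fns0 P \<Longrightarrow> ((\<lambda>R::real. S \<psi> (\<lambda>x. p x * \<eta> (x /\<^sub>R R))) \<longlongrightarrow> 0) at_top"
  shows "\<exists>C\<ge>0. \<forall>a b t s. 0 < t \<and> t \<le> s \<longrightarrow>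
    norm (S (dil G t a) (dil F s b)) \<le> C * t powr (real CARD('n) - \<nu>) * (t / s) powr (real L + \<theta>)"
proof -
  let ?n = "real CARD('n)" and ?\<tau> = "real L + \<theta>"
  have n: "1 \<le> ?n" by (simp add: Suc_le_eq)
  obtain C N \<kappa> where C: "0 \<le> C" and \<kappa>: "1 \<le> \<kappa>" and near: "\<And>a t A H. 0 < t \<Longrightarrow> 0 < A \<Longrightarrow> H \<in> test_fns \<Longrightarrow>
      (\<And>u. t \<le> norm (u - a) \<Longrightarrow> norm (H u) \<le> A * norm (u - a) powr ?\<tau>) \<Longrightarrow>
      (\<And>is u. length is \<le> N \<Longrightarrow> norm (u - a) \<le> \<kappa> * t \<Longrightarrow> norm (iter_pd is H u) \<le> A * t powr (?\<tau> - real (length is))) \<Longrightarrow>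
    norm (S (dil G t a) H) \<le> C * A * t powr (?n - \<nu> + ?\<tau>)"
    using narrow_oper_near_bound[OF S MP \<gamma> G \<tau>] by metis
  obtain B where B: "B > 0" "\<And>is x. length is \<le> max N (Suc L) \<Longrightarrow> norm (iter_pd is F x) \<le> B"
    using test_fns_derivs_bounded[OF F, of "max N (Suc L)"] by blast
  obtain B\<eta> where B\<eta>: "B\<eta> > 0" "\<And>x. norm (\<eta> x) \<le> B\<eta>" using test_fns_bounded[OF \<eta>(1)] by blast
  \<comment> \<open>E1 controls the remainder f - p for |u-a| < s and its derivatives for |u-a|
    \<le> \<kappa> t; E2 controls f and the cut-off polynomial for |u-a| \<ge> s.\<close>
  define E1 where "E1 = (?n * \<kappa>) ^ Suc L * B"
  define E2 where "E2 = B + real (Suc L) * ?n ^ L * B * B\<eta>"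
  define E where "E = E1 + E2"
  have n\<kappa>: "1 \<le> ?n * \<kappa>" using n \<kappa> mult_mono[of 1 ?n 1 \<kappa>] by simp
  have E1: "B \<le> E1" using B(1) n\<kappa> one_le_power[OF n\<kappa>, of "Suc L"] by (simp add: E1_def del: power_Suc)
  have E2: "0 \<le> E2" using B(1) B\<eta>(1) by (simp add: E2_def)
  have E: "0 < E" "E1 \<le> E" "E2 \<le> E" using E1 E2 B(1) by (auto simp: E_def)
  have "norm (S (dil G t a) (dil F s b)) \<le> C * E * t powr (?n - \<nu>) * (t / s) powr ?\<tau>"
    if t: "0 < t" and ts: "t \<le> s" for a b t s
  proof -
    have s: "0 < s" using t ts by simp
    define f where "f = dil F s b"
    have f: "f \<in> test_fns" unfolding f_def by (rule dil_test_fns[OF F s])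
    have sf: "smooth f" by (rule test_fns_smooth[OF f])
    have fB: "norm (iter_pd is f u) \<le> B * inverse s ^ length is" if "length is \<le> max N (Suc L)" for "is" u
      unfolding f_def by (rule norm_iter_pd_dil_le[OF test_fns_smooth[OF F] s B(2)[OF that]])
    define p where "p = taylor L f a"
    have p: "poly_deg L p" unfolding p_def by (rule poly_deg_taylor)
    have sp: "smooth p" by (rule poly_deg_smooth[OF p])
    \<comment> \<open>The remainder is measured against (|u-a|/s)^(L+\<theta>), which fixes the
      amplitude for the near bound.\<close>
    define A where "A = E * s powr - ?\<tau>"
    have A: "0 < A" using E s by (simp add: A_def)
    have rem: "norm (iter_pd is (\<lambda>x. f x - p x) u) \<le> (?n * norm (u - a)) ^ (Suc L - length is) * (B * inverse s ^ Suc L)"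
      if "length is \<le> L" for "is" u
      unfolding p_def by (rule iter_pd_taylor_remainder_bound[OF sf that]) (metis fB le_refl max.coboundedI2)
    define H where "H R x = f x - p x * \<eta> (x /\<^sub>R R)" for R x
    have d0: "dil G t a \<in> test_fns0 P" by (rule dil_test_fns0[OF G t])
    have p\<eta>: "(\<lambda>x. p x * \<eta> (x /\<^sub>R R)) \<in> test_fns" if "R > 0" for R
    proof -
      have "(\<lambda>x. \<eta> (inverse R *\<^sub>R x + 0)) \<in> test_fns" by (rule test_fns_scale[OF \<eta>(1)]) (use that in simp)
      from test_fns_mult[OF this sp] show ?thesis by simp
    qed
    \<comment> \<open>For R \<ge> R0 the cutoff is 1 on the ball of radius \<kappa> s + 1 about a,
      which covers |u-a| < s as well as |u-a| \<le> \<kappa> t; there H R is the plain Taylor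
      remainder.\<close>
    define R0 where "R0 = norm a + \<kappa> * s + 1"
    have \<kappa>s: "s \<le> \<kappa> * s" "\<kappa> * t \<le> \<kappa> * s" using \<kappa> s ts by auto
    have R0: "R0 > 0" using \<kappa>s s by (simp add: R0_def add_nonneg_pos add_pos_pos)
    have cut: "\<eta> (x /\<^sub>R R) = 1" if "R \<ge> R0" "norm (x - a) < \<kappa> * s + 1" for x R
    proof (rule \<eta>(2))
      have "norm x \<le> norm (x - a) + norm a" using norm_triangle_ineq[of "x - a" a] by simp
      then have "norm x < R" using that by (simp add: R0_def)
      moreover have "R > 0" using R0 that by simp
      ultimately show "x /\<^sub>R R \<in> ball 0 1" by (simp add: inverse_eq_divide divide_less_eq)
    qed
    have bound: "norm (S (dil G t a) (H R)) \<le> C * A * t powr (?n - \<nu> + ?\<tau>)" if R: "R \<ge> R0" for R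
    proof (rule near[OF t A])
      show "H R \<in> test_fns" unfolding H_def[abs_def] using R R0 by (intro test_fns_diff f p\<eta>) simp
    next
      fix u assume u: "t \<le> norm (u - a)"
      define x where "x = norm (u - a) / s"
      have x: "0 < x" unfolding x_def by (rule divide_pos_pos[OF less_le_trans[OF t u] s])
      have Ax: "A * norm (u - a) powr ?\<tau> = E * x powr ?\<tau>"
        unfolding A_def x_def powr_divide powr_minus unfolding divide_inverse by (simp only: mult_ac)
      have "norm (H R u) \<le> E * x powr ?\<tau>"
      \<comment> \<open>Below s the remainder has order L+1 \<ge> L+\<theta> in x < 1; beyond s the
        function and its polynomial are bounded separately by powers of x \<ge> 1.\<close>
      proof (cases "norm (u - a) < s")
        case True
        then have "\<eta> (u /\<^sub>R R) = 1" using \<kappa>s by (intro cut[OF R]) simp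
        then have "norm (H R u) \<le> (?n * norm (u - a)) ^ Suc L * (B * inverse s ^ Suc L)"
          using rem[of "[]" u] by (simp add: H_def)
        also have "\<dots> = ?n ^ Suc L * B * x ^ Suc L"
          by (simp add: x_def power_mult_distrib divide_inverse mult_ac)
        also have "\<dots> \<le> E1 * x powr ?\<tau>"
        proof (intro mult_mono)
          show "?n ^ Suc L * B \<le> E1" unfolding E1_def
            using n \<kappa> B(1) by (intro mult_right_mono power_mono) (auto simp: mult_le_cancel_left1)
          have "x ^ Suc L = x powr real (Suc L)" using x powr_realpow by metis
          also have "\<dots> \<le> x powr ?\<tau>"
            using x True s \<theta> by (intro powr_mono') (auto simp: x_def)
          finally show "x ^ Suc L \<le> x powr ?\<tau>" .
        qed (use E1 B(1) x in auto)
        also have "\<dots> \<le> E * x powr ?\<tau>" using E by (intro mult_right_mono) auto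
        finally show ?thesis .
      next
        case False
        then have x1: "1 \<le> x" using s by (simp add: x_def)
        have xL: "x ^ L \<le> x powr ?\<tau>" "1 \<le> x powr ?\<tau>"
        proof -
          have "x ^ L = x powr real L" using x powr_realpow by metis
          then show "x ^ L \<le> x powr ?\<tau>" using x1 \<theta> by (simp add: powr_mono)
          show "1 \<le> x powr ?\<tau>" using x1 \<theta> by (simp add: ge_one_powr_ge_zero)
        qed
        have "norm (H R u) \<le> norm (f u) + norm (p u) * norm (\<eta> (u /\<^sub>R R))"
          unfolding H_def using norm_triangle_ineq4 by (metis norm_mult)
        also have "\<dots> \<le> B * x powr ?\<tau> + (real (Suc L) * ?n ^ L * B * x powr ?\<tau>) * B\<eta>"
        proof (intro add_mono mult_mono)
          have "norm (f u) \<le> B" using fB[of "[]"] by simp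
          then show "norm (f u) \<le> B * x powr ?\<tau>" using xL(2) B(1) mult_left_mono[of 1 "x powr ?\<tau>" B] by linarith
          have "norm (p u) \<le> real (Suc L) * ?n ^ L * B * (norm (u - a) / s) ^ L"
            unfolding p_def by (rule norm_taylor_le) (use fB s False B in auto)
          also have "\<dots> \<le> real (Suc L) * ?n ^ L * B * x powr ?\<tau>"
            using xL(1) B(1) unfolding x_def by (intro mult_left_mono) auto
          finally show "norm (p u) \<le> real (Suc L) * ?n ^ L * B * x powr ?\<tau>" .
        qed (use B\<eta> B in auto)
        also have "\<dots> = E2 * x powr ?\<tau>" by (simp add: E2_def algebra_simps)
        also have "\<dots> \<le> E * x powr ?\<tau>" using E by (intro mult_right_mono) auto
        finally show ?thesis .
      qed
      then show "norm (H R u) \<le> A * norm (u - a) powr ?\<tau>" by (simp only: Ax)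
    next
      fix "is" :: "'n list" and u assume l: "length is \<le> N" and u: "norm (u - a) \<le> \<kappa> * t"
      have op: "open {x. norm (x - a) < \<kappa> * s + 1}" by (intro open_Collect_less continuous_intros)
      have "iter_pd is (H R) u = iter_pd is (\<lambda>x. f x - p x) u"
        by (rule iter_pd_cong_open[OF op]) (use u \<kappa>s cut[OF R] in \<open>auto simp: H_def\<close>)
      also have "norm \<dots> \<le> E1 * (s powr - ?\<tau> * t powr (?\<tau> - real (length is)))"
      proof (cases "length is \<le> L")
        case True
        define m where "m = length is"
        have mL: "m \<le> L" using True by (simp add: m_def)
        have "norm (iter_pd is (\<lambda>x. f x - p x) u) \<le> (?n * norm (u - a)) ^ (Suc L - m) * (B * inverse s ^ Suc L)"
          using rem[OF True] by (simp add: m_def)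
        also have "\<dots> \<le> (?n * (\<kappa> * t)) ^ (Suc L - m) * (B * inverse s ^ Suc L)"
          using u B(1) s by (intro mult_right_mono power_mono mult_left_mono) auto
        also have "\<dots> = (?n * \<kappa>) ^ (Suc L - m) * B * (t ^ (Suc L - m) * inverse s ^ Suc L)"
          by (simp add: power_mult_distrib mult_ac)
        also have "\<dots> \<le> E1 * (s powr - ?\<tau> * t powr (?\<tau> - real m))"
        proof (rule mult_mono)
          show "(?n * \<kappa>) ^ (Suc L - m) * B \<le> E1"
            unfolding E1_def using B(1) n\<kappa> by (intro mult_right_mono power_increasing) auto
          have "t ^ (Suc L - m) * inverse s ^ Suc L = t powr (real (Suc L) - real m) * s powr - real (Suc L)"
            using t s mL powr_realpow[OF t, of "Suc L - m"] powr_realpow[OF s, of "Suc L"]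
            by (simp add: powr_minus power_inverse of_nat_diff del: of_nat_Suc power_Suc)
          \<comment> \<open>The surplus of L+1 over L+\<theta> is a factor (t/s)^(1-\<theta>), at
            most 1.\<close>
          also have "\<dots> = (s powr - ?\<tau> * t powr (?\<tau> - real m)) * (t powr (1 - \<theta>) * s powr - (1 - \<theta>))"
            by (simp add: powr_add[symmetric] mult_ac) (simp add: powr_add[symmetric] mult.assoc[symmetric] algebra_simps)
          also have "\<dots> \<le> (s powr - ?\<tau> * t powr (?\<tau> - real m)) * 1"
          proof (intro mult_left_mono)
            have "t powr (1 - \<theta>) \<le> s powr (1 - \<theta>)" using t ts \<theta> by (intro powr_mono2) auto
            then show "t powr (1 - \<theta>) * s powr - (1 - \<theta>) \<le> 1"
              using s by (simp only: powr_minus divide_inverse[symmetric]) (simp add: divide_le_eq)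
          qed simp
          finally show "t ^ (Suc L - m) * inverse s ^ Suc L \<le> s powr - ?\<tau> * t powr (?\<tau> - real m)" by simp
        qed (use E1 B(1) t s in auto)
        finally show ?thesis by (simp add: m_def)
      next
        case False
        define m where "m = length is"
        have mL: "Suc L \<le> m" using False by (simp add: m_def)
        \<comment> \<open>More than L derivatives remove the polynomial. What is left has size
          s^(-m), and m \<ge> L+1 \<ge> L+\<theta> allows part of it to be traded for a power of
          t.\<close>
        have "iter_pd is (\<lambda>x. f x - p x) u = iter_pd is f u"
          using False by (simp add: p_def iter_pd_diff[OF sf smooth_taylor[OF sf]] iter_pd_taylor_0[OF sf])
        then have "norm (iter_pd is (\<lambda>x. f x - p x) u) \<le> B * inverse s ^ m"
          using fB[of "is" u] l by (simp add: m_def)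
        also have "inverse s ^ m = s powr - ?\<tau> * s powr - (real m - ?\<tau>)"
          using s by (simp add: powr_add[symmetric] powr_minus powr_realpow power_inverse)
        also have "s powr - (real m - ?\<tau>) \<le> t powr - (real m - ?\<tau>)"
          using t ts mL \<theta> by (intro powr_mono2') auto
        finally have "norm (iter_pd is (\<lambda>x. f x - p x) u) \<le> B * (s powr - ?\<tau> * t powr - (real m - ?\<tau>))"
          using B(1) by (simp add: mult_left_mono)
        also have "\<dots> \<le> E1 * (s powr - ?\<tau> * t powr - (real m - ?\<tau>))"
          using E1 by (intro mult_right_mono) auto
        finally show ?thesis by (simp add: m_def)
      qed
      also have "\<dots> \<le> E * (s powr - ?\<tau> * t powr (?\<tau> - real (length is)))"
        using E by (intro mult_right_mono) auto
      finally show "norm (iter_pd is (H R) u) \<le> A * t powr (?\<tau> - real (length is))"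
        by (simp add: A_def mult.assoc)
    qed
    \<comment> \<open>The bound for H R is uniform in R, while the contribution of the cut-off
      polynomial tends to 0; so f itself inherits the bound.\<close>
    have lim: "((\<lambda>R. norm (S (dil G t a) f - S (dil G t a) (\<lambda>x. p x * \<eta> (x /\<^sub>R R)))) \<longlongrightarrow> norm (S (dil G t a) f - 0)) at_top"
      by (intro tendsto_intros canc p d0)
    have ev: "eventually (\<lambda>R. norm (S (dil G t a) f - S (dil G t a) (\<lambda>x. p x * \<eta> (x /\<^sub>R R))) \<le> C * A * t powr (?n - \<nu> + ?\<tau>)) at_top"
      using eventually_ge_at_top[of R0]
    proof eventually_elim
      case (elim R)
      have "R > 0" using elim R0 by simp
      note p\<eta>R = p\<eta>[OF this]
      have HR: "H R \<in> test_fns" unfolding H_def[abs_def] by (intro test_fns_diff f p\<eta>R)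
      have "S (dil G t a) (\<lambda>x. H R x + p x * \<eta> (x /\<^sub>R R)) = S (dil G t a) (H R) + S (dil G t a) (\<lambda>x. p x * \<eta> (x /\<^sub>R R))"
        by (rule narrow_oper_add[OF S d0 HR p\<eta>R])
      then have "S (dil G t a) f - S (dil G t a) (\<lambda>x. p x * \<eta> (x /\<^sub>R R)) = S (dil G t a) (H R)" by (simp add: H_def)
      then show ?case using bound[OF elim] by simp
    qed
    have "norm (S (dil G t a) f - 0) \<le> C * A * t powr (?n - \<nu> + ?\<tau>)"
      by (rule tendsto_upperbound[OF lim ev]) simp
    also have "\<dots> = C * E * t powr (?n - \<nu>) * (t / s) powr ?\<tau>"
      unfolding powr_divide powr_add[of t "?n - \<nu>"] A_def powr_minus by (simp add: divide_inverse mult_ac)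
    finally show ?thesis by (simp add: f_def)
  qed
  then show ?thesis using C E(1) by (intro exI[of _ "C * E"]) auto
qed

section \<open>Convolution with tempered distributions\<close>

lemma vpow_bound: "\<bar>vpow x \<alpha>\<bar> \<le> norm x ^ mi_order \<alpha>"
proof -
  have "\<bar>vpow x \<alpha>\<bar> = (\<Prod>i\<in>UNIV. \<bar>x $ i\<bar> ^ \<alpha> i)" by (simp add: vpow_def abs_prod power_abs)
  also have "\<dots> \<le> (\<Prod>i\<in>UNIV. norm x ^ \<alpha> i)"
    by (intro prod_mono conjI power_mono component_le_norm_cart) auto
  also have "\<dots> = norm x ^ mi_order \<alpha>" by (simp add: mi_order_def power_sum)
  finally show ?thesis .
qed

text \<open>Beyond the radius r all derivatives vanish; within it the weight is at most a power of
  r. The maximum with 1 lets one exponent N serve for all lower orders.\<close>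

lemma vpow_deriv_bound:
  assumes "\<And>x. r < norm x \<Longrightarrow> f x = 0" "\<And>is x. length is \<le> N \<Longrightarrow> norm (iter_pd is f x) \<le> A"
    and "mi_order \<alpha> \<le> N" "mi_order \<beta> \<le> N"
  shows "norm (vpow x \<alpha> *\<^sub>R multi_deriv \<beta> f x) \<le> max 1 r ^ N * A"
proof -
  have "norm (iter_pd [] f 0) \<le> A" by (rule assms(2)) simp
  then have A: "0 \<le> A" by (rule order_trans[OF norm_ge_zero])
  show ?thesis
  proof (cases "r < norm x")
    case True
    have "multi_deriv \<beta> f x = 0" unfolding multi_deriv_conv_iter_pd
      by (rule iter_pd_eq_0_outside[where a = 0 and r = r]) (use assms(1) True in auto)
    then show ?thesis using A by simp
  next
    case False
    have "\<bar>vpow x \<alpha>\<bar> \<le> norm x ^ mi_order \<alpha>" by (rule vpow_bound)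
    also have "\<dots> \<le> max 1 r ^ mi_order \<alpha>" using False by (intro power_mono) auto
    also have "\<dots> \<le> max 1 r ^ N" by (intro power_increasing assms(3)) auto
    finally have "\<bar>vpow x \<alpha>\<bar> \<le> max 1 r ^ N" .
    moreover have "norm (multi_deriv \<beta> f x) \<le> A"
      unfolding multi_deriv_conv_iter_pd using assms(2,4) by (simp add: length_mi_list)
    ultimately show ?thesis unfolding norm_scaleR real_norm_def using A by (intro mult_mono) auto
  qed
qed

lemma test_fns_schwartz: "f \<in> test_fns \<Longrightarrow> f \<in> schwartz"
proof -
  assume f: "f \<in> test_fns"
  obtain r where r: "\<And>x. r < norm x \<Longrightarrow> f x = 0" using test_fns_radius[OF f] by blast
  have "bounded (range (\<lambda>x. vpow x \<alpha> *\<^sub>R multi_deriv \<beta> f x))" for \<alpha> \<beta>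
  proof -
    obtain B where "B > 0" and B: "\<And>is x. length is \<le> max (mi_order \<alpha>) (mi_order \<beta>) \<Longrightarrow> norm (iter_pd is f x) \<le> B"
      by (rule test_fns_derivs_bounded[OF f, of "max (mi_order \<alpha>) (mi_order \<beta>)"]) (rule that)
    have "norm (vpow x \<alpha> *\<^sub>R multi_deriv \<beta> f x) \<le> max 1 r ^ max (mi_order \<alpha>) (mi_order \<beta>) * B" for x
      by (rule vpow_deriv_bound) (use r B in auto)
    then show ?thesis unfolding bounded_iff by blast
  qed
  then show ?thesis using f test_fns_smooth unfolding schwartz_def by blast
qed

lemma test_fns0_schwartz0: "f \<in> test_fns0 P \<Longrightarrow> f \<in> schwartz0 P"
  unfolding test_fns0_def schwartz0_def using test_fns_schwartz by blast

text \<open>On functions supported in a fixed ball, sup norms of derivatives dominate the Schwartz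
  seminorm. The order N depends on u alone; only C depends on the radius.\<close>

lemma tempered_bound:
  fixes u :: "(real ^ 'n::finite \<Rightarrow> complex) \<Rightarrow> complex"
  assumes "tempered u"
  shows "\<exists>N. \<forall>r. \<exists>C\<ge>0. \<forall>f\<in>test_fns. \<forall>A. (\<forall>x. r < norm x \<longrightarrow> f x = 0) \<and>
    (\<forall>is x. length is \<le> N \<longrightarrow> norm (iter_pd is f x) \<le> A) \<longrightarrow> norm (u f) \<le> C * A"
proof -
  obtain N C where C: "\<And>f. f \<in> schwartz \<Longrightarrow> norm (u f) \<le> C * schwartz_seminorm N f"
    using assms unfolding tempered_def by blast
  let ?I = "{(\<alpha> :: 'n \<Rightarrow> nat, \<beta> :: 'n \<Rightarrow> nat). mi_order \<alpha> \<le> N \<and> mi_order \<beta> \<le> N}"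
  have "norm (u f) \<le> (\<bar>C\<bar> * (real (card ?I) * max 1 r ^ N)) * A"
    if f: "f \<in> test_fns" and z: "\<And>x. r < norm x \<Longrightarrow> f x = 0" and b: "\<And>is x. length is \<le> N \<Longrightarrow> norm (iter_pd is f x) \<le> A"
    for r f A
  proof -
    have s: "(SUP x. norm (vpow x \<alpha> *\<^sub>R multi_deriv \<beta> f x)) \<le> max 1 r ^ N * A"
      "0 \<le> (SUP x. norm (vpow x \<alpha> *\<^sub>R multi_deriv \<beta> f x))" if "mi_order \<alpha> \<le> N" "mi_order \<beta> \<le> N" for \<alpha> \<beta>
    proof -
      note bd = vpow_deriv_bound[of r f N A \<alpha> \<beta>, OF z b that]
      show "(SUP x. norm (vpow x \<alpha> *\<^sub>R multi_deriv \<beta> f x)) \<le> max 1 r ^ N * A"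
        by (rule cSUP_least) (use bd in auto)
      have "norm (vpow 0 \<alpha> *\<^sub>R multi_deriv \<beta> f 0) \<le> (SUP x. norm (vpow x \<alpha> *\<^sub>R multi_deriv \<beta> f x))"
        by (rule cSUP_upper) (use bd in \<open>auto intro!: bdd_aboveI2\<close>)
      then show "0 \<le> (SUP x. norm (vpow x \<alpha> *\<^sub>R multi_deriv \<beta> f x))" using norm_ge_zero order_trans by blast
    qed
    have "schwartz_seminorm N f \<le> of_nat (card ?I) * (max 1 r ^ N * A)"
      unfolding schwartz_seminorm_def by (rule sum_bounded_above) (use s in auto)
    moreover have "0 \<le> schwartz_seminorm N f"
      unfolding schwartz_seminorm_def by (rule sum_nonneg) (use s in auto)
    moreover have "norm (u f) \<le> C * schwartz_seminorm N f" by (rule C[OF test_fns_schwartz[OF f]])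
    ultimately have "norm (u f) \<le> \<bar>C\<bar> * (of_nat (card ?I) * (max 1 r ^ N * A))"
      by (smt (verit) mult_left_mono mult_right_mono)
    then show ?thesis by (simp add: mult_ac)
  qed
  note main = this
  show ?thesis
  proof (rule exI[of _ N], rule allI)
    fix r
    show "\<exists>C\<ge>0. \<forall>f\<in>test_fns. \<forall>A. (\<forall>x. r < norm x \<longrightarrow> f x = 0) \<and>
      (\<forall>is x. length is \<le> N \<longrightarrow> norm (iter_pd is f x) \<le> A) \<longrightarrow> norm (u f) \<le> C * A"
      by (rule exI[of _ "\<bar>C\<bar> * (real (card ?I) * max 1 r ^ N)"]) (use main[of _ r] in auto)
  qed
qed

lemma tempered_add: "tempered u \<Longrightarrow> f \<in> test_fns \<Longrightarrow> g \<in> test_fns \<Longrightarrow> u (\<lambda>x. f x + g x) = u f + u g"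
  and tempered_cmult: "tempered u \<Longrightarrow> f \<in> test_fns \<Longrightarrow> u (\<lambda>x. c * f x) = c * u f"
  using test_fns_schwartz unfolding tempered_def by blast+

lemma tempered_diff: "tempered u \<Longrightarrow> f \<in> test_fns \<Longrightarrow> g \<in> test_fns \<Longrightarrow> u (\<lambda>x. f x - g x) = u f - u g"
  using tempered_add[of u f "\<lambda>x. -1 * g x"] tempered_cmult[of u g "-1"] test_fns_cmult[of g "-1"] by simp

lemma test_fns_0: "(\<lambda>x. 0) \<in> test_fns"
  by (rule test_fnsI[where r = 0]) (auto simp: smooth_const)

lemma test_fns_sum: "(\<And>i. i \<in> I \<Longrightarrow> f i \<in> test_fns) \<Longrightarrow> (\<lambda>x. \<Sum>i\<in>I. f i x) \<in> test_fns"
  by (induction I rule: infinite_finite_induct) (auto intro: test_fns_add test_fns_0)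

lemma tempered_sum:
  assumes "tempered u" "\<And>i. i \<in> I \<Longrightarrow> f i \<in> test_fns"
  shows "u (\<lambda>x. \<Sum>i\<in>I. f i x) = (\<Sum>i\<in>I. u (f i))"
proof -
  have "u (\<lambda>x. 0) = 0" using tempered_cmult[OF assms(1) test_fns_0, of 0] by simp
  then show ?thesis using assms(2)
    by (induction I rule: infinite_finite_induct) (auto simp: tempered_add[OF assms(1)] test_fns_sum)
qed

text \<open>The convolution of a tempered distribution with a test function: the means to
  differentiate a pairing with respect to the position of its argument.\<close>

definition conv :: "((real ^ 'n::finite \<Rightarrow> complex) \<Rightarrow> complex) \<Rightarrow> (real ^ 'n \<Rightarrow> complex) \<Rightarrow> real ^ 'n \<Rightarrow> complex"
  where "conv u \<Psi> z = u (\<lambda>w. \<Psi> (z - w))"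

lemma test_fns_reflect: "\<Psi> \<in> test_fns \<Longrightarrow> (\<lambda>w. \<Psi> (z - w)) \<in> test_fns"
  using test_fns_scale[of \<Psi> "-1" z] by simp

text \<open>Taylor's formula of degree 1 is applied to each derivative of \<Psi>, so the error is
  quadratic in h for all derivatives that enter the continuity of a distribution.\<close>

lemma first_order_remainder_bound:
  fixes \<Psi> :: "real ^ 'n::finite \<Rightarrow> complex"
  assumes "smooth \<Psi>" and B: "\<And>is v. length is \<le> Suc (Suc N) \<Longrightarrow> norm (iter_pd is \<Psi> v) \<le> B" and l: "length is \<le> N"
  shows "norm (iter_pd is (\<lambda>v. \<Psi> (v + h) - \<Psi> v - (\<Sum>i\<in>UNIV. of_real (h $ i) * partial_deriv i \<Psi> v)) v)
    \<le> (real CARD('n) * norm h)\<^sup>2 * B"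
proof -
  let ?g = "iter_pd is \<Psi>"
  have sh: "smooth (\<lambda>v. \<Psi> (v + h))" using smooth_scale_comp[OF assms(1), of 1 h] by simp
  have sp: "smooth (\<lambda>v. of_real (h $ i) * partial_deriv i \<Psi> v)" for i
    by (intro smooth_cmult smooth_partial_deriv assms(1))
  have "iter_pd is (\<lambda>v. \<Psi> (v + h) - \<Psi> v - (\<Sum>i\<in>UNIV. of_real (h $ i) * partial_deriv i \<Psi> v)) v
    = iter_pd is (\<lambda>v. \<Psi> (v + h)) v - ?g v - (\<Sum>i\<in>UNIV. of_real (h $ i) * iter_pd is (partial_deriv i \<Psi>) v)"
    by (simp add: iter_pd_diff smooth_diff smooth_sum sh sp assms(1) iter_pd_sum iter_pd_cmult smooth_partial_deriv)
  also have "iter_pd is (\<lambda>v. \<Psi> (v + h)) v = ?g (v + h)"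
    using iter_pd_scale[OF assms(1), of "is" 1 h] by simp
  also have "(\<Sum>i\<in>UNIV. of_real (h $ i) * iter_pd is (partial_deriv i \<Psi>) v) = (\<Sum>i\<in>UNIV. h $ i *\<^sub>R partial_deriv i ?g v)"
  proof (rule sum.cong[OF refl])
    fix i
    have "iter_pd (is @ [i]) \<Psi> v = iter_pd (i # is) \<Psi> v" by (rule iter_pd_smooth_permute[OF assms(1)]) simp
    then show "of_real (h $ i) * iter_pd is (partial_deriv i \<Psi>) v = h $ i *\<^sub>R partial_deriv i ?g v"
      by (simp add: iter_pd_append scaleR_conv_of_real)
  qed
  also have "?g (v + h) - ?g v - (\<Sum>i\<in>UNIV. h $ i *\<^sub>R partial_deriv i ?g v) = ?g (v + h) - taylor 1 ?g v (v + h)"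
    by (simp add: taylor_def)
  also have "norm \<dots> \<le> (real CARD('n) * norm (v + h - v)) ^ Suc 1 * B"
    by (rule smooth_taylor_bound[OF smooth_iter_pd[OF assms(1)]])
      (use B l in \<open>simp add: iter_pd_append[symmetric]\<close>)
  finally show ?thesis by (simp add: power2_eq_square)
qed

text \<open>Continuity of u turns the quadratic remainder of the translated test function into a
  quadratic remainder of the convolution.\<close>

lemma conv_has_derivative:
  fixes \<Psi> :: "real ^ 'n::finite \<Rightarrow> complex"
  assumes u: "tempered u" and \<Psi>: "\<Psi> \<in> test_fns"
  shows "(conv u \<Psi> has_derivative (\<lambda>h. \<Sum>i\<in>UNIV. h $ i *\<^sub>R conv u (partial_deriv i \<Psi>) z)) (at z)"
proof -
  obtain N where "\<forall>r. \<exists>C\<ge>0. \<forall>f\<in>test_fns. \<forall>A. (\<forall>x. r < norm x \<longrightarrow> f x = 0) \<and>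
    (\<forall>is x. length is \<le> N \<longrightarrow> norm (iter_pd is f x) \<le> A) \<longrightarrow> norm (u f) \<le> C * A"
    using tempered_bound[OF u] by blast
  note bound = this[rule_format]
  obtain r where r: "r \<ge> 1" "\<And>x. r < norm x \<Longrightarrow> \<Psi> x = 0" using test_fns_radius[OF \<Psi>] by blast
  obtain B where B: "B > 0" "\<And>is x. length is \<le> Suc (Suc N) \<Longrightarrow> norm (iter_pd is \<Psi> x) \<le> B"
    using test_fns_derivs_bounded[OF \<Psi>, of "Suc (Suc N)"] by blast
  \<comment> \<open>For |h| \<le> 1 the remainder, as a function of w, vanishes outside the ball of
    radius |z| + r + 1, so one constant serves for all such h.\<close>
  obtain C where C: "C \<ge> 0" "\<And>f A. f \<in> test_fns \<Longrightarrow> (\<And>x. norm z + r + 1 < norm x \<Longrightarrow> f x = 0) \<Longrightarrow>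
    (\<And>is x. length is \<le> N \<Longrightarrow> norm (iter_pd is f x) \<le> A) \<Longrightarrow> norm (u f) \<le> C * A"
    using bound[of "norm z + r + 1"] by metis
  define D where "D h = (\<Sum>i\<in>UNIV. h $ i *\<^sub>R conv u (partial_deriv i \<Psi>) z)" for h
  have pt: "partial_deriv i \<Psi> \<in> test_fns" for i using test_fns_iter_pd[OF \<Psi>, of "[i]"] by simp
  have est: "norm (conv u \<Psi> (z + h) - conv u \<Psi> z - D h) \<le> C * ((real CARD('n) * norm h)\<^sup>2 * B)" if h: "norm h \<le> 1" for h
  proof -
    define \<rho> where "\<rho> v = \<Psi> (v + h) - \<Psi> v - (\<Sum>i\<in>UNIV. of_real (h $ i) * partial_deriv i \<Psi> v)" for v
    have th: "(\<lambda>v. \<Psi> (v + h)) \<in> test_fns" using test_fns_scale[OF \<Psi>, of 1 h] by simp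
    have \<rho>t: "\<rho> \<in> test_fns" unfolding \<rho>_def[abs_def]
      by (intro test_fns_diff test_fns_sum test_fns_cmult th \<Psi> pt)
    have "norm (u (\<lambda>w. \<rho> (z - w))) \<le> C * ((real CARD('n) * norm h)\<^sup>2 * B)"
    proof (rule C(2)[OF test_fns_reflect[OF \<rho>t]])
      fix w :: "real ^ 'n" assume w: "norm z + r + 1 < norm w"
      have "norm w \<le> norm (z - w) + norm z" using norm_triangle_ineq4[of "z" "z - w"] by simp
      then have a: "r + 1 < norm (z - w)" using w by simp
      have "norm (z - w) \<le> norm (z - w + h) + norm h" using norm_triangle_ineq4[of "z - w + h" h] by simp
      then have b: "r < norm (z - w + h)" using a h by simp
      have "partial_deriv i \<Psi> (z - w) = 0" for i
        using iter_pd_eq_0_outside[of r 0 \<Psi> "z - w" "[i]"] r(2) a by simp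
      then show "\<rho> (z - w) = 0" using r(2) a b by (simp add: \<rho>_def)
    next
      fix "is" :: "'n list" and w :: "real ^ 'n" assume l: "length is \<le> N"
      have "iter_pd is (\<lambda>w. \<rho> ((-1) *\<^sub>R w + z)) w = of_real ((-1) ^ length is) * iter_pd is \<rho> ((-1) *\<^sub>R w + z)"
        by (simp only: iter_pd_scale[OF test_fns_smooth[OF \<rho>t]])
      then have "norm (iter_pd is (\<lambda>w. \<rho> (z - w)) w) = norm (iter_pd is \<rho> (z - w))"
        by (simp add: norm_mult norm_power)
      also have "\<dots> \<le> (real CARD('n) * norm h)\<^sup>2 * B"
        unfolding \<rho>_def[abs_def] by (rule first_order_remainder_bound[OF test_fns_smooth[OF \<Psi>] B(2) l])
      finally show "norm (iter_pd is (\<lambda>w. \<rho> (z - w)) w) \<le> (real CARD('n) * norm h)\<^sup>2 * B" .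
    qed
    moreover have "u (\<lambda>w. \<rho> (z - w)) = conv u \<Psi> (z + h) - conv u \<Psi> z - D h"
    proof -
      have th': "(\<lambda>w. \<Psi> (z + h - w)) \<in> test_fns" "(\<lambda>w. \<Psi> (z - w)) \<in> test_fns"
        "\<And>i. (\<lambda>w. partial_deriv i \<Psi> (z - w)) \<in> test_fns"
        using test_fns_reflect \<Psi> pt by blast+
      have "(\<lambda>w. \<rho> (z - w)) = (\<lambda>w. (\<Psi> (z + h - w) - \<Psi> (z - w)) - (\<Sum>i\<in>UNIV. of_real (h $ i) * partial_deriv i \<Psi> (z - w)))"
        by (simp add: \<rho>_def algebra_simps)
      then show ?thesis
        by (simp add: tempered_diff[OF u] tempered_sum[OF u] tempered_cmult[OF u] test_fns_diff test_fns_sum test_fns_cmult th'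
            conv_def D_def scaleR_conv_of_real)
    qed
    ultimately show ?thesis by simp
  qed
  have bl: "bounded_linear D" unfolding D_def[abs_def]
    by (intro bounded_linear_sum bounded_linear_scaleR_left[THEN bounded_linear_compose] bounded_linear_vec_nth)
  show ?thesis unfolding D_def[symmetric]
  proof (rule has_derivativeI_sandwich[where e = 1])
    show "bounded_linear D" by (rule bl)
    let ?H = "\<lambda>y. C * (real CARD('n) ^ 2 * B) * norm (y - z)"
    have "((\<lambda>y. C * (real CARD('n) ^ 2 * B) * norm (y - z)) \<longlongrightarrow> C * (real CARD('n) ^ 2 * B) * norm (z - z)) (at z)"
      by (intro tendsto_intros)
    then show "(?H \<longlongrightarrow> 0) (at z)" by simp
    fix y assume y: "y \<noteq> z" "dist y z < 1"
    have "norm (conv u \<Psi> (z + (y - z)) - conv u \<Psi> z - D (y - z)) \<le> C * ((real CARD('n) * norm (y - z))\<^sup>2 * B)"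
      by (rule est) (use y in \<open>simp add: dist_norm\<close>)
    then show "norm (conv u \<Psi> y - conv u \<Psi> z - D (y - z)) / norm (y - z) \<le> ?H y"
      using y(1) by (simp add: divide_le_eq power_mult_distrib power2_eq_square mult_ac)
  qed simp
qed

lemma smooth_conv:
  fixes \<Psi> :: "real ^ 'n::finite \<Rightarrow> complex"
  assumes u: "tempered u" and \<Psi>: "\<Psi> \<in> test_fns"
  shows "smooth (conv u \<Psi>)"
proof (rule smooth_I[where F = "{conv u \<Psi> |\<Psi>. \<Psi> \<in> test_fns}"])
  fix f assume "f \<in> {conv u \<Psi> |\<Psi>. \<Psi> \<in> test_fns}"
  then obtain \<Phi> where \<Phi>: "f = conv u \<Phi>" "\<Phi> \<in> test_fns" by blast
  have "(\<lambda>z. \<Sum>i\<in>UNIV. b $ i *\<^sub>R conv u (partial_deriv i \<Phi>) z) \<in> {conv u \<Psi> |\<Psi>. \<Psi> \<in> test_fns}"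
    if bB: "b \<in> Basis" for b :: "real ^ 'n"
  proof -
    obtain j where b: "b = axis j 1" using bB unfolding Basis_vec_real by auto
    have "(\<lambda>z. \<Sum>i\<in>UNIV. b $ i *\<^sub>R conv u (partial_deriv i \<Phi>) z) = conv u (partial_deriv j \<Phi>)"
      unfolding b by (rule ext, rule sum_axis)
    moreover have "partial_deriv j \<Phi> \<in> test_fns" using test_fns_iter_pd[OF \<Phi>(2), of "[j]"] by simp
    ultimately show ?thesis by auto
  qed
  then show "\<exists>f'. \<forall>x. (f has_derivative f' x) (at x) \<and> (\<forall>b\<in>Basis. (\<lambda>x. f' x b) \<in> {conv u \<Psi> |\<Psi>. \<Psi> \<in> test_fns})"
    using conv_has_derivative[OF u \<Phi>(2)] \<Phi>(1)
    by (intro exI[of _ "\<lambda>z h. \<Sum>i\<in>UNIV. h $ i *\<^sub>R conv u (partial_deriv i \<Phi>) z"]) blast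
qed (use \<Psi> in blast)

section \<open>Tensor products, and pairings as convolutions on R^2n\<close>

text \<open>The pair (x, y) is stored as (y, x): in \<open>tensor g f\<close> the function tested
  against occupies the first factor, and y is its position.\<close>

definition pair_vec :: "(real ^ 'n::finite) \<times> (real ^ 'n) \<Rightarrow> real ^ ('n + 'n)"
  where "pair_vec p = (\<chi> k. case k of Inl i \<Rightarrow> snd p $ i | Inr i \<Rightarrow> fst p $ i)"

lemma pair_vec_nth [simp]: "pair_vec p $ Inl i = snd p $ i" "pair_vec p $ Inr i = fst p $ i"
  by (simp_all add: pair_vec_def)

lemma bounded_linear_pair_vec: "bounded_linear pair_vec"
proof -
  have "linear pair_vec"
    by (rule linearI) (auto simp: vec_eq_iff pair_vec_def split: sum.splits)
  then show ?thesis by (simp add: linear_conv_bounded_linear)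
qed

lemma bounded_linear_proj_vec:
  fixes r :: "'n::finite \<Rightarrow> 'm::finite"
  shows "bounded_linear (\<lambda>z :: real ^ 'm. (\<chi> i. z $ r i) :: real ^ 'n)"
proof -
  have "linear (\<lambda>z :: real ^ 'm. (\<chi> i. z $ r i) :: real ^ 'n)" by (rule linearI) (auto simp: vec_eq_iff)
  then show ?thesis by (simp add: linear_conv_bounded_linear)
qed

lemma smooth_proj_comp:
  fixes r :: "'n::finite \<Rightarrow> 'm::finite" and g :: "real ^ 'n \<Rightarrow> complex"
  assumes "smooth g"
  shows "smooth (\<lambda>z :: real ^ 'm. g (\<chi> i. z $ r i))"
  using smooth_affine_comp[OF assms bounded_linear_proj_vec[of r], of 0] by simp

lemma tensor_test_fns:
  fixes f g :: "real ^ 'n::finite \<Rightarrow> complex"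
  assumes f: "f \<in> test_fns" and g: "g \<in> test_fns"
  shows "tensor g f \<in> test_fns"
proof -
  obtain r1 where r1: "\<And>x. r1 < norm x \<Longrightarrow> f x = 0" using test_fns_radius[OF f] by blast
  obtain r2 where r2: "\<And>x. r2 < norm x \<Longrightarrow> g x = 0" using test_fns_radius[OF g] by blast
  show ?thesis
  proof (rule test_fnsI[where r = "real CARD('n) * r2 + real CARD('n) * r1"])
    show "smooth (tensor g f)" unfolding tensor_def[abs_def]
      by (intro smooth_mult smooth_proj_comp test_fns_smooth f g)
    fix z :: "real ^ ('n + 'n)"
    let ?l = "(\<chi> i. z $ Inl i) :: real ^ 'n" and ?r = "(\<chi> i. z $ Inr i) :: real ^ 'n"
    assume z: "real CARD('n) * r2 + real CARD('n) * r1 < norm z"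
    have "norm z \<le> (\<Sum>k\<in>UNIV. \<bar>z $ k\<bar>)" by (rule norm_le_l1_cart)
    also have "\<dots> = (\<Sum>i\<in>UNIV. \<bar>?l $ i\<bar>) + (\<Sum>i\<in>UNIV. \<bar>?r $ i\<bar>)"
      unfolding UNIV_Plus_UNIV[symmetric] by (subst sum.Plus) auto
    also have "\<dots> \<le> (\<Sum>i\<in>(UNIV::'n set). norm ?l) + (\<Sum>i\<in>(UNIV::'n set). norm ?r)"
      by (intro add_mono sum_mono component_le_norm_cart)
    finally have "norm z \<le> real CARD('n) * norm ?l + real CARD('n) * norm ?r" by simp
    then have "r2 < norm ?l \<or> r1 < norm ?r"
      using z by (smt (verit) mult_left_mono of_nat_0_le_iff)
    then show "tensor g f z = 0" using r1 r2 unfolding tensor_def by auto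
  qed
qed

lemma partial_deriv_tensor:
  fixes f g :: "real ^ 'n::finite \<Rightarrow> complex"
  assumes f: "smooth f" and g: "smooth g"
  shows "partial_deriv (Inl i) (tensor g f) = tensor (partial_deriv i g) f"
    and "partial_deriv (Inr i) (tensor g f) = tensor g (partial_deriv i f)"
proof -
  let ?l = "\<lambda>z :: real ^ ('n + 'n). (\<chi> i. z $ Inl i) :: real ^ 'n" and ?r = "\<lambda>z :: real ^ ('n + 'n). (\<chi> i. z $ Inr i) :: real ^ 'n"
  have dl: "((\<lambda>z. g (?l z)) has_derivative (\<lambda>h. frechet_derivative g (at (?l z)) (?l h))) (at z)" for z
    by (rule has_derivative_compose[OF bounded_linear_imp_has_derivative[OF bounded_linear_proj_vec] smooth_has_derivative[OF g]])
  have dr: "((\<lambda>z. f (?r z)) has_derivative (\<lambda>h. frechet_derivative f (at (?r z)) (?r h))) (at z)" for z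
    by (rule has_derivative_compose[OF bounded_linear_imp_has_derivative[OF bounded_linear_proj_vec] smooth_has_derivative[OF f]])
  have d: "(tensor g f has_derivative (\<lambda>h. g (?l z) * frechet_derivative f (at (?r z)) (?r h) + frechet_derivative g (at (?l z)) (?l h) * f (?r z))) (at z)" for z
    unfolding tensor_def[abs_def] by (rule has_derivative_mult[OF dl dr])
  have lin: "frechet_derivative g (at x) 0 = 0" "frechet_derivative f (at x) 0 = 0" for x
    using smooth_has_derivative[OF g] smooth_has_derivative[OF f] has_derivative_linear linear_0 by blast+
  have ax: "?l (axis (Inl i) 1) = axis i 1" "?r (axis (Inl i) 1) = 0" "?l (axis (Inr i) 1) = 0" "?r (axis (Inr i) 1) = axis i 1"
    by (auto simp: vec_eq_iff axis_def)
  show "partial_deriv (Inl i) (tensor g f) = tensor (partial_deriv i g) f"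
    by (rule ext, subst partial_deriv_eq[OF d]) (simp add: ax lin tensor_def partial_deriv_def)
  show "partial_deriv (Inr i) (tensor g f) = tensor g (partial_deriv i f)"
    by (rule ext, subst partial_deriv_eq[OF d]) (simp add: ax lin tensor_def partial_deriv_def)
qed

definition tensor_conv ::
    "((real ^ ('n::finite + 'n) \<Rightarrow> complex) \<Rightarrow> complex) \<Rightarrow> (real ^ 'n \<Rightarrow> complex) \<Rightarrow> (real ^ 'n \<Rightarrow> complex) \<Rightarrow>
      real ^ 'n \<Rightarrow> real ^ 'n \<Rightarrow> complex"
  where "tensor_conv \<K> f g x y = \<K> (tensor (\<lambda>v. g (y - v)) (\<lambda>u. f (x - u)))"

text \<open>Moving f and g separately amounts to one translation of their tensor product; joint
  smoothness in (x, y) thereby becomes smoothness of a convolution.\<close>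

lemma tensor_conv_eq_conv: "tensor_conv \<K> f g x y = conv \<K> (tensor g f) (pair_vec (x, y))"
proof -
  have "(\<chi> i. (pair_vec (x, y) - w) $ Inl i) = y - (\<chi> i. w $ Inl i)"
    "(\<chi> i. (pair_vec (x, y) - w) $ Inr i) = x - (\<chi> i. w $ Inr i)" for w
    by (simp_all add: vec_eq_iff)
  then have "tensor (\<lambda>v. g (y - v)) (\<lambda>u. f (x - u)) = (\<lambda>w. tensor g f (pair_vec (x, y) - w))"
    by (simp add: tensor_def fun_eq_iff)
  then show ?thesis by (simp add: tensor_conv_def conv_def)
qed

lemma smooth_tensor_conv:
  assumes "tempered \<K>" "f \<in> test_fns" "g \<in> test_fns"
  shows "smooth (\<lambda>(x, y). tensor_conv \<K> f g x y)"
  using smooth_affine_comp[OF smooth_conv[OF assms(1) tensor_test_fns[OF assms(2,3)]] bounded_linear_pair_vec, of 0]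
  by (simp add: tensor_conv_eq_conv case_prod_unfold)

lemma pair_vec_has_derivative:
  "((\<lambda>x. pair_vec (x, y)) has_derivative (\<lambda>h. pair_vec (h, 0))) (at x)"
  "((\<lambda>y. pair_vec (x, y)) has_derivative (\<lambda>h. pair_vec (0, h))) (at y)"
  using has_derivative_compose[OF has_derivative_Pair[OF has_derivative_ident has_derivative_const]
      bounded_linear_imp_has_derivative[OF bounded_linear_pair_vec]]
    has_derivative_compose[OF has_derivative_Pair[OF has_derivative_const has_derivative_ident]
      bounded_linear_imp_has_derivative[OF bounded_linear_pair_vec]] by blast+

lemma tensor_conv_has_derivative:
  fixes f g :: "real ^ 'n::finite \<Rightarrow> complex"
  assumes K: "tempered \<K>" and f: "f \<in> test_fns" and g: "g \<in> test_fns"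
  shows "((\<lambda>x. tensor_conv \<K> f g x y) has_derivative (\<lambda>h. \<Sum>i\<in>UNIV. h $ i *\<^sub>R tensor_conv \<K> (partial_deriv i f) g x y)) (at x)"
    and "((\<lambda>y. tensor_conv \<K> f g x y) has_derivative (\<lambda>h. \<Sum>i\<in>UNIV. h $ i *\<^sub>R tensor_conv \<K> f (partial_deriv i g) x y)) (at y)"
proof -
  note d = conv_has_derivative[OF K tensor_test_fns[OF f g]]
  note pt = partial_deriv_tensor[OF test_fns_smooth[OF f] test_fns_smooth[OF g]]
  have s: "(\<Sum>k\<in>UNIV. F k) = (\<Sum>i\<in>UNIV. F (Inl i)) + (\<Sum>i\<in>UNIV. F (Inr i))" for F :: "'n + 'n \<Rightarrow> complex"
    unfolding UNIV_Plus_UNIV[symmetric] by (subst sum.Plus) auto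
  show "((\<lambda>x. tensor_conv \<K> f g x y) has_derivative (\<lambda>h. \<Sum>i\<in>UNIV. h $ i *\<^sub>R tensor_conv \<K> (partial_deriv i f) g x y)) (at x)"
    using has_derivative_compose[OF pair_vec_has_derivative(1) d] by (simp add: tensor_conv_eq_conv s pt)
  show "((\<lambda>y. tensor_conv \<K> f g x y) has_derivative (\<lambda>h. \<Sum>i\<in>UNIV. h $ i *\<^sub>R tensor_conv \<K> f (partial_deriv i g) x y)) (at y)"
    using has_derivative_compose[OF pair_vec_has_derivative(2) d] by (simp add: tensor_conv_eq_conv s pt)
qed

lemma iter_pd_tensor_conv:
  assumes K: "tempered \<K>" and f: "f \<in> test_fns" and g: "g \<in> test_fns"
  shows "iter_pd is (\<lambda>x. tensor_conv \<K> f g x y) = (\<lambda>x. tensor_conv \<K> (iter_pd is f) g x y)"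
    and "iter_pd is (\<lambda>y. tensor_conv \<K> f g x y) = (\<lambda>y. tensor_conv \<K> f (iter_pd is g) x y)"
proof -
  show "iter_pd is (\<lambda>x. tensor_conv \<K> f g x y) = (\<lambda>x. tensor_conv \<K> (iter_pd is f) g x y)"
  proof (induction "is")
    case (Cons i "is")
    show ?case unfolding iter_pd_Cons Cons
      by (rule ext) (simp only: partial_deriv_eq[OF tensor_conv_has_derivative(1)[OF K test_fns_iter_pd[OF f] g]] sum_axis)
  qed simp
  show "iter_pd is (\<lambda>y. tensor_conv \<K> f g x y) = (\<lambda>y. tensor_conv \<K> f (iter_pd is g) x y)"
  proof (induction "is")
    case (Cons i "is")
    show ?case unfolding iter_pd_Cons Cons
      by (rule ext) (simp only: partial_deriv_eq[OF tensor_conv_has_derivative(2)[OF K f test_fns_iter_pd[OF g]]] sum_axis)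
  qed simp
qed

lemma multi_deriv2_tensor_conv:
  assumes "tempered \<K>" "f \<in> test_fns" "g \<in> test_fns"
  shows "multi_deriv2 \<alpha> \<beta> (tensor_conv \<K> f g) x y = tensor_conv \<K> (iter_pd (mi_list \<alpha>) f) (iter_pd (mi_list \<beta>) g) x y"
  unfolding multi_deriv2_def multi_deriv_conv_iter_pd iter_pd_tensor_conv(2)[OF assms]
    iter_pd_tensor_conv(1)[OF assms(1,2) test_fns_iter_pd[OF assms(3)]] ..

section \<open>Singular integral operators\<close>

text \<open>If one side is not integrable, neither is the other and both integrals are 0 by
  convention, so the swap holds for every F.\<close>

lemma lborel_integral_swap:
  fixes F :: "'a::euclidean_space \<Rightarrow> 'a \<Rightarrow> complex"
  shows "(LINT (x, y)|lborel. F x y) = (LINT (x, y)|lborel. F y x)"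
proof -
  have eq: "(\<lambda>(x, y). F y x) = (\<lambda>(x, y). (\<lambda>(x, y). F x y) (y, x))" by auto
  show ?thesis
  proof (cases "integrable (lborel \<Otimes>\<^sub>M lborel) (\<lambda>(x, y). F x y)")
    case True
    from lborel_pair.integral_product_swap[OF borel_measurable_integrable[OF True]]
    show ?thesis by (simp add: lborel_prod)
  next
    case False
    then have "\<not> integrable (lborel \<Otimes>\<^sub>M lborel) (\<lambda>(x, y). F y x)"
      unfolding eq lborel_pair.integrable_product_swap_iff .
    with False show ?thesis by (simp add: lborel_prod not_integrable_integral_eq)
  qed
qed

lemma narrow_operI:
  fixes S :: "('n::finite) oper"
  assumes S: "continuous_oper P1 S" and P: "P1 \<le> P"
    and K: "taylor_kernel M (real M + \<gamma>) (real CARD('n) + \<nu> + real M + \<gamma>) K"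
      "\<And>\<psi> \<phi>. \<psi> \<in> test_fns0 P1 \<Longrightarrow> \<phi> \<in> test_fns \<Longrightarrow> supp \<psi> \<inter> supp \<phi> = {} \<Longrightarrow>
        S \<psi> \<phi> = (LINT (u, v)|lborel. K u v * \<psi> u * \<phi> v)"
    and C: "C > 0" "\<And>c r \<psi> \<phi>. \<psi> \<in> test_fns0 P \<Longrightarrow> \<phi> \<in> test_fns \<Longrightarrow> r > 0 \<Longrightarrow> normalized N c r \<psi> \<Longrightarrow> normalized N c r \<phi> \<Longrightarrow>
      norm (S \<psi> \<phi>) \<le> C * measure lborel (ball c r) powr (1 - \<nu> / real CARD('n))"
  shows "narrow_oper P \<nu> M \<gamma> S"
proof -
  have sch: "\<psi> \<in> schwartz0 P1" if "\<psi> \<in> test_fns0 P" for \<psi> :: "real ^ 'n \<Rightarrow> complex"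
    using test_fns0_schwartz0 test_fns0_mono[OF that P] by blast
  have t: "tempered (S \<psi>)" if "\<psi> \<in> test_fns0 P" for \<psi>
    using S sch[OF that] unfolding continuous_oper_def by blast
  have hom: "S (\<lambda>x. c * \<psi> x) \<phi> = c * S \<psi> \<phi>" if "\<psi> \<in> test_fns0 P" "\<phi> \<in> test_fns" for \<psi> \<phi> c
    using S sch[OF that(1)] test_fns_schwartz[OF that(2)] unfolding continuous_oper_def by blast
  show ?thesis unfolding narrow_oper_def
  proof (intro conjI exI[of _ K] K(1) ballI allI impI exI[of _ N] exI[of _ C] C(1); (elim conjE)?)
    fix \<psi> \<phi> :: "real ^ 'n \<Rightarrow> complex" assume \<psi>: "\<psi> \<in> test_fns0 P" and \<phi>: "\<phi> \<in> test_fns"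
    show "S (\<lambda>x. c * \<psi> x) \<phi> = c * S \<psi> \<phi>" for c by (rule hom[OF \<psi> \<phi>])
    show "S \<psi> (\<lambda>x. c * \<phi> x) = c * S \<psi> \<phi>" for c by (rule tempered_cmult[OF t[OF \<psi>] \<phi>])
    show "S \<psi> (\<lambda>x. \<phi> x + \<phi>2 x) = S \<psi> \<phi> + S \<psi> \<phi>2" if "\<phi>2 \<in> test_fns" for \<phi>2
      by (rule tempered_add[OF t[OF \<psi>] \<phi> that])
    show "S \<psi> \<phi> = (LINT (u, v)|lborel. K u v * \<psi> u * \<phi> v)" if "supp \<psi> \<inter> supp \<phi> = {}"
      by (rule K(2)[OF test_fns0_mono[OF \<psi> P] \<phi> that])
    show "norm (S \<psi> \<phi>) \<le> C * measure lborel (ball c r) powr (1 - \<nu> / real CARD('n))"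
      if "r > 0" "normalized N c r \<psi>" "normalized N c r \<phi>" for c r
      by (rule C(2)[OF \<psi> \<phi> that])
  qed
qed

text \<open>The order must serve the kernel representation and the weak boundedness property, hence
  the maximum of P1 and M'. For T the narrow function occupies the second kernel variable, for
  \<open>Ts\<close> the first.\<close>

lemma SIO_WBP_imp_narrow_oper:
  fixes T Ts :: "('n::finite) oper"
  assumes SIO: "SIO_at P1 \<nu> M \<gamma> T Ts" and \<gamma>: "0 < \<gamma>" and WBP: "WBP \<nu> T Ts"
  shows "\<exists>P2. \<forall>P\<ge>P2. narrow_oper P \<nu> M \<gamma> T \<and> narrow_oper P \<nu> M \<gamma> Ts"
proof -
  let ?v = "\<lambda>c r. measure lborel (ball (c :: real ^ 'n) r) powr (1 - \<nu> / real CARD('n))"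
  obtain M' N C where C: "C > 0" and "\<forall>c r. r > 0 \<longrightarrow> (\<forall>\<psi>\<in>test_fns0 M'. \<forall>\<phi>\<in>test_fns.
      supp \<psi> \<subseteq> ball c r \<and> supp \<phi> \<subseteq> ball c r \<and> (\<forall>\<alpha> x. mi_order \<alpha> \<le> N \<longrightarrow>
        norm (multi_deriv \<alpha> \<psi> x) \<le> measure lborel (ball c r) powr (- real (mi_order \<alpha>) / real CARD('n)) \<and>
        norm (multi_deriv \<alpha> \<phi> x) \<le> measure lborel (ball c r) powr (- real (mi_order \<alpha>) / real CARD('n)))
      \<longrightarrow> norm (T \<psi> \<phi>) + norm (Ts \<psi> \<phi>) \<le> C * ?v c r)"
    using WBP unfolding WBP_def Let_def by (elim exE conjE) (rule that)
  note W0 = this(2)[rule_format]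
  have W: "norm (T \<psi> \<phi>) + norm (Ts \<psi> \<phi>) \<le> C * ?v c r"
    if "\<psi> \<in> test_fns0 M'" "\<phi> \<in> test_fns" "r > 0" "normalized N c r \<psi>" "normalized N c r \<phi>" for c r \<psi> \<phi>
    using that(4,5) by (intro W0[OF that(3,1,2)]) (simp add: normalized_def)
  obtain K where K: "SIO_kernel \<nu> M \<gamma> K"
    and KT: "\<And>f g. f \<in> test_fns0 P1 \<Longrightarrow> g \<in> test_fns \<Longrightarrow> supp f \<inter> supp g = {} \<Longrightarrow>
      T f g = (LINT (x, y)|lborel. K x y * f y * g x)"
    and KTs: "\<And>f g. f \<in> test_fns \<Longrightarrow> g \<in> test_fns0 P1 \<Longrightarrow> supp f \<inter> supp g = {} \<Longrightarrow>
      Ts g f = (LINT (x, y)|lborel. K x y * f y * g x)"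
    using SIO unfolding SIO_at_def by (elim exE conjE) blast
  note tk = SIO_kernel_imp_taylor_kernel[OF K \<gamma>]
  have c: "continuous_oper P1 T" "continuous_oper P1 Ts" using SIO unfolding SIO_at_def by blast+
  have "narrow_oper P \<nu> M \<gamma> T \<and> narrow_oper P \<nu> M \<gamma> Ts" if P: "P \<ge> max P1 M'" for P
  proof
    have P': "P1 \<le> P" "M' \<le> P" using P by auto
    have w: "norm (T \<psi> \<phi>) \<le> C * ?v c r" "norm (Ts \<psi> \<phi>) \<le> C * ?v c r"
      if "\<psi> \<in> test_fns0 P" "\<phi> \<in> test_fns" "r > 0" "normalized N c r \<psi>" "normalized N c r \<phi>" for \<psi> \<phi> c r
      using W[OF test_fns0_mono[OF that(1) P'(2)] that(2-)] norm_ge_zero[of "T \<psi> \<phi>"] norm_ge_zero[of "Ts \<psi> \<phi>"]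
      by linarith+
    show "narrow_oper P \<nu> M \<gamma> T"
    proof (rule narrow_operI[OF c(1) P'(1) tk(2) _ C w(1)])
      fix \<psi> \<phi> :: "real ^ 'n \<Rightarrow> complex"
      assume "\<psi> \<in> test_fns0 P1" "\<phi> \<in> test_fns" "supp \<psi> \<inter> supp \<phi> = {}"
      from KT[OF this] show "T \<psi> \<phi> = (LINT (u, v)|lborel. K v u * \<psi> u * \<phi> v)"
        by (simp only: lborel_integral_swap[of "\<lambda>x y. K x y * \<psi> y * \<phi> x"])
    qed
    show "narrow_oper P \<nu> M \<gamma> Ts"
    proof (rule narrow_operI[OF c(2) P'(1) tk(1) _ C w(2)])
      fix \<psi> \<phi> :: "real ^ 'n \<Rightarrow> complex"
      assume "\<psi> \<in> test_fns0 P1" "\<phi> \<in> test_fns" "supp \<psi> \<inter> supp \<phi> = {}"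
      then show "Ts \<psi> \<phi> = (LINT (u, v)|lborel. K u v * \<psi> u * \<phi> v)"
        using KTs[of \<phi> \<psi>] by (simp add: Int_commute mult_ac)
    qed
  qed
  then show ?thesis by blast
qed

section \<open>Cancellation on polynomials\<close>

lemma poly_deg_mult: "poly_deg a p \<Longrightarrow> poly_deg b q \<Longrightarrow> poly_deg (a + b) (\<lambda>x. p x * q x)"
proof (induction rule: poly_deg.induct)
  case (const d c)
  then show ?case using poly_deg_mono[OF poly_deg_cmult, of b q "d + b" c] by simp
next
  case (add d p q')
  then show ?case using poly_deg.add[of "d + b" "\<lambda>x. p x * q x" "\<lambda>x. q' x * q x"] by (simp add: distrib_right)
next
  case (coord d p i)
  then show ?case using poly_deg.coord[of "d + b" "\<lambda>x. p x * q x" i] by (simp add: mult.assoc)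
qed

text \<open>Multiplication by a polynomial of degree d uses up d vanishing moments; the 2P moments
  of the cutoffs pay for it.\<close>

lemma test_fns0_mult_poly:
  assumes "\<eta> \<in> test_fns0 Q" "poly_deg d p" "P + d \<le> Q"
  shows "(\<lambda>x. p x * \<eta> x) \<in> test_fns0 P"
  unfolding test_fns0_iff
proof (intro conjI allI impI)
  show "(\<lambda>x. p x * \<eta> x) \<in> test_fns"
    using test_fns_mult[OF test_fns0_imp[OF assms(1)] poly_deg_smooth[OF assms(2)]] .
  fix q :: "real ^ 'a \<Rightarrow> complex" assume "poly_deg P q"
  then have "poly_deg Q (\<lambda>x. q x * p x)" using poly_deg_mono[OF poly_deg_mult] assms(2,3) by blast
  then have "(LINT x|lborel. (q x * p x) * \<eta> x) = 0" using assms(1) unfolding test_fns0_iff by blast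
  then show "(LINT x|lborel. q x * (p x * \<eta> x)) = 0" by (simp add: mult.assoc)
qed

text \<open>The hypothesis concerns \<open>Ts\<close> acting on cut-off monomials. Transposition
  rewrites it as T applied to the narrow function and tested against them, the form needed when T
  acts on the smaller scale; linearity then passes from monomials to polynomials.\<close>

lemma annihilates_imp_cancellation:
  fixes T Ts :: "('n::finite) oper"
  assumes SIO: "SIO_at P1 \<nu> M \<gamma> T Ts"
    and ann: "\<And>\<alpha>. mi_order \<alpha> \<le> L \<Longrightarrow> annihilates_monomial \<nu> M \<gamma> Ts T \<alpha>"
  shows "\<exists>P3. \<forall>P\<ge>P3. \<exists>\<eta>\<in>test_fns. (\<forall>x\<in>ball 0 1. \<eta> x = 1) \<and>
    (\<forall>p \<psi>. poly_deg L p \<longrightarrow> \<psi> \<in> test_fns0 P \<longrightarrow> ((\<lambda>R::real. T \<psi> (\<lambda>x. p x * \<eta> (x /\<^sub>R R))) \<longlongrightarrow> 0) at_top)"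
proof -
  let ?A = "{\<alpha> :: 'n \<Rightarrow> nat. mi_order \<alpha> \<le> L}"
  have "\<exists>P. \<forall>\<psi>\<in>test_fns0 P. monomial_pairing P Ts \<alpha> \<psi> 0" if "mi_order \<alpha> \<le> L" for \<alpha>
    using ann[OF that] unfolding annihilates_monomial_def by blast
  then obtain p0 where p0: "\<And>\<alpha> \<psi>. mi_order \<alpha> \<le> L \<Longrightarrow> \<psi> \<in> test_fns0 (p0 \<alpha>) \<Longrightarrow> monomial_pairing (p0 \<alpha>) Ts \<alpha> \<psi> 0"
    by metis
  have fin: "finite ?A"
  proof (rule finite_subset)
    show "?A \<subseteq> (\<lambda>is. count (mset is)) ` {is. length is \<le> L}"
    proof
      fix \<alpha> :: "'n \<Rightarrow> nat" assume "\<alpha> \<in> ?A"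
      have "\<alpha> = count (mset (mi_list \<alpha>))" by (simp add: count_mi_list)
      moreover have "mi_list \<alpha> \<in> {is. length is \<le> L}" using \<open>\<alpha> \<in> ?A\<close> by (simp add: length_mi_list)
      ultimately show "\<alpha> \<in> (\<lambda>is. count (mset is)) ` {is. length is \<le> L}" by blast
    qed
  qed (use finite_lists_length_le_UNIV in blast)
  \<comment> \<open>Each monomial comes with its own order p0 \<alpha>; the sum over the finitely
    many \<alpha> bounds them all, and P1 + L leaves enough moments for the transposition.\<close>
  define P3 where "P3 = P1 + L + (\<Sum>\<alpha>\<in>?A. p0 \<alpha>)"
  have "\<exists>\<eta>\<in>test_fns. (\<forall>x\<in>ball 0 1. \<eta> x = 1) \<and>
    (\<forall>p \<psi>. poly_deg L p \<longrightarrow> \<psi> \<in> test_fns0 P \<longrightarrow> ((\<lambda>R::real. T \<psi> (\<lambda>x. p x * \<eta> (x /\<^sub>R R))) \<longlongrightarrow> 0) at_top)"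
    if P: "P \<ge> P3" for P
  proof -
    \<comment> \<open>A cutoff with 2P moments is admissible for every order p0 \<alpha> \<le> P, so
      a single \<eta> works for all monomials.\<close>
    obtain \<eta> :: "real ^ 'n \<Rightarrow> complex" where \<eta>: "\<eta> \<in> test_fns0 (2 * P)" "\<And>x. x \<in> ball 0 1 \<Longrightarrow> \<eta> x = 1"
      using exists_cutoff_moments[of "2 * P"] by blast
    have p0P: "p0 \<alpha> \<le> P" if "mi_order \<alpha> \<le> L" for \<alpha>
      using member_le_sum[of \<alpha> ?A p0] fin that P by (simp add: P3_def)
    have P1: "P1 \<le> P" "P1 + L \<le> 2 * P" using P by (auto simp: P3_def)
    have \<eta>R: "(\<lambda>x. \<eta> (x /\<^sub>R R)) \<in> test_fns0 (2 * P)" if "R > 0" for R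
      using test_fns0_scale[OF \<eta>(1), of "inverse R" 0] that by simp
    have p\<eta>: "(\<lambda>x. p x * \<eta> (x /\<^sub>R R)) \<in> test_fns0 P1" if "poly_deg L p" "R > 0" for p R
      by (rule test_fns0_mult_poly[OF \<eta>R[OF that(2)] that(1) P1(2)])
    have mono: "((\<lambda>R::real. T \<psi> (\<lambda>x. of_real (vpow x \<alpha>) * \<eta> (x /\<^sub>R R))) \<longlongrightarrow> 0) at_top"
      if \<alpha>: "mi_order \<alpha> \<le> L" and \<psi>: "\<psi> \<in> test_fns0 P" for \<alpha> \<psi>
    proof -
      have "\<eta> \<in> test_fns0 (2 * p0 \<alpha>)" using test_fns0_mono[OF \<eta>(1)] p0P[OF \<alpha>] by simp
      moreover have "monomial_pairing (p0 \<alpha>) Ts \<alpha> \<psi> 0"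
        by (rule p0[OF \<alpha> test_fns0_mono[OF \<psi> p0P[OF \<alpha>]]])
      ultimately have "((\<lambda>R::real. Ts (\<lambda>x. vpow x \<alpha> *\<^sub>R \<eta> (x /\<^sub>R R)) \<psi>) \<longlongrightarrow> 0) at_top"
        using \<eta>(2) unfolding monomial_pairing_def by blast
      \<comment> \<open>Transposition requires the cut-off monomial to lie in
        \<open>schwartz0 P1\<close>, which is the case for R > 0.\<close>
      moreover have "eventually (\<lambda>R. Ts (\<lambda>x. vpow x \<alpha> *\<^sub>R \<eta> (x /\<^sub>R R)) \<psi> = T \<psi> (\<lambda>x. of_real (vpow x \<alpha>) * \<eta> (x /\<^sub>R R))) at_top"
        using eventually_gt_at_top[of 0]
      proof eventually_elim
        case (elim R)
        have "(\<lambda>x. of_real (vpow x \<alpha>) * \<eta> (x /\<^sub>R R)) \<in> schwartz0 P1"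
          by (rule test_fns0_schwartz0[OF p\<eta>[OF poly_deg_mono[OF poly_deg_vpow \<alpha>] elim]])
        moreover have "\<psi> \<in> schwartz0 P1" by (rule test_fns0_schwartz0[OF test_fns0_mono[OF \<psi> P1(1)]])
        ultimately show ?case using SIO unfolding SIO_at_def scaleR_conv_of_real by metis
      qed
      ultimately show ?thesis by (rule Lim_transform_eventually)
    qed
    have "((\<lambda>R::real. T \<psi> (\<lambda>x. p x * \<eta> (x /\<^sub>R R))) \<longlongrightarrow> 0) at_top"
      if p: "poly_deg L p" and \<psi>: "\<psi> \<in> test_fns0 P" for p \<psi>
    proof -
      have "continuous_oper P1 T" using SIO unfolding SIO_at_def by (elim conjE)
      then have "tempered (T \<psi>)"
        using test_fns0_schwartz0[OF test_fns0_mono[OF \<psi> P1(1)]] unfolding continuous_oper_def by blast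
      note lin = tempered_add[OF this] tempered_cmult[OF this]
      obtain xs :: "(complex \<times> ('n \<Rightarrow> nat)) list"
        where xs: "\<forall>(c, \<alpha>)\<in>set xs. mi_order \<alpha> \<le> L" "\<And>x. p x = (\<Sum>(c, \<alpha>)\<leftarrow>xs. c * of_real (vpow x \<alpha>))"
        using poly_deg_monomials[OF p] by blast
      have "((\<lambda>R::real. T \<psi> (\<lambda>x. (\<Sum>(c, \<alpha>)\<leftarrow>xs. c * of_real (vpow x \<alpha>)) * \<eta> (x /\<^sub>R R))) \<longlongrightarrow> 0) at_top"
        using xs(1)
      proof (induction xs)
        case Nil
        have "T \<psi> (\<lambda>x. 0) = 0" using lin(2)[OF test_fns_0, of 0] by simp
        then show ?case by simp
      next
        case (Cons a xs)
        obtain c \<alpha> where a: "a = (c, \<alpha>)" by fastforce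
        have \<alpha>: "mi_order \<alpha> \<le> L" and rest: "\<forall>(c, \<alpha>)\<in>set xs. mi_order \<alpha> \<le> L" using Cons.prems a by auto
        let ?r = "\<lambda>x. \<Sum>(c, \<alpha>)\<leftarrow>xs. c * of_real (vpow x \<alpha>)"
        have sm: "smooth ?r" using rest
        proof (induction xs)
          case (Cons b ys)
          then show ?case by (auto intro!: smooth_add smooth_cmult poly_deg_smooth[OF poly_deg_vpow])
        qed (simp add: smooth_const)
        have "((\<lambda>R. c * T \<psi> (\<lambda>x. of_real (vpow x \<alpha>) * \<eta> (x /\<^sub>R R)) + T \<psi> (\<lambda>x. ?r x * \<eta> (x /\<^sub>R R))) \<longlongrightarrow> c * 0 + 0) at_top"
          by (intro tendsto_intros mono[OF \<alpha> \<psi>] Cons.IH[OF rest])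
        then have lim: "((\<lambda>R. c * T \<psi> (\<lambda>x. of_real (vpow x \<alpha>) * \<eta> (x /\<^sub>R R)) + T \<psi> (\<lambda>x. ?r x * \<eta> (x /\<^sub>R R))) \<longlongrightarrow> 0) at_top" by simp
        show ?case
        proof (rule Lim_transform_eventually[OF lim])
          show "eventually (\<lambda>R. c * T \<psi> (\<lambda>x. of_real (vpow x \<alpha>) * \<eta> (x /\<^sub>R R)) + T \<psi> (\<lambda>x. ?r x * \<eta> (x /\<^sub>R R))
              = T \<psi> (\<lambda>x. (\<Sum>(c, \<alpha>)\<leftarrow>a # xs. c * of_real (vpow x \<alpha>)) * \<eta> (x /\<^sub>R R))) at_top"
            using eventually_gt_at_top[of 0]
          proof eventually_elim
            case (elim R)
            have e: "(\<lambda>x. \<eta> (x /\<^sub>R R)) \<in> test_fns" by (rule test_fns0_imp[OF \<eta>R[OF elim]])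
            have 1: "(\<lambda>x. of_real (vpow x \<alpha>) * \<eta> (x /\<^sub>R R)) \<in> test_fns"
              by (rule test_fns_mult[OF e poly_deg_smooth[OF poly_deg_vpow]])
            have 2: "(\<lambda>x. ?r x * \<eta> (x /\<^sub>R R)) \<in> test_fns" by (rule test_fns_mult[OF e sm])
            have "(\<lambda>x. (\<Sum>(c, \<alpha>)\<leftarrow>a # xs. c * of_real (vpow x \<alpha>)) * \<eta> (x /\<^sub>R R))
              = (\<lambda>x. c * (of_real (vpow x \<alpha>) * \<eta> (x /\<^sub>R R)) + ?r x * \<eta> (x /\<^sub>R R))"
              by (simp add: a algebra_simps fun_eq_iff)
            then show ?case using lin(1)[OF test_fns_cmult[OF 1] 2] lin(2)[OF 1] by simp
          qed
        qed
      qed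
      then show ?thesis by (simp add: xs(2))
    qed
    then show ?thesis using \<eta>(2) test_fns0_imp[OF \<eta>(1)] by blast
  qed
  then show ?thesis by blast
qed

section \<open>Almost diagonal estimates\<close>

definition dilate :: "(real ^ 'n::finite \<Rightarrow> complex) \<Rightarrow> int \<Rightarrow> real ^ 'n \<Rightarrow> complex"
  where "dilate \<psi> k w = of_real (2 powr (real_of_int k * real CARD('n))) * \<psi> ((2 powr real_of_int k) *\<^sub>R w)"

lemma powi_conv_powr: "(2::real) powi k = 2 powr real_of_int k"
  by (simp add: powr_real_of_int')

lemma dil_trans_conv_dilate: "dil_trans \<psi> k x = (\<lambda>u. dilate \<psi> k (x - u))"
  by (simp add: dil_trans_def dilate_def powi_conv_powr scaleR_conv_of_real fun_eq_iff)

lemma dil_trans_conv_dil: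
  fixes \<psi> :: "real ^ 'n::finite \<Rightarrow> complex"
  shows "dil_trans \<psi> k x = (\<lambda>u. of_real (2 powr (real_of_int k * real CARD('n))) * dil \<psi> (2 powr - real_of_int k) x u)"
  by (simp add: dil_trans_conv_dilate dilate_def dil_def powr_minus)

lemma dilate_test_fns: "\<psi> \<in> test_fns \<Longrightarrow> dilate \<psi> k \<in> test_fns"
  unfolding dilate_def[abs_def] using test_fns_cmult test_fns_scale[of \<psi> "2 powr real_of_int k" 0] by simp

lemma dil_trans_test_fns: "\<psi> \<in> test_fns \<Longrightarrow> dil_trans \<psi> k x \<in> test_fns"
  unfolding dil_trans_conv_dil by (intro test_fns_cmult dil_test_fns) auto

lemma dil_trans_test_fns0: "\<psi> \<in> test_fns0 P \<Longrightarrow> dil_trans \<psi> k x \<in> test_fns0 P"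
  unfolding dil_trans_conv_dil by (intro test_fns0_cmult dil_test_fns0) auto

lemma iter_pd_dilate:
  assumes "\<psi> \<in> test_fns"
  shows "iter_pd is (dilate \<psi> k) = (\<lambda>w. of_real (2 powr (real_of_int k * real (length is))) * dilate (iter_pd is \<psi>) k w)"
proof -
  have s: "smooth \<psi>" by (rule test_fns_smooth[OF assms])
  have "(2 powr real_of_int k) ^ length is = 2 powr (real_of_int k * real (length is))"
    by (simp add: powr_realpow[symmetric] powr_powr)
  moreover have "iter_pd is (\<lambda>w. c * \<psi> (r *\<^sub>R w + 0)) = (\<lambda>w. c * (of_real (r ^ length is) * iter_pd is \<psi> (r *\<^sub>R w + 0)))" for c r
    unfolding iter_pd_cmult[OF smooth_scale_comp[OF s]] iter_pd_scale[OF s] ..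
  ultimately show ?thesis unfolding dilate_def[abs_def] by (simp add: mult.left_commute del: of_real_power)
qed

lemma tensor_conv_scale:
  assumes "tempered \<K>" "f \<in> test_fns" "g \<in> test_fns"
  shows "tensor_conv \<K> (\<lambda>w. c * f w) (\<lambda>w. d * g w) x y = (c * d) * tensor_conv \<K> f g x y"
proof -
  have "tensor (\<lambda>v. d * g (y - v)) (\<lambda>u. c * f (x - u)) = (\<lambda>z. (c * d) * tensor (\<lambda>v. g (y - v)) (\<lambda>u. f (x - u)) z)"
    by (simp add: tensor_def fun_eq_iff)
  then show ?thesis unfolding tensor_conv_def
    using tempered_cmult[OF assms(1) tensor_test_fns[OF test_fns_reflect[OF assms(2)] test_fns_reflect[OF assms(3)]]] by simp
qed

lemma lam_conv_tensor_conv: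
  fixes Ts :: "('n::finite) oper"
  assumes K: "\<forall>f\<in>schwartz0 P1. \<forall>g\<in>schwartz. Ts f g = \<K> (tensor g f)"
    and "f \<in> test_fns0 P1" "g \<in> test_fns"
  shows "lam Ts f g j k x y = tensor_conv \<K> (dilate f j) (dilate g k) x y"
  unfolding lam_def tensor_conv_def dil_trans_conv_dilate[symmetric]
  by (rule K[rule_format, OF test_fns0_schwartz0[OF dil_trans_test_fns0[OF assms(2)]] test_fns_schwartz[OF dil_trans_test_fns[OF assms(3)]]])

text \<open>The pairing is a convolution of the distribution kernel with a tensor product of
  dilates. Derivatives pass to f and g, each contributing a factor 2^j or 2^k, and what remains is
  again a \<open>lam\<close>.\<close>

lemma lam_regularity:
  fixes Ts :: "('n::finite) oper"
  assumes c: "continuous_oper P1 Ts" and f: "f \<in> test_fns0 P1" and g: "g \<in> test_fns"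
  shows "smooth (\<lambda>(x, y). lam Ts f g j k x y)"
    and "multi_deriv2 \<alpha> \<beta> (lam Ts f g j k) x y =
      of_real (2 powr (real_of_int j * real (mi_order \<alpha>) + real_of_int k * real (mi_order \<beta>))) *
      lam Ts (iter_pd (mi_list \<alpha>) f) (iter_pd (mi_list \<beta>) g) j k x y"
    and "((\<lambda>x. lam Ts f g j k x y) has_derivative
      (\<lambda>h. \<Sum>i\<in>UNIV. h $ i *\<^sub>R (of_real (2 powr real_of_int j) * lam Ts (partial_deriv i f) g j k x y))) (at x)"
proof -
  obtain \<K> where \<K>: "tempered \<K>" and K: "\<forall>f\<in>schwartz0 P1. \<forall>g\<in>schwartz. Ts f g = \<K> (tensor g f)"
    using c unfolding continuous_oper_def by blast
  note f' = test_fns0_imp[OF f]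
  note df = dilate_test_fns[OF f', of j] and dg = dilate_test_fns[OF g, of k]
  have lam: "lam Ts f g j k = tensor_conv \<K> (dilate f j) (dilate g k)"
    by (intro ext lam_conv_tensor_conv[OF K f g])
  show "smooth (\<lambda>(x, y). lam Ts f g j k x y)"
    unfolding lam by (rule smooth_tensor_conv[OF \<K> df dg])
  have sc: "tensor_conv \<K> (iter_pd is (dilate f j)) (iter_pd js (dilate g k)) x y
    = of_real (2 powr (real_of_int j * real (length is) + real_of_int k * real (length js))) *
      lam Ts (iter_pd is f) (iter_pd js g) j k x y" for "is" js x
    unfolding iter_pd_dilate[OF f'] iter_pd_dilate[OF g]
      tensor_conv_scale[OF \<K> dilate_test_fns[OF test_fns_iter_pd[OF f']] dilate_test_fns[OF test_fns_iter_pd[OF g]]]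
      lam_conv_tensor_conv[OF K test_fns0_iter_pd[OF f] test_fns_iter_pd[OF g]]
    by (simp add: powr_add)
  show "multi_deriv2 \<alpha> \<beta> (lam Ts f g j k) x y =
      of_real (2 powr (real_of_int j * real (mi_order \<alpha>) + real_of_int k * real (mi_order \<beta>))) *
      lam Ts (iter_pd (mi_list \<alpha>) f) (iter_pd (mi_list \<beta>) g) j k x y"
    unfolding lam multi_deriv2_tensor_conv[OF \<K> df dg] sc length_mi_list ..
  have "tensor_conv \<K> (partial_deriv i (dilate f j)) (dilate g k) x y
      = of_real (2 powr real_of_int j) * lam Ts (partial_deriv i f) g j k x y" for i
    using sc[of "[i]" "[]" x] by simp
  then show "((\<lambda>x. lam Ts f g j k x y) has_derivative
      (\<lambda>h. \<Sum>i\<in>UNIV. h $ i *\<^sub>R (of_real (2 powr real_of_int j) * lam Ts (partial_deriv i f) g j k x y))) (at x)"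
    unfolding lam using tensor_conv_has_derivative(1)[OF \<K> df dg, of y x] by simp
qed

section \<open>Comparison estimates for the decay function\<close>

lemma Phi_conv_powr:
  fixes x :: "real ^ 'n::finite"
  shows "Phi N m x = 2 powr (real_of_int m * real CARD('n)) * (1 + 2 powr real_of_int m * norm x) powr - N"
  by (simp add: Phi_def powi_conv_powr)

lemma Phi_nonneg: "0 \<le> Phi N m x"
  by (simp add: Phi_conv_powr)

lemma Phi_near_lower:
  fixes x :: "real ^ 'n::finite"
  assumes "norm x < A * 2 powr - real_of_int m" "0 \<le> N" "0 \<le> A"
  shows "2 powr (real_of_int m * real CARD('n)) \<le> (1 + A) powr N * Phi N m x"
proof -
  have "2 powr real_of_int m * norm x \<le> 2 powr real_of_int m * (A * 2 powr - real_of_int m)"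
    using assms(1) by (intro mult_left_mono) auto
  also have "\<dots> = A" by (simp add: powr_minus)
  finally have "(1 + A) powr - N \<le> (1 + 2 powr real_of_int m * norm x) powr - N"
    using assms(2,3) by (intro powr_mono2') (auto intro: add_pos_nonneg)
  then have "(1 + A) powr N * (1 + A) powr - N \<le> (1 + A) powr N * (1 + 2 powr real_of_int m * norm x) powr - N"
    by (intro mult_left_mono) auto
  moreover have "(1 + A) powr N * (1 + A) powr - N = 1" using assms(3) by (simp add: powr_minus)
  ultimately have "1 \<le> (1 + A) powr N * (1 + 2 powr real_of_int m * norm x) powr - N" by simp
  then have "2 powr (real_of_int m * real CARD('n)) * 1 \<le> 2 powr (real_of_int m * real CARD('n)) * ((1 + A) powr N * (1 + 2 powr real_of_int m * norm x) powr - N)"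
    by (intro mult_left_mono) auto
  then show ?thesis by (simp add: Phi_conv_powr mult_ac)
qed

text \<open>For q = 2^m |x| \<ge> 1 one has 1 + q \<le> 2q. The exponent N - n remains after the
  normalization 2^(mn) of \<open>Phi\<close> is split off.\<close>

lemma Phi_far_lower:
  fixes x :: "real ^ 'n::finite"
  assumes "2 powr - real_of_int m \<le> norm x" "0 \<le> N"
  shows "norm x powr - N \<le> 2 powr N * 2 powr (real_of_int m * (N - real CARD('n))) * Phi N m x"
proof -
  let ?q = "2 powr real_of_int m * norm x"
  have "2 powr real_of_int m * 2 powr - real_of_int m \<le> ?q" using assms(1) by (intro mult_left_mono) auto
  then have q: "1 \<le> ?q" by (simp add: powr_minus)
  have "(2 * ?q) powr - N \<le> (1 + ?q) powr - N" using q assms(2) by (intro powr_mono2') linarith+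
  then have "2 powr N * (2 * ?q) powr - N \<le> 2 powr N * (1 + ?q) powr - N" by (intro mult_left_mono) auto
  moreover have "2 powr N * (2 * ?q) powr - N = ?q powr - N"
    unfolding powr_mult by (simp add: powr_minus)
  ultimately have 1: "?q powr - N \<le> 2 powr N * (1 + ?q) powr - N" by simp
  have "norm x powr - N = 2 powr (real_of_int m * N) * ?q powr - N"
    unfolding powr_mult powr_powr by (simp add: powr_minus)
  also have "\<dots> \<le> 2 powr (real_of_int m * N) * (2 powr N * (1 + ?q) powr - N)" by (intro mult_left_mono 1) auto
  also have "2 powr (real_of_int m * N) = 2 powr (real_of_int m * (N - real CARD('n))) * 2 powr (real_of_int m * real CARD('n))"
    by (simp add: powr_add[symmetric] algebra_simps)
  finally show ?thesis by (simp add: Phi_conv_powr mult_ac)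
qed

text \<open>The condition on h reads 2^m |h| \<le> (1 + 2^m |x|)/2, so 1 + 2^m |x| shrinks at most
  by half under the shift.\<close>

lemma Phi_shift:
  fixes x h :: "real ^ 'n::finite"
  assumes "norm h \<le> (2 powr - real_of_int m + norm x) / 2" "0 \<le> N"
  shows "Phi N m (x + h) \<le> 2 powr N * Phi N m x"
proof -
  let ?c = "2 powr real_of_int m"
  have "?c * norm h \<le> ?c * ((2 powr - real_of_int m + norm x) / 2)" using assms(1) by (intro mult_left_mono) auto
  also have "\<dots> = (1 + ?c * norm x) / 2" by (simp add: powr_minus field_simps)
  finally have h: "?c * norm h \<le> (1 + ?c * norm x) / 2" .
  have "norm x \<le> norm (x + h) + norm h" using norm_triangle_ineq4[of "x + h" h] by simp
  then have "?c * norm x \<le> ?c * (norm (x + h) + norm h)" by (intro mult_left_mono) auto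
  then have "(1 + ?c * norm x) / 2 \<le> 1 + ?c * norm (x + h)" using h by (simp add: distrib_left)
  then have "(1 + ?c * norm (x + h)) powr - N \<le> ((1 + ?c * norm x) / 2) powr - N"
    using assms(2) by (intro powr_mono2') (auto intro!: divide_pos_pos add_pos_nonneg)
  also have "\<dots> = 2 powr N * (1 + ?c * norm x) powr - N"
    unfolding powr_divide by (simp add: powr_minus divide_inverse)
  finally have "2 powr (real_of_int m * real CARD('n)) * (1 + ?c * norm (x + h)) powr - N
    \<le> 2 powr (real_of_int m * real CARD('n)) * (2 powr N * (1 + ?c * norm x) powr - N)" by (intro mult_left_mono) auto
  then show ?thesis by (simp add: Phi_conv_powr mult_ac)
qed

section \<open>The size estimate and the Hoelder estimate\<close>

text \<open>Four cases: j \<ge> k or j < k, and positions closer or further apart than a multiple of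
  the larger scale 2^(-min(j,k)). The kernel alone covers both far cases. Near the diagonal, the
  bound without cancellation suffices for j \<ge> k, where min(0,j-k) = 0, and the cancellation
  enters for j < k.\<close>

lemma lam_bound:
  fixes T Ts :: "('n::finite) oper"
  assumes L: "\<nu> \<le> real L" "real L \<le> real M + \<nu>" and \<gamma>: "0 < \<gamma>" and \<gamma>': "0 \<le> \<gamma>'" "\<gamma>' < \<gamma>" "\<gamma> \<le> 1"
    and S: "narrow_oper P \<nu> M \<gamma> T" "narrow_oper P \<nu> M \<gamma> Ts" and MP: "M \<le> P"
    and hom: "\<And>c f g. f \<in> test_fns0 P \<Longrightarrow> g \<in> test_fns0 P \<Longrightarrow> Ts (\<lambda>x. c * f x) g = c * Ts f g"
    and tr: "\<And>f g. f \<in> test_fns0 P \<Longrightarrow> g \<in> test_fns0 P \<Longrightarrow> T f g = Ts g f"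
    and \<eta>: "\<eta> \<in> test_fns" "\<And>x. x \<in> ball 0 1 \<Longrightarrow> \<eta> x = 1"
    and canc: "\<And>p \<psi>. poly_deg L p \<Longrightarrow> \<psi> \<in> test_fns0 P \<Longrightarrow> ((\<lambda>R::real. T \<psi> (\<lambda>x. p x * \<eta> (x /\<^sub>R R))) \<longlongrightarrow> 0) at_top"
    and f: "f \<in> test_fns0 P" and g: "g \<in> test_fns0 P"
  shows "\<exists>C\<ge>0. \<forall>j k x y. norm (lam Ts f g j k x y) \<le> C * 2 powr (\<nu> * real_of_int j)
    * 2 powr ((real_of_int \<lfloor>real L - \<nu>\<rfloor> + \<gamma>') * real_of_int (min 0 (j - k)))
    * Phi (real CARD('n) + \<nu> + real M + \<gamma>) (min j k) (x - y)"
proof -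
  let ?n = "real CARD('n)" and ?\<sigma> = "real M + \<gamma>" and ?l = "real_of_int \<lfloor>real L - \<nu>\<rfloor> + \<gamma>'"
  let ?N = "?n + \<nu> + real M + \<gamma>"
  have Mn: "0 \<le> real M + \<nu>" using L by linarith
  have N0: "0 \<le> ?N" and pos: "0 < \<nu> + real M + \<gamma>" using Mn \<gamma> by auto
  \<comment> \<open>The integer part does not exceed L-\<nu>, and L-\<nu> \<le> M together with
    \<gamma>' < \<gamma> keeps the exponent below M+\<gamma>.\<close>
  have l: "?l \<le> real L - \<nu> + \<gamma>'" "?l \<le> ?\<sigma>" using L \<gamma>' by linarith+
  have g0: "0 \<le> \<gamma>" using \<gamma> by simp
  note f' = test_fns0_imp[OF f] and g' = test_fns0_imp[OF g]
  have lam: "norm (lam Ts f g j k x y) = 2 powr ((real_of_int j + real_of_int k) * ?n) *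
      norm (Ts (dil f (2 powr - real_of_int j) x) (dil g (2 powr - real_of_int k) y))" for j k x y
  proof -
    have d: "dil f (2 powr - real_of_int j) x \<in> test_fns0 P" "dil g (2 powr - real_of_int k) y \<in> test_fns0 P"
      by (auto intro: dil_test_fns0 f g)
    have "lam Ts f g j k x y = of_real (2 powr (real_of_int j * ?n)) * (of_real (2 powr (real_of_int k * ?n)) *
        Ts (dil f (2 powr - real_of_int j) x) (dil g (2 powr - real_of_int k) y))"
      unfolding lam_def dil_trans_conv_dil hom[OF d(1) test_fns0_cmult[OF d(2)]] narrow_oper_cmult[OF S(2) d(1) test_fns0_imp[OF d(2)]] ..
    then show ?thesis by (simp add: norm_mult powr_add[symmetric] distrib_right)
  qed
  obtain C1 A1 where 1: "0 \<le> C1" "1 \<le> A1" "\<And>a b t s. 0 < t \<Longrightarrow> t \<le> s \<Longrightarrow> A1 * s \<le> norm (a - b) \<Longrightarrow>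
    norm (Ts (dil f t a) (dil g s b)) \<le> C1 * t powr (?n + ?\<sigma>) * s powr ?n * norm (a - b) powr - ?N"
    using narrow_oper_far_bound[OF S(2) MP g0 f g' N0] by metis
  obtain C2 A2 where 2: "0 \<le> C2" "1 \<le> A2" "\<And>a b t s. 0 < t \<Longrightarrow> t \<le> s \<Longrightarrow> A2 * s \<le> norm (a - b) \<Longrightarrow>
    norm (T (dil g t a) (dil f s b)) \<le> C2 * t powr (?n + ?\<sigma>) * s powr ?n * norm (a - b) powr - ?N"
    using narrow_oper_far_bound[OF S(1) MP g0 g f' N0] by metis
  obtain C3 where 3: "0 \<le> C3" "\<And>a b t s. 0 < t \<Longrightarrow> t \<le> s \<Longrightarrow> norm (Ts (dil f t a) (dil g s b)) \<le> C3 * t powr (?n - \<nu>)"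
    using narrow_oper_wide_bound[OF S(2) MP g0 f g' pos] by metis
  have \<tau>: "real L + \<gamma>' < \<nu> + real M + \<gamma>" and \<gamma>'1: "\<gamma>' \<le> 1" using L \<gamma>' by auto
  obtain C4 where 4: "0 \<le> C4" "\<And>a b t s. 0 < t \<Longrightarrow> t \<le> s \<Longrightarrow>
    norm (T (dil g t a) (dil f s b)) \<le> C4 * t powr (?n - \<nu>) * (t / s) powr (real L + \<gamma>')"
    using narrow_oper_cancellation_bound[OF S(1) MP g0 g f' \<gamma>'(1) \<gamma>'1 \<tau> \<eta> canc] by metis
  define C where "C = C1 * 2 powr ?N + C2 * 2 powr ?N + C3 * (1 + A1) powr ?N + C4 * (1 + A2) powr ?N"
  have C: "C1 * 2 powr ?N \<le> C" "C2 * 2 powr ?N \<le> C" "C3 * (1 + A1) powr ?N \<le> C" "C4 * (1 + A2) powr ?N \<le> C" "0 \<le> C"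
    using 1(1) 2(1) 3(1) 4(1) by (auto simp: C_def intro!: add_nonneg_nonneg mult_nonneg_nonneg)
  \<comment> \<open>With t = 2^(-max(j,k)) and s = 2^(-min(j,k)) the factors t^n s^n cancel the
    normalization 2^((j+k)n) of the two dilates.\<close>
  have far: "2 powr ((j + k) * ?n) * (D * (2 powr - max j k) powr (?n + ?\<sigma>) * (2 powr - min j k) powr ?n * X)
     \<le> D * (2 powr (- max j k * ?\<sigma>) * X)" for j k D X :: real
  proof -
    have "(j + k) * ?n = max j k * ?n + min j k * ?n" by (simp add: max_def min_def algebra_simps)
    then have "2 powr ((j + k) * ?n) * ((2 powr - max j k) powr (?n + ?\<sigma>) * (2 powr - min j k) powr ?n) = 2 powr (- max j k * ?\<sigma>)"
      unfolding powr_powr powr_add[symmetric] by (simp add: algebra_simps)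
    then show ?thesis by (simp add: mult_ac)
  qed
  have main: "norm (lam Ts f g j k x y) \<le> C * 2 powr (\<nu> * real_of_int j) * 2 powr (?l * real_of_int (min 0 (j - k)))
    * Phi ?N (min j k) (x - y)" for j k x y
  proof -
    let ?J = "real_of_int j" and ?K = "real_of_int k" and ?m = "real_of_int (min j k)"
    let ?P = "Phi ?N (min j k) (x - y)"
    let ?Z = "norm (Ts (dil f (2 powr - ?J) x) (dil g (2 powr - ?K) y))"
    define E where "E = 2 powr (\<nu> * ?J) * 2 powr (?l * real_of_int (min 0 (j - k)))"
    have EP: "0 \<le> E * ?P" unfolding E_def by (intro mult_nonneg_nonneg Phi_nonneg) auto
    have finish: "2 powr ((?J + ?K) * ?n) * ?Z \<le> C * (E * ?P)"
      if "2 powr ((?J + ?K) * ?n) * ?Z \<le> D * (E * ?P)" "D \<le> C" for D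
      using that mult_right_mono[OF that(2) EP] by linarith
    have far2: "2 powr ((?J + ?K) * ?n) * ?Z \<le> C * (E * ?P)"
      if Z: "?Z \<le> D * (2 powr - max ?J ?K) powr (?n + ?\<sigma>) * (2 powr - min ?J ?K) powr ?n * norm (x - y) powr - ?N"
        and D: "0 \<le> D" "D * 2 powr ?N \<le> C" and xy: "A * 2 powr - min ?J ?K \<le> norm (x - y)" "1 \<le> A" for D A
    proof (rule finish[OF _ D(2)])
      have m: "?m = min ?J ?K" by simp
      have "2 powr - min ?J ?K \<le> A * 2 powr - min ?J ?K" using xy(2) by simp
      then have xy': "2 powr - ?m \<le> norm (x - y)" using xy(1) unfolding m by linarith
      have "2 powr ((?J + ?K) * ?n) * ?Z \<le> 2 powr ((?J + ?K) * ?n) * (D * (2 powr - max ?J ?K) powr (?n + ?\<sigma>) * (2 powr - min ?J ?K) powr ?n * norm (x - y) powr - ?N)"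
        using Z by (intro mult_left_mono) auto
      also have "\<dots> \<le> D * (2 powr (- max ?J ?K * ?\<sigma>) * norm (x - y) powr - ?N)" by (rule far)
      also have "\<dots> \<le> D * (2 powr (- max ?J ?K * ?\<sigma>) * (2 powr ?N * 2 powr (?m * (?N - ?n)) * ?P))"
        using Phi_far_lower[OF xy' N0] D(1) by (intro mult_left_mono) auto
      also have "\<dots> = D * 2 powr ?N * (2 powr (- max ?J ?K * ?\<sigma> + ?m * (\<nu> + ?\<sigma>)) * ?P)"
        by (simp add: powr_add[symmetric] mult_ac) (simp add: powr_add algebra_simps)
      also have "\<dots> \<le> D * 2 powr ?N * (E * ?P)"
      proof (intro mult_left_mono mult_right_mono)
        \<comment> \<open>For j \<ge> k the left side exceeds the right by (k-j)(\<nu>+M+\<gamma>)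
          \<le> 0; for j < k by j-k times the nonnegative gap between M+\<gamma> and the claimed
          exponent.\<close>
        have "- max ?J ?K * ?\<sigma> + ?m * (\<nu> + ?\<sigma>) \<le> \<nu> * ?J + ?l * real_of_int (min 0 (j - k))"
        proof (cases "k \<le> j")
          case True
          then have "(?K - ?J) * (\<nu> + ?\<sigma>) \<le> 0" using pos by (intro mult_nonpos_nonneg) auto
          then show ?thesis using True by (simp add: algebra_simps)
        next
          case False
          then have "(?J - ?K) * ?\<sigma> \<le> (?J - ?K) * ?l" using l(2) by (intro mult_left_mono_neg) auto
          then show ?thesis using False by (simp add: algebra_simps)
        qed
        then show "2 powr (- max ?J ?K * ?\<sigma> + ?m * (\<nu> + ?\<sigma>)) \<le> E"
          unfolding E_def powr_add[symmetric] by simp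
      qed (use D(1) Phi_nonneg in auto)
      finally show "2 powr ((?J + ?K) * ?n) * ?Z \<le> D * 2 powr ?N * (E * ?P)" .
    qed
    have "2 powr ((?J + ?K) * ?n) * ?Z \<le> C * (E * ?P)"
    proof (cases "k \<le> j")
      case True
      then have mm: "max ?J ?K = ?J" "min ?J ?K = ?K" "min j k = k" by auto
      have ts: "0 < 2 powr - ?J" "2 powr - ?J \<le> 2 powr - ?K" using True by auto
      show ?thesis
      proof (cases "A1 * 2 powr - ?K \<le> norm (x - y)")
        case True
        show ?thesis by (rule far2[of C1 A1]) (use 1 ts C True in \<open>simp_all only: mm\<close>)
      next
        case far: False
        have "2 powr ((?J + ?K) * ?n) * ?Z \<le> 2 powr ((?J + ?K) * ?n) * (C3 * (2 powr - ?J) powr (?n - \<nu>))"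
          using 3(2)[OF ts] by (intro mult_left_mono) auto
        also have "\<dots> = C3 * (2 powr (\<nu> * ?J) * 2 powr (?K * ?n))"
          unfolding powr_powr by (simp add: powr_add[symmetric] mult.left_commute[of _ C3]) (simp add: algebra_simps)
        also have "\<dots> \<le> C3 * (2 powr (\<nu> * ?J) * ((1 + A1) powr ?N * ?P))"
          using Phi_near_lower[of "x - y" A1 k ?N] far N0 1(2) 3(1) unfolding mm by (intro mult_left_mono) auto
        also have "\<dots> = C3 * (1 + A1) powr ?N * (E * ?P)" using True by (simp add: E_def mult_ac)
        finally show ?thesis using C(3) by (rule finish)
      qed
    next
      case False
      then have mm: "max ?J ?K = ?K" "min ?J ?K = ?J" "min j k = j" by auto
      have ts: "0 < 2 powr - ?K" "2 powr - ?K \<le> 2 powr - ?J" using False by auto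
      \<comment> \<open>Both functions have vanishing moments, so the pairing may be transposed and
        T acts on the narrower of the two.\<close>
      have Z: "?Z = norm (T (dil g (2 powr - ?K) y) (dil f (2 powr - ?J) x))"
        by (subst tr) (auto intro: dil_test_fns0 f g)
      show ?thesis
      proof (cases "A2 * 2 powr - ?J \<le> norm (x - y)")
        case True
        then have "A2 * 2 powr - ?J \<le> norm (y - x)" by (simp add: norm_minus_commute)
        from 2(3)[OF ts this]
        have "?Z \<le> C2 * (2 powr - ?K) powr (?n + ?\<sigma>) * (2 powr - ?J) powr ?n * norm (x - y) powr - ?N"
          unfolding Z by (simp only: norm_minus_commute[of x y])
        then show ?thesis by (intro far2[of C2 A2]) (use 2 C True in \<open>simp_all only: mm\<close>)
      next
        case far: False
        have pw: "2 powr A * (C4 * 2 powr B * 2 powr D) = C4 * 2 powr (A + (B + D))" for A B D :: real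
          by (simp add: powr_add mult_ac)
        have r: "2 powr - ?K / 2 powr - ?J = 2 powr (?J - ?K)" by (simp add: powr_diff powr_minus field_simps)
        have "2 powr ((?J + ?K) * ?n) * ?Z \<le> 2 powr ((?J + ?K) * ?n) * (C4 * (2 powr - ?K) powr (?n - \<nu>) * (2 powr - ?K / 2 powr - ?J) powr (real L + \<gamma>'))"
          using 4(2)[OF ts] unfolding Z by (intro mult_left_mono) auto
        also have "\<dots> = C4 * (2 powr ((?J + ?K) * ?n + (- ?K * (?n - \<nu>) + (?J - ?K) * (real L + \<gamma>'))))"
          unfolding r powr_powr pw ..
        also have "(?J + ?K) * ?n + (- ?K * (?n - \<nu>) + (?J - ?K) * (real L + \<gamma>')) = ?J * ?n + (\<nu> * ?J + (real L - \<nu> + \<gamma>') * (?J - ?K))"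
          by (simp add: algebra_simps)
        \<comment> \<open>As j - k < 0, replacing L-\<nu> by its integer part enlarges the
          bound.\<close>
        also have "C4 * 2 powr \<dots> \<le> C4 * 2 powr (?J * ?n + (\<nu> * ?J + ?l * (?J - ?K)))"
        proof (intro mult_left_mono)
          have "(real L - \<nu> + \<gamma>') * (?J - ?K) \<le> ?l * (?J - ?K)"
            using l(1) False by (intro mult_right_mono_neg) auto
          then show "2 powr (?J * ?n + (\<nu> * ?J + (real L - \<nu> + \<gamma>') * (?J - ?K))) \<le> 2 powr (?J * ?n + (\<nu> * ?J + ?l * (?J - ?K)))"
            by simp
        qed (rule 4(1))
        also have "\<dots> = C4 * (E * 2 powr (?J * ?n))" using False by (simp add: E_def powr_add mult_ac)
        also have "\<dots> \<le> C4 * (E * ((1 + A2) powr ?N * ?P))"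
          using Phi_near_lower[of "x - y" A2 j ?N] far N0 2(2) 4(1) unfolding mm
          by (intro mult_left_mono) (auto simp: E_def)
        also have "\<dots> = C4 * (1 + A2) powr ?N * (E * ?P)" by (simp add: mult_ac)
        finally show ?thesis using C(4) by (rule finish)
      qed
    qed
    then show ?thesis unfolding lam E_def by (simp add: mult_ac)
  qed
  then show ?thesis using C(5) by blast
qed

text \<open>For 2^j |h| \<ge> 1 the two values are bounded separately and the factor (2^j
  |h|)^(\<gamma>'-\<delta>) is at least 1. For 2^j |h| < 1 the mean value inequality gives 2^j |h|,
  at most that factor because 0 \<le> \<gamma>'-\<delta> \<le> 1. Lowering the exponent e+\<gamma>'
  to e+\<delta> only enlarges the bound, as it multiplies min(0,j-k) \<le> 0.\<close>

lemma lam_hoelder_bound: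
  fixes Ts :: "('n::finite) oper" and f g :: "real ^ 'n \<Rightarrow> complex"
  assumes c: "continuous_oper P1 Ts" and f: "f \<in> test_fns0 P1" and g: "g \<in> test_fns"
    and N: "0 \<le> N" and \<delta>: "0 \<le> \<delta>" "\<delta> \<le> \<gamma>'" "\<gamma>' \<le> 1"
    and B: "\<And>is. length is \<le> 1 \<Longrightarrow> \<exists>C\<ge>0. \<forall>j k x y. norm (lam Ts (iter_pd is f) g j k x y) \<le>
      C * 2 powr (\<nu> * real_of_int j) * 2 powr ((e + \<gamma>') * real_of_int (min 0 (j - k))) * Phi N (min j k) (x - y)"
  shows "\<exists>C\<ge>0. \<forall>j k x y h. norm h < (2 powi (- min j k) + norm (x - y)) / 2 \<longrightarrow>
    norm (lam Ts f g j k (x + h) y - lam Ts f g j k x y) \<le>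
      C * 2 powr (\<nu> * real_of_int j) * (2 powi j * norm h) powr (\<gamma>' - \<delta>) *
      2 powr (real_of_int (min 0 (j - k)) * (e + \<delta>)) * Phi N (min j k) (x - y)"
proof -
  let ?E = "\<lambda>j k x y. 2 powr (\<nu> * real_of_int j) * 2 powr ((e + \<gamma>') * real_of_int (min 0 (j - k))) * Phi N (min j k) (x - y)"
  obtain C0 where C0: "0 \<le> C0" "\<And>j k x y. norm (lam Ts f g j k x y) \<le> C0 * ?E j k x y"
    using B[of "[]"] by (auto simp: mult.assoc)
  have "\<exists>C\<ge>0. \<forall>j k x y. norm (lam Ts (partial_deriv i f) g j k x y) \<le> C * ?E j k x y" for i
    using B[of "[i]"] by (auto simp: mult.assoc)
  then obtain C1 where C1: "\<And>i. 0 \<le> C1 i" "\<And>i j k x y. norm (lam Ts (partial_deriv i f) g j k x y) \<le> C1 i * ?E j k x y"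
    by metis
  define D where "D = (\<Sum>i\<in>UNIV. C1 i)"
  have D: "0 \<le> D" unfolding D_def by (intro sum_nonneg C1)
  define C where "C = C0 * (2 powr N + 1) + D * 2 powr N"
  have C: "C0 * (2 powr N + 1) \<le> C" "D * 2 powr N \<le> C" "0 \<le> C"
    using C0(1) D by (auto simp: C_def intro!: add_nonneg_nonneg mult_nonneg_nonneg)
  have "norm (lam Ts f g j k (x + h) y - lam Ts f g j k x y) \<le>
      C * 2 powr (\<nu> * real_of_int j) * (2 powi j * norm h) powr (\<gamma>' - \<delta>) *
      2 powr (real_of_int (min 0 (j - k)) * (e + \<delta>)) * Phi N (min j k) (x - y)"
    if h: "norm h < (2 powi (- min j k) + norm (x - y)) / 2" for j k x y h
  proof -
    let ?m = "real_of_int (min 0 (j - k))" and ?F = "\<lambda>x. lam Ts f g j k x y"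
    let ?V = "2 powr (\<nu> * real_of_int j) * 2 powr (?m * (e + \<delta>)) * Phi N (min j k) (x - y)"
    let ?H = "2 powi j * norm h"
    \<comment> \<open>The restriction on |h| keeps the decay factor comparable along the whole
      segment from x to x+h.\<close>
    have E_shift: "?E j k (x + t *\<^sub>R h) y \<le> 2 powr N * ?V" if t: "0 \<le> t" "t \<le> 1" for t
    proof -
      have "norm (t *\<^sub>R h) \<le> norm h" using t by (simp add: mult_left_le_one_le)
      then have "norm (t *\<^sub>R h) \<le> (2 powr - real_of_int (min j k) + norm (x - y)) / 2"
        using h unfolding powi_conv_powr of_int_minus by linarith
      from Phi_shift[OF this N] have "Phi N (min j k) (x + t *\<^sub>R h - y) \<le> 2 powr N * Phi N (min j k) (x - y)"
        by (simp add: algebra_simps)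
      moreover have "2 powr ((e + \<gamma>') * ?m) \<le> 2 powr (?m * (e + \<delta>))"
      proof -
        have "?m * (e + \<gamma>') \<le> ?m * (e + \<delta>)" using \<delta> by (intro mult_left_mono_neg) auto
        then show ?thesis by (simp add: mult.commute)
      qed
      ultimately have "2 powr ((e + \<gamma>') * ?m) * Phi N (min j k) (x + t *\<^sub>R h - y)
          \<le> 2 powr (?m * (e + \<delta>)) * (2 powr N * Phi N (min j k) (x - y))"
        by (intro mult_mono Phi_nonneg) auto
      then have "2 powr (\<nu> * real_of_int j) * (2 powr ((e + \<gamma>') * ?m) * Phi N (min j k) (x + t *\<^sub>R h - y))
          \<le> 2 powr (\<nu> * real_of_int j) * (2 powr (?m * (e + \<delta>)) * (2 powr N * Phi N (min j k) (x - y)))"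
        by (rule mult_left_mono) simp
      then show ?thesis by (simp add: mult_ac)
    qed
    have E0: "?E j k x y \<le> ?V"
    proof -
      have "?m * (e + \<gamma>') \<le> ?m * (e + \<delta>)" using \<delta> by (intro mult_left_mono_neg) auto
      then show ?thesis by (intro mult_right_mono mult_left_mono Phi_nonneg) (auto simp: mult.commute)
    qed
    have V: "0 \<le> ?V" by (intro mult_nonneg_nonneg Phi_nonneg) auto
    have "norm (?F (x + h) - ?F x) \<le> C * (?H powr (\<gamma>' - \<delta>) * ?V)"
    proof (cases "1 \<le> ?H")
      case True
      have "norm (?F (x + h) - ?F x) \<le> norm (?F (x + h)) + norm (?F x)" by (rule norm_triangle_ineq4)
      also have "\<dots> \<le> C0 * (2 powr N * ?V) + C0 * ?V"
      proof (intro add_mono)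
        show "norm (?F (x + h)) \<le> C0 * (2 powr N * ?V)"
          using C0(2)[of j k "x + h" y] mult_left_mono[OF E_shift[of 1] C0(1)] by simp
        show "norm (?F x) \<le> C0 * ?V"
          using C0(2)[of j k x y] mult_left_mono[OF E0 C0(1)] by linarith
      qed
      also have "\<dots> = C0 * (2 powr N + 1) * ?V" by (simp add: algebra_simps)
      also have "\<dots> \<le> C * ?V" by (rule mult_right_mono[OF C(1) V])
      also have "\<dots> \<le> C * (?H powr (\<gamma>' - \<delta>) * ?V)"
      proof (rule mult_left_mono[OF _ C(3)])
        have "1 \<le> ?H powr (\<gamma>' - \<delta>)" using True \<delta> by (intro ge_one_powr_ge_zero) auto
        from mult_right_mono[OF this V] show "?V \<le> ?H powr (\<gamma>' - \<delta>) * ?V" by simp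
      qed
      finally show ?thesis .
    next
      case False
      have "norm (?F (x + 1 *\<^sub>R h) - ?F (x + 0 *\<^sub>R h)) \<le> (D * 2 powr N * (?H * ?V)) * 1"
      proof (rule interval_mvt_bound[where g = "\<lambda>t. ?F (x + t *\<^sub>R h)"])
        fix t :: real assume t: "0 \<le> t" "t \<le> 1"
        let ?d = "\<Sum>i\<in>UNIV. h $ i *\<^sub>R (of_real (2 powr real_of_int j) * lam Ts (partial_deriv i f) g j k (x + t *\<^sub>R h) y)"
        show "((\<lambda>t. ?F (x + t *\<^sub>R h)) has_vector_derivative ?d) (at t)"
          by (rule has_vector_derivative_along_line[OF lam_regularity(3)[OF c f g]])
        have "norm ?d \<le> (\<Sum>i\<in>UNIV. ?H * (C1 i * (2 powr N * ?V)))"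
        proof (rule sum_norm_le)
          fix i
          have "norm (lam Ts (partial_deriv i f) g j k (x + t *\<^sub>R h) y) \<le> C1 i * (2 powr N * ?V)"
            using C1(2)[of i j k "x + t *\<^sub>R h" y] mult_left_mono[OF E_shift[OF t] C1(1)[of i]] by linarith
          then have "\<bar>h $ i\<bar> * (2 powr real_of_int j * norm (lam Ts (partial_deriv i f) g j k (x + t *\<^sub>R h) y))
            \<le> norm h * (2 powr real_of_int j * (C1 i * (2 powr N * ?V)))"
            by (intro mult_mono component_le_norm_cart) auto
          then show "norm (h $ i *\<^sub>R (of_real (2 powr real_of_int j) * lam Ts (partial_deriv i f) g j k (x + t *\<^sub>R h) y)) \<le> ?H * (C1 i * (2 powr N * ?V))"
            by (simp add: norm_mult powi_conv_powr mult_ac)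
        qed
        also have "\<dots> = D * 2 powr N * (?H * ?V)"
          unfolding D_def sum_distrib_right by (simp add: mult_ac)
        finally show "norm ?d \<le> D * 2 powr N * (?H * ?V)" .
      qed auto
      then have "norm (?F (x + h) - ?F x) \<le> D * 2 powr N * (?H * ?V)" by simp
      also have "\<dots> \<le> C * (?H powr (\<gamma>' - \<delta>) * ?V)"
      proof (rule mult_mono[OF C(2)])
        have "?H \<le> ?H powr (\<gamma>' - \<delta>)"
        proof (cases "h = 0")
          case False
          then have "0 < ?H" by simp
          then have "?H powr 1 \<le> ?H powr (\<gamma>' - \<delta>)" using \<open>\<not> 1 \<le> ?H\<close> \<delta> by (intro powr_mono') auto
          then show ?thesis using \<open>0 < ?H\<close> by simp
        qed simp
        then show "?H * ?V \<le> ?H powr (\<gamma>' - \<delta>) * ?V" using V by (rule mult_right_mono)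
      qed (use C(3) V in auto)
      finally show ?thesis .
    qed
    then show ?thesis by (simp add: mult_ac)
  qed
  then show ?thesis using C(3) by blast
qed

theorem corollary3p2:
  fixes \<nu> \<gamma> :: real and M L :: nat and T Ts :: "('n::finite) oper"
  assumes "\<nu> \<le> real L" and "real L \<le> real M + \<nu>"
    and "0 < \<gamma>" and "\<gamma> \<le> 1"
    and "SIO \<nu> M \<gamma> T Ts"
    and "\<And>\<alpha>. mi_order \<alpha> \<le> L \<Longrightarrow> annihilates_monomial \<nu> M \<gamma> Ts T \<alpha>"
    and "WBP \<nu> T Ts"
  shows "\<exists>P0. \<forall>P\<ge>P0. \<forall>\<psi>\<in>test_fns0 P. \<forall>\<psi>'\<in>test_fns0 P. radial \<psi> \<and> radial \<psi>' \<longrightarrow>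
    (\<forall>j k. smooth (\<lambda>(x, y). lam Ts \<psi> \<psi>' j k x y)) \<and>
    (\<forall>\<alpha> \<beta> \<delta> \<gamma>'. 0 \<le> \<delta> \<and> \<delta> \<le> \<gamma>' \<and> \<gamma>' < \<gamma> \<longrightarrow>
      (\<exists>C. \<forall>j k x y.
        norm (multi_deriv2 \<alpha> \<beta> (lam Ts \<psi> \<psi>' j k) x y)
          \<le> C * 2 powr ((\<nu> + real (mi_order \<alpha>)) * real_of_int j + real (mi_order \<beta>) * real_of_int k)
              * 2 powr ((real_of_int \<lfloor>real L - \<nu>\<rfloor> + \<gamma>') * real_of_int (min 0 (j - k)))
              * Phi (real CARD('n) + \<nu> + real M + \<gamma>) (min j k) (x - y)) \<and>
      (\<exists>C. \<forall>j k x y h. norm h < (2 powi (- min j k) + norm (x - y)) / 2 \<longrightarrow>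
        norm (multi_deriv2 \<alpha> \<beta> (lam Ts \<psi> \<psi>' j k) (x + h) y
              - multi_deriv2 \<alpha> \<beta> (lam Ts \<psi> \<psi>' j k) x y)
          \<le> C * 2 powr (real_of_int j * (\<nu> + real (mi_order \<alpha>)) + real_of_int k * real (mi_order \<beta>))
              * (2 powi j * norm h) powr (\<gamma>' - \<delta>)
              * 2 powr (real_of_int (min 0 (j - k)) * (real_of_int \<lfloor>real L - \<nu>\<rfloor> + \<delta>))
              * Phi (real CARD('n) + \<nu> + real M + \<gamma>) (min j k) (x - y)))"
proof -
  let ?N = "real CARD('n) + \<nu> + real M + \<gamma>" and ?e = "real_of_int \<lfloor>real L - \<nu>\<rfloor>"
  have N: "0 \<le> ?N" using assms(1-3) by linarith
  obtain P1 where SIO: "SIO_at P1 \<nu> M \<gamma> T Ts" using assms(5) unfolding SIO_def by blast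
  have c: "continuous_oper P1 Ts" using SIO unfolding SIO_at_def by blast
  obtain P2 where P2: "\<forall>P\<ge>P2. narrow_oper P \<nu> M \<gamma> T \<and> narrow_oper P \<nu> M \<gamma> Ts"
    using SIO_WBP_imp_narrow_oper[OF SIO assms(3,7)] by blast
  obtain P3 where P3: "\<forall>P\<ge>P3. \<exists>\<eta>\<in>test_fns. (\<forall>x\<in>ball 0 1. \<eta> x = 1) \<and>
    (\<forall>p \<psi>. poly_deg L p \<longrightarrow> \<psi> \<in> test_fns0 P \<longrightarrow> ((\<lambda>R::real. T \<psi> (\<lambda>x. p x * \<eta> (x /\<^sub>R R))) \<longlongrightarrow> 0) at_top)"
    using annihilates_imp_cancellation[OF SIO assms(6)] by blast
  \<comment> \<open>A single order for the kernel representation, weak boundedness, cancellation and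
    the Taylor expansion of the kernel. Functions with more moments belong to this class too, so
    every estimate is applied with Q.\<close>
  define Q where "Q = P1 + P2 + P3 + M"
  have Q: "P1 \<le> Q" "P2 \<le> Q" "P3 \<le> Q" "M \<le> Q" by (simp_all add: Q_def)
  have S: "narrow_oper Q \<nu> M \<gamma> T" "narrow_oper Q \<nu> M \<gamma> Ts" using P2 Q(2) by blast+
  obtain \<eta> where \<eta>: "\<eta> \<in> test_fns" "\<forall>x\<in>ball 0 1. \<eta> x = 1"
    "\<forall>p \<psi>. poly_deg L p \<longrightarrow> \<psi> \<in> test_fns0 Q \<longrightarrow> ((\<lambda>R::real. T \<psi> (\<lambda>x. p x * \<eta> (x /\<^sub>R R))) \<longlongrightarrow> 0) at_top"
    using P3 Q(3) by blast
  have sch: "f \<in> schwartz0 P1" if "f \<in> test_fns0 Q" for f :: "real ^ 'n \<Rightarrow> complex"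
    by (rule test_fns0_schwartz0[OF test_fns0_mono[OF that Q(1)]])
  have hom: "Ts (\<lambda>x. c * f x) g = c * Ts f g" if "f \<in> test_fns0 Q" "g \<in> test_fns0 Q" for c f g
    using c sch[OF that(1)] test_fns_schwartz[OF test_fns0_imp[OF that(2)]] unfolding continuous_oper_def by blast
  have tr: "T f g = Ts g f" if "f \<in> test_fns0 Q" "g \<in> test_fns0 Q" for f g
  proof -
    have "\<forall>f\<in>schwartz0 P1. \<forall>g\<in>schwartz0 P1. T f g = Ts g f" using SIO unfolding SIO_at_def by (elim conjE)
    then show ?thesis using sch that by blast
  qed
  have bound: "\<exists>C\<ge>0. \<forall>j k x y. norm (lam Ts f g j k x y) \<le> C * 2 powr (\<nu> * real_of_int j)
    * 2 powr ((?e + \<gamma>') * real_of_int (min 0 (j - k))) * Phi ?N (min j k) (x - y)"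
    if "f \<in> test_fns0 Q" "g \<in> test_fns0 Q" "0 \<le> \<gamma>'" "\<gamma>' < \<gamma>" for f g \<gamma>'
    by (rule lam_bound[OF assms(1-3) that(3,4) assms(4) S Q(4) hom tr \<eta>(1) _ _ that(1,2)]) (use \<eta>(2,3) in blast)+
  show ?thesis
  proof (intro exI[of _ Q] allI impI ballI; intro conjI allI impI; (elim conjE)?)
    fix P and \<psi> \<psi>' :: "real ^ 'n \<Rightarrow> complex"
    assume "Q \<le> P" "\<psi> \<in> test_fns0 P" "\<psi>' \<in> test_fns0 P"
    then have \<psi>: "\<psi> \<in> test_fns0 Q" and \<psi>': "\<psi>' \<in> test_fns0 Q" using test_fns0_mono by blast+
    note \<psi>1 = test_fns0_mono[OF \<psi> Q(1)]
    note reg = lam_regularity[OF c \<psi>1 test_fns0_imp[OF \<psi>']]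
    show "smooth (\<lambda>(x, y). lam Ts \<psi> \<psi>' j k x y)" for j k by (rule reg(1))
    fix \<alpha> \<beta> :: "'n \<Rightarrow> nat" and \<delta> \<gamma>' :: real
    assume \<delta>: "0 \<le> \<delta>" "\<delta> \<le> \<gamma>'" "\<gamma>' < \<gamma>"
    then have \<gamma>': "0 \<le> \<gamma>'" "\<gamma>' \<le> 1" using assms(4) by auto
    \<comment> \<open>Derivatives of the pairing are, up to powers of two, pairings of f and g,
      which keep their vanishing moments up to order Q; so the bounds for arbitrary pairs
      apply.\<close>
    define f where "f = iter_pd (mi_list \<alpha>) \<psi>"
    define g where "g = iter_pd (mi_list \<beta>) \<psi>'"
    have f: "f \<in> test_fns0 Q" and g: "g \<in> test_fns0 Q"
      unfolding f_def g_def by (intro test_fns0_iter_pd \<psi> \<psi>')+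
    let ?s = "\<lambda>j k. 2 powr (real_of_int j * real (mi_order \<alpha>) + real_of_int k * real (mi_order \<beta>))"
    have lam: "multi_deriv2 \<alpha> \<beta> (lam Ts \<psi> \<psi>' j k) x y = of_real (?s j k) * lam Ts f g j k x y" for j k x y
      unfolding f_def g_def by (rule reg(2))
    have s: "norm (complex_of_real (?s j k)) = ?s j k" for j k by simp
    obtain C where C: "\<And>j k x y. norm (lam Ts f g j k x y) \<le> C * 2 powr (\<nu> * real_of_int j)
      * 2 powr ((?e + \<gamma>') * real_of_int (min 0 (j - k))) * Phi ?N (min j k) (x - y)"
      using bound[OF f g \<gamma>'(1) \<delta>(3)] by blast
    have "norm (multi_deriv2 \<alpha> \<beta> (lam Ts \<psi> \<psi>' j k) x y)
          \<le> C * 2 powr ((\<nu> + real (mi_order \<alpha>)) * real_of_int j + real (mi_order \<beta>) * real_of_int k)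
              * 2 powr ((?e + \<gamma>') * real_of_int (min 0 (j - k))) * Phi ?N (min j k) (x - y)" for j k x y
    proof -
      have e: "2 powr ((\<nu> + real (mi_order \<alpha>)) * real_of_int j + real (mi_order \<beta>) * real_of_int k) = ?s j k * 2 powr (\<nu> * real_of_int j)"
        unfolding powr_add[symmetric] by (simp add: algebra_simps)
      show ?thesis
        using mult_left_mono[OF C[of j k x y], of "?s j k"] unfolding lam norm_mult s e by (simp add: mult_ac)
    qed
    then show "\<exists>C. \<forall>j k x y. norm (multi_deriv2 \<alpha> \<beta> (lam Ts \<psi> \<psi>' j k) x y)
          \<le> C * 2 powr ((\<nu> + real (mi_order \<alpha>)) * real_of_int j + real (mi_order \<beta>) * real_of_int k)
              * 2 powr ((?e + \<gamma>') * real_of_int (min 0 (j - k))) * Phi ?N (min j k) (x - y)" by blast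
    \<comment> \<open>The size bounds for f and for its first partial derivatives, the input of the
      interpolation, are all instances of \<open>bound\<close>.\<close>
    obtain C' where C': "\<And>j k x y h. norm h < (2 powi (- min j k) + norm (x - y)) / 2 \<Longrightarrow>
      norm (lam Ts f g j k (x + h) y - lam Ts f g j k x y) \<le>
      C' * 2 powr (\<nu> * real_of_int j) * (2 powi j * norm h) powr (\<gamma>' - \<delta>) *
      2 powr (real_of_int (min 0 (j - k)) * (?e + \<delta>)) * Phi ?N (min j k) (x - y)"
      using lam_hoelder_bound[OF c test_fns0_mono[OF f Q(1)] test_fns0_imp[OF g] N \<delta>(1,2) \<gamma>'(2)
          bound[OF test_fns0_iter_pd[OF f] g \<gamma>'(1) \<delta>(3)]] by blast
    have "norm (multi_deriv2 \<alpha> \<beta> (lam Ts \<psi> \<psi>' j k) (x + h) y - multi_deriv2 \<alpha> \<beta> (lam Ts \<psi> \<psi>' j k) x y)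
          \<le> C' * 2 powr (real_of_int j * (\<nu> + real (mi_order \<alpha>)) + real_of_int k * real (mi_order \<beta>))
              * (2 powi j * norm h) powr (\<gamma>' - \<delta>)
              * 2 powr (real_of_int (min 0 (j - k)) * (?e + \<delta>)) * Phi ?N (min j k) (x - y)"
      if h: "norm h < (2 powi (- min j k) + norm (x - y)) / 2" for j k x y h
    proof -
      have e: "2 powr (real_of_int j * (\<nu> + real (mi_order \<alpha>)) + real_of_int k * real (mi_order \<beta>)) = ?s j k * 2 powr (\<nu> * real_of_int j)"
        unfolding powr_add[symmetric] by (simp add: algebra_simps)
      show ?thesis
        using mult_left_mono[OF C'[OF h], of "?s j k"]
        unfolding lam right_diff_distrib[symmetric] norm_mult s e by (simp add: mult_ac)
    qed
    then show "\<exists>C. \<forall>j k x y h. norm h < (2 powi (- min j k) + norm (x - y)) / 2 \<longrightarrow>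
        norm (multi_deriv2 \<alpha> \<beta> (lam Ts \<psi> \<psi>' j k) (x + h) y - multi_deriv2 \<alpha> \<beta> (lam Ts \<psi> \<psi>' j k) x y)
          \<le> C * 2 powr (real_of_int j * (\<nu> + real (mi_order \<alpha>)) + real_of_int k * real (mi_order \<beta>))
              * (2 powi j * norm h) powr (\<gamma>' - \<delta>)
              * 2 powr (real_of_int (min 0 (j - k)) * (?e + \<delta>)) * Phi ?N (min j k) (x - y)" by blast
  qed
qed

end
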